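(* LS Max Cut is W[1]-hard when parameterized by $k$, even on bipartite $2$-degenerate graphs with unit edge weights.
   Context: LS Max Cut: given a graph $G=(V,E)$, a weight function $\omega:E\to\mathbb{Q}$, a partition $(A,B)$ of $V$, and $k\in\mathbb{N}$, decide whether there is a set $S\subseteq V$ with $|S|\le k$ such that $\omega(E(A\oplus S,B\oplus S))>\omega(E(A,B))$, where $E(X,Y)$ is the set of edges with one endpoint in $X$ and the other in $Y$, $\oplus$ is symmetric difference, and $\omega(F)$ is the total weight of an edge set $F$. (Equivalently, LS Max $c$-Cut with $c=2$: given a 2-coloring, is there a coloring changing at most $k$ vertex colors with strictly larger total weight of edges whose endpoints have different colors.) *)

theory Defs
  imports Complex_Main "HOL-Library.Discrete_Functions"
begin

section \<open>Machine model\<close>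

text \<open>
  The machine model is a random access machine with the uniform cost measure whose arithmetic is
  addition and truncated subtraction (no multiplication), so that numbers gain at most a constant
  number of bits per step and running times agree with those of Turing machines up to a polynomial.
  The control flow is structured, and the memory consists of arrays of natural numbers indexed by
  natural numbers; a program can mention only finitely many arrays.
\<close>

datatype aexp =
    Const nat
  | Read nat aexp
  | Add aexp aexp
  | Sub aexp aexp

datatype bexp =
    Less aexp aexp
  | BNot bexp
  | BAnd bexp bexp

datatype com =
    Skip
  | Store nat aexp aexp
  | Seq com com
  | Cond bexp com com
  | While bexp com

type_synonym memory = "nat \<Rightarrow> nat \<Rightarrow> nat"

primrec aval :: "aexp \<Rightarrow> memory \<Rightarrow> nat" where
  "aval (Const n) s = n"
| "aval (Read x a) s = s x (aval a s)"
| "aval (Add a b) s = aval a s + aval b s"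
| "aval (Sub a b) s = aval a s - aval b s"

primrec bval :: "bexp \<Rightarrow> memory \<Rightarrow> bool" where
  "bval (Less a b) s = (aval a s < aval b s)"
| "bval (BNot b) s = (\<not> bval b s)"
| "bval (BAnd b c) s = (bval b s \<and> bval c s)"

text \<open>\<open>exec c s t s'\<close>: started in memory \<open>s\<close>, the program \<open>c\<close> halts after \<open>t\<close> steps in memory \<open>s'\<close>.\<close>

inductive exec :: "com \<Rightarrow> memory \<Rightarrow> nat \<Rightarrow> memory \<Rightarrow> bool" where
  Skip: "exec Skip s 1 s"
| Store: "exec (Store x a b) s 1 (s(x := (s x)(aval a s := aval b s)))"
| Seq: "exec c\<^sub>1 s t\<^sub>1 s' \<Longrightarrow> exec c\<^sub>2 s' t\<^sub>2 s'' \<Longrightarrow> exec (Seq c\<^sub>1 c\<^sub>2) s (t\<^sub>1 + t\<^sub>2) s''"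
| CondTrue: "bval b s \<Longrightarrow> exec c\<^sub>1 s t s' \<Longrightarrow> exec (Cond b c\<^sub>1 c\<^sub>2) s (Suc t) s'"
| CondFalse: "\<not> bval b s \<Longrightarrow> exec c\<^sub>2 s t s' \<Longrightarrow> exec (Cond b c\<^sub>1 c\<^sub>2) s (Suc t) s'"
| WhileFalse: "\<not> bval b s \<Longrightarrow> exec (While b c) s 1 s"
| WhileTrue: "bval b s \<Longrightarrow> exec c s t\<^sub>1 s' \<Longrightarrow> exec (While b c) s' t\<^sub>2 s'' \<Longrightarrow>
    exec (While b c) s (Suc (t\<^sub>1 + t\<^sub>2)) s''"


section \<open>Parameterized problems and fpt-reductions\<close>

text \<open>
  Words are finite sequences of natural numbers, whose size is that of the sequence written out in
  binary. This is interchangeable with words over a finite alphabet (binary numbers with separators).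
\<close>

type_synonym word = "nat list"

definition word_size :: "word \<Rightarrow> nat" where
  "word_size w = (\<Sum>a\<leftarrow>w. floor_log a + 1)"

text \<open>The second component of an instance is its parameter.\<close>

type_synonym parameterized_problem = "(word \<times> nat) set"

text \<open>Array 0 holds the length of the word followed by the word, array 1 holds the parameter.\<close>

definition input_memory :: "word \<Rightarrow> nat \<Rightarrow> memory" where
  "input_memory w k =
     (\<lambda>x i. if x = 0 \<and> i = 0 then length w
            else if x = 0 \<and> i \<le> length w then w ! (i - 1)
            else if x = 1 \<and> i = 0 then k
            else 0)"

definition holds_output :: "memory \<Rightarrow> word \<Rightarrow> nat \<Rightarrow> bool" where
  "holds_output s w k \<longleftrightarrow>
     s 0 0 = length w \<and> (\<forall>i<length w. s 0 (Suc i) = w ! i) \<and> s 1 0 = k"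

definition computable :: "(nat \<Rightarrow> nat) \<Rightarrow> bool" where
  "computable f \<longleftrightarrow> (\<exists>c. \<forall>n. \<exists>t s. exec c (input_memory [] n) t s \<and> s 1 0 = f n)"

text \<open>
  Parameterized (many-one) reduction from \<open>P\<close> to the problem \<open>Q\<close> restricted to the instance set \<open>I\<close>:
  all instances produced lie in \<open>I\<close>. The explicit bound on the size of the output is needed because
  a machine can announce an output length exceeding the number of cells it has written.
\<close>

definition fpt_reducible_on ::
  "(word \<times> nat) set \<Rightarrow> parameterized_problem \<Rightarrow> parameterized_problem \<Rightarrow> bool" where
  "fpt_reducible_on I P Q \<longleftrightarrow>
     (\<exists>c f g e. computable f \<and> computable g \<and>
       (\<forall>w k. \<exists>w' k' t s.
          exec c (input_memory w k) t s \<and> holds_output s w' k' \<and>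
          t \<le> f k * Suc (word_size w) ^ e \<and>
          word_size w' \<le> f k * Suc (word_size w) ^ e \<and>
          k' \<le> g k \<and>
          (w', k') \<in> I \<and>
          ((w, k) \<in> P \<longleftrightarrow> (w', k') \<in> Q)))"


section \<open>Boolean circuits and the W-hierarchy\<close>

text \<open>
  A circuit is the list of its nodes in topological order; a node refers to its predecessors by
  their positions in the list. The last node is the output node.
\<close>

datatype gate =
    Input
  | Neg nat
  | Conj "nat list"
  | Disj "nat list"

primrec preds :: "gate \<Rightarrow> nat list" where
  "preds Input = []"
| "preds (Neg i) = [i]"
| "preds (Conj js) = js"
| "preds (Disj js) = js"

primrec gate_ok :: "gate \<Rightarrow> bool" where
  "gate_ok Input = True"
| "gate_ok (Neg i) = True"
| "gate_ok (Conj js) = (distinct js \<and> length js \<ge> 2)"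
| "gate_ok (Disj js) = (distinct js \<and> length js \<ge> 2)"

type_synonym circuit = "gate list"

definition is_circuit :: "circuit \<Rightarrow> bool" where
  "is_circuit C \<longleftrightarrow>
     C \<noteq> [] \<and> (\<forall>i<length C. gate_ok (C ! i) \<and> (\<forall>j\<in>set (preds (C ! i)). j < i))"

definition input_nodes :: "circuit \<Rightarrow> nat set" where
  "input_nodes C = {i. i < length C \<and> C ! i = Input}"

text \<open>An assignment is given by the set \<open>S\<close> of input nodes that are set to true.\<close>

primrec gate_value :: "nat set \<Rightarrow> bool list \<Rightarrow> gate \<Rightarrow> bool" where
  "gate_value S vs Input \<longleftrightarrow> length vs \<in> S"
| "gate_value S vs (Neg i) \<longleftrightarrow> \<not> vs ! i"
| "gate_value S vs (Conj js) \<longleftrightarrow> (\<forall>j\<in>set js. vs ! j)"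
| "gate_value S vs (Disj js) \<longleftrightarrow> (\<exists>j\<in>set js. vs ! j)"

definition node_values :: "nat set \<Rightarrow> circuit \<Rightarrow> bool list" where
  "node_values S C = foldl (\<lambda>vs g. vs @ [gate_value S vs g]) [] C"

definition satisfies :: "nat set \<Rightarrow> circuit \<Rightarrow> bool" where
  "satisfies S C \<longleftrightarrow> last (node_values S C)"

definition input_output_path :: "circuit \<Rightarrow> nat list \<Rightarrow> bool" where
  "input_output_path C p \<longleftrightarrow>
     p \<noteq> [] \<and> hd p \<in> input_nodes C \<and> last p = length C - 1 \<and> (\<forall>i\<in>set p. i < length C) \<and>
     (\<forall>i. Suc i < length p \<longrightarrow> p ! i \<in> set (preds (C ! (p ! Suc i))))"

definition large_gate :: "gate \<Rightarrow> bool" where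
  "large_gate g \<longleftrightarrow> length (preds g) > 2"

definition depth_at_most :: "nat \<Rightarrow> circuit \<Rightarrow> bool" where
  "depth_at_most d C \<longleftrightarrow> (\<forall>p. input_output_path C p \<longrightarrow> length p - 1 \<le> d)"

definition weft_at_most :: "nat \<Rightarrow> circuit \<Rightarrow> bool" where
  "weft_at_most t C \<longleftrightarrow>
     (\<forall>p. input_output_path C p \<longrightarrow> length (filter (\<lambda>i. large_gate (C ! i)) p) \<le> t)"

primrec encode_gate :: "gate \<Rightarrow> word" where
  "encode_gate Input = [0]"
| "encode_gate (Neg i) = [1, i]"
| "encode_gate (Conj js) = 2 # length js # js"
| "encode_gate (Disj js) = 3 # length js # js"

definition encode_circuit :: "circuit \<Rightarrow> word" where
  "encode_circuit C = concat (map encode_gate C)"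

definition WCS_instances :: "nat \<Rightarrow> nat \<Rightarrow> (word \<times> nat) set" where
  "WCS_instances t d =
     {(encode_circuit C, k) | C k. is_circuit C \<and> weft_at_most t C \<and> depth_at_most d C}"

text \<open>Weighted Circuit Satisfiability; the parameter is the weight of the assignment.\<close>

definition WCS :: parameterized_problem where
  "WCS = {(encode_circuit C, k) | C k. is_circuit C \<and>
            (\<exists>S \<subseteq> input_nodes C. card S = k \<and> satisfies S C)}"

definition W :: "nat \<Rightarrow> parameterized_problem set" where
  "W t = {P. \<exists>d\<ge>1. fpt_reducible_on (WCS_instances t d) P WCS}"

definition W_hard_on :: "nat \<Rightarrow> (word \<times> nat) set \<Rightarrow> parameterized_problem \<Rightarrow> bool" where
  "W_hard_on t I Q \<longleftrightarrow> (\<forall>P\<in>W t. fpt_reducible_on I P Q)"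


section \<open>Local search for Max Cut\<close>

definition simple_graph :: "'v set \<Rightarrow> 'v set set \<Rightarrow> bool" where
  "simple_graph V E \<longleftrightarrow> finite V \<and> (\<forall>e\<in>E. e \<subseteq> V \<and> card e = 2)"

definition bipartite :: "'v set \<Rightarrow> 'v set set \<Rightarrow> bool" where
  "bipartite V E \<longleftrightarrow>
     (\<exists>X Y. X \<union> Y = V \<and> X \<inter> Y = {} \<and> (\<forall>e\<in>E. \<exists>x\<in>X. \<exists>y\<in>Y. e = {x, y}))"

definition degree :: "'v set set \<Rightarrow> 'v \<Rightarrow> nat" where
  "degree E v = card {e \<in> E. v \<in> e}"

definition degenerate :: "nat \<Rightarrow> 'v set \<Rightarrow> 'v set set \<Rightarrow> bool" where
  "degenerate d V E \<longleftrightarrow>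
     (\<forall>V' E'. V' \<subseteq> V \<and> V' \<noteq> {} \<and> E' \<subseteq> E \<and> simple_graph V' E' \<longrightarrow> (\<exists>v\<in>V'. degree E' v \<le> d))"

definition edges_between :: "'v set set \<Rightarrow> 'v set \<Rightarrow> 'v set \<Rightarrow> 'v set set" where
  "edges_between E X Y = {e \<in> E. \<exists>x\<in>X. \<exists>y\<in>Y. e = {x, y}}"

definition total_weight :: "('v set \<Rightarrow> rat) \<Rightarrow> 'v set set \<Rightarrow> rat" where
  "total_weight \<omega> F = (\<Sum>e\<in>F. \<omega> e)"

definition partition_of :: "'v set \<Rightarrow> 'v set \<Rightarrow> 'v set \<Rightarrow> bool" where
  "partition_of V A B \<longleftrightarrow> A \<union> B = V \<and> A \<inter> B = {}"

definition improving_flip ::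
  "'v set \<Rightarrow> 'v set set \<Rightarrow> ('v set \<Rightarrow> rat) \<Rightarrow> 'v set \<Rightarrow> 'v set \<Rightarrow> nat \<Rightarrow> 'v set \<Rightarrow> bool" where
  "improving_flip V E \<omega> A B k S \<longleftrightarrow>
     S \<subseteq> V \<and> card S \<le> k \<and>
     total_weight \<omega> (edges_between E (sym_diff A S) (sym_diff B S)) >
     total_weight \<omega> (edges_between E A B)"

definition encode_rat :: "rat \<Rightarrow> word" where
  "encode_rat q = (let (a, b) = quotient_of q in [if a < 0 then 1 else 0, nat \<bar>a\<bar>, nat b])"

text \<open>
  \<open>encodes w V E \<omega> A B\<close>: the word \<open>w\<close> represents the graph with vertex set \<open>V = {0..<n}\<close> and edge
  set \<open>E\<close>, listed in some order together with the weights, and the partition \<open>(A, B)\<close> of \<open>V\<close>, given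
  by one bit per vertex.
\<close>

definition encodes ::
  "word \<Rightarrow> nat set \<Rightarrow> nat set set \<Rightarrow> (nat set \<Rightarrow> rat) \<Rightarrow> nat set \<Rightarrow> nat set \<Rightarrow> bool" where
  "encodes w V E \<omega> A B \<longleftrightarrow>
     simple_graph V E \<and> partition_of V A B \<and>
     (\<exists>n es. V = {0..<n} \<and>
        distinct (map (\<lambda>(u, v). {u, v}) es) \<and> E = set (map (\<lambda>(u, v). {u, v}) es) \<and>
        w = [n, length es] @ concat (map (\<lambda>(u, v). [u, v] @ encode_rat (\<omega> {u, v})) es)
              @ map (\<lambda>v. if v \<in> A then 1 else 0) [0..<n])"

text \<open>The parameter is the bound \<open>k\<close> on the number of vertices that change sides.\<close>

definition LS_Max_Cut :: parameterized_problem where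
  "LS_Max_Cut =
     {(w, k). \<exists>V E \<omega> A B. encodes w V E \<omega> A B \<and> (\<exists>S. improving_flip V E \<omega> A B k S)}"

definition bipartite_2_degenerate_unit_weight_instances :: "(word \<times> nat) set" where
  "bipartite_2_degenerate_unit_weight_instances =
     {(w, k). \<exists>V E \<omega> A B. encodes w V E \<omega> A B \<and>
        bipartite V E \<and> degenerate 2 V E \<and> (\<forall>e\<in>E. \<omega> e = 1)}"

end

theory Submission
  imports Defs
begin

text \<open>
  Let \<open>C\<close> be a circuit of weft 1 and depth \<open>d\<close>. A satisfying assignment of weight \<open>k\<close> is an increasing
  sequence \<open>a\<^sub>0 < \<dots> < a\<^sub>k\<^sub>+\<^sub>1\<close> of positions with sentinels at both ends; membership of an input in
  the assignment is visible from one entry of the sequence, non-membership from two consecutive ones.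
  That the output is true follows from at most \<open>2 ^ d\<close> assumptions on inputs, on large conjunctions
  being true and on large disjunctions being false, and a false assumption of this kind is refuted by the
  values of at most \<open>2 ^ d\<close> inputs, hence by at most \<open>R = 2 * 2 ^ d\<close> entries of the sequence. So
  \<open>C\<close> has such an assignment iff there is a clique of size \<open>\<kappa> = (k + 2) ^ R\<close> in the graph whose
  vertices (\<^emph>\<open>rows\<close>) consist of a list of assumptions, \<open>R\<close> indices and the \<open>R\<close> claimed entries at these
  indices, where the assumptions are not refuted by the entries and adjacent rows have the same
  assumptions and agree in the order of the entries.

  Clique is reduced to local search on a graph in which every vertex outside an independent base set
  has degree two. All vertices of the clique instance lie on one side; each pair of adjacent ones is
  joined by \<open>2 * \<kappa>\<close> paths of length two through the other side, and further degree-two neighbours, whose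
  second neighbour is a hub that is too expensive to flip, adjust the loss for flipping a single vertex to
  \<open>2 * (\<kappa> * (\<kappa> - 1) - 1)\<close>. Flipping \<open>a\<close> vertices together with \<open>e\<close> midpoints of paths between them then
  gains at most \<open>2 * e - 2 * (\<kappa> * (\<kappa> - 1) - 1) * a\<close>, which within the budget of flips is positive only
  for \<open>\<kappa>\<close> pairwise adjacent vertices and all their midpoints.

  Adjacency of rows is a formula with quantifiers bounded by the input size, so it is decided by nested
  loops, and all loops of the program are bounded by two precomputed powers of the input size.
\<close>


section \<open>Renaming arrays and computable functions\<close>

text \<open>The obstacle is that a large gate reads unboundedly many inputs, so boundedly many
  entries of the sequence cannot certify its value. Hence only claims whose negation has a bounded
  witness are assumed: if a claimed large conjunction is false, one false predecessor shows it, and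
  in weft 1 this predecessor has no large gate below it, so boundedly many inputs fix its value. A
  clique of the prescribed size uses every tuple of \<open>R\<close> indices exactly once, because
  compatible rows with the same indices have the same entries and hence coincide. Thus the entries
  form one global sequence, and any \<open>R\<close> of its positions are inspected together by some
  row, so no refutation is missed. In the cut instance the factor \<open>\<kappa>\<close> on the
  number of midpoints creates slack: a clique with all midpoints gains \<open>2 * \<kappa>\<close>,
  and a single missing ordered pair costs just that. Fewer vertices span too few pairs, and more
  vertices leave too little budget for midpoints. With unit weights, every weight becomes a number
  of parallel vertices of degree two, which also yields bipartiteness and degeneracy.\<close>

primrec rename_aexp :: "(nat \<Rightarrow> nat) \<Rightarrow> aexp \<Rightarrow> aexp" where
  "rename_aexp \<rho> (Const n) = Const n"
| "rename_aexp \<rho> (Read x a) = Read (\<rho> x) (rename_aexp \<rho> a)"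
| "rename_aexp \<rho> (Add a b) = Add (rename_aexp \<rho> a) (rename_aexp \<rho> b)"
| "rename_aexp \<rho> (Sub a b) = Sub (rename_aexp \<rho> a) (rename_aexp \<rho> b)"

primrec rename_bexp :: "(nat \<Rightarrow> nat) \<Rightarrow> bexp \<Rightarrow> bexp" where
  "rename_bexp \<rho> (Less a b) = Less (rename_aexp \<rho> a) (rename_aexp \<rho> b)"
| "rename_bexp \<rho> (BNot b) = BNot (rename_bexp \<rho> b)"
| "rename_bexp \<rho> (BAnd b c) = BAnd (rename_bexp \<rho> b) (rename_bexp \<rho> c)"

primrec rename_com :: "(nat \<Rightarrow> nat) \<Rightarrow> com \<Rightarrow> com" where
  "rename_com \<rho> Skip = Skip"
| "rename_com \<rho> (Store x a b) = Store (\<rho> x) (rename_aexp \<rho> a) (rename_aexp \<rho> b)"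
| "rename_com \<rho> (Seq c d) = Seq (rename_com \<rho> c) (rename_com \<rho> d)"
| "rename_com \<rho> (Cond b c d) = Cond (rename_bexp \<rho> b) (rename_com \<rho> c) (rename_com \<rho> d)"
| "rename_com \<rho> (While b c) = While (rename_bexp \<rho> b) (rename_com \<rho> c)"

lemma aval_rename: "(\<And>x. u (\<rho> x) = s x) \<Longrightarrow> aval (rename_aexp \<rho> a) u = aval a s"
  by (induction a) auto

lemma bval_rename: "(\<And>x. u (\<rho> x) = s x) \<Longrightarrow> bval (rename_bexp \<rho> b) u = bval b s"
  by (induction b) (auto simp: aval_rename)

text \<open>Foreign programs are run on private copies of their arrays. Since every array outside
  the range of \<open>\<rho>\<close> survives, their results and any other data can be kept while
  the next program runs.\<close>

lemma exec_rename:
  assumes "exec c s t s'" "inj \<rho>" "\<And>x. u (\<rho> x) = s x"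
  shows "\<exists>u'. exec (rename_com \<rho> c) u t u' \<and> (\<forall>x. u' (\<rho> x) = s' x) \<and> (\<forall>y. y \<notin> range \<rho> \<longrightarrow> u' y = u y)"
  using assms
proof (induction arbitrary: u rule: exec.induct)
  case (Skip s)
  then show ?case using exec.Skip[of u] by (intro exI[of _ u]) simp
next
  case (Store x a b s)
  have "exec (rename_com \<rho> (Store x a b)) u 1
      (u(\<rho> x := (u (\<rho> x))(aval a s := aval b s)))"
    using exec.Store[of "\<rho> x" "rename_aexp \<rho> a" "rename_aexp \<rho> b" u] Store
    by (simp add: aval_rename)
  moreover have "(u(\<rho> x := (u (\<rho> x))(aval a s := aval b s))) (\<rho> y)
      = (s(x := (s x)(aval a s := aval b s))) y" for y
    using Store by (auto dest: injD)
  ultimately show ?case by fastforce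
next
  case (Seq c1 s t1 s' c2 t2 s'')
  from Seq.IH(1)[OF Seq.prems] obtain u1 where u1: "exec (rename_com \<rho> c1) u t1 u1"
    "\<And>x. u1 (\<rho> x) = s' x" "\<And>y. y \<notin> range \<rho> \<Longrightarrow> u1 y = u y" by blast
  from Seq.IH(2)[OF Seq.prems(1) u1(2)] obtain u2 where "exec (rename_com \<rho> c2) u1 t2 u2"
    "\<And>x. u2 (\<rho> x) = s'' x" "\<And>y. y \<notin> range \<rho> \<Longrightarrow> u2 y = u1 y" by blast
  with u1 show ?case by (auto intro!: exI[of _ u2] exec.Seq)
next
  case (CondTrue b s c1 t s' c2)
  from CondTrue.IH[OF CondTrue.prems] obtain u1 where "exec (rename_com \<rho> c1) u t u1"
    "\<And>x. u1 (\<rho> x) = s' x" "\<And>y. y \<notin> range \<rho> \<Longrightarrow> u1 y = u y" by blast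
  with CondTrue.hyps CondTrue.prems show ?case
    by (auto intro!: exI[of _ u1] exec.CondTrue simp: bval_rename)
next
  case (CondFalse b s c2 t s' c1)
  from CondFalse.IH[OF CondFalse.prems] obtain u1 where "exec (rename_com \<rho> c2) u t u1"
    "\<And>x. u1 (\<rho> x) = s' x" "\<And>y. y \<notin> range \<rho> \<Longrightarrow> u1 y = u y" by blast
  with CondFalse.hyps CondFalse.prems show ?case
    by (auto intro!: exI[of _ u1] exec.CondFalse simp: bval_rename)
next
  case (WhileFalse b s c)
  then show ?case
    using exec.WhileFalse[of "rename_bexp \<rho> b" u] by (intro exI[of _ u]) (simp add: bval_rename)
next
  case (WhileTrue b s c t1 s' t2 s'')
  from WhileTrue.IH(1)[OF WhileTrue.prems] obtain u1 where u1: "exec (rename_com \<rho> c) u t1 u1"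
    "\<And>x. u1 (\<rho> x) = s' x" "\<And>y. y \<notin> range \<rho> \<Longrightarrow> u1 y = u y" by blast
  from WhileTrue.IH(2)[OF WhileTrue.prems(1) u1(2)] obtain u2 where
    "exec (rename_com \<rho> (While b c)) u1 t2 u2"
    "\<And>x. u2 (\<rho> x) = s'' x" "\<And>y. y \<notin> range \<rho> \<Longrightarrow> u2 y = u1 y" by blast
  with u1 WhileTrue.hyps WhileTrue.prems show ?case
    by (auto intro!: exI[of _ u2] exec.WhileTrue simp: bval_rename)
qed

section \<open>Closure of computable functions under arithmetic operations\<close>

lemma computable_const: "computable (\<lambda>n. a)"
proof -
  have "\<exists>t s. exec (Store 1 (Const 0) (Const a)) (input_memory [] n) t s \<and> s 1 0 = a" for n
    by (intro exI conjI, rule exec.Store) simp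
  then show ?thesis unfolding computable_def by blast
qed

lemma computable_binary:
  assumes f: "computable f" and g: "computable g"
    and op: "\<And>s. \<exists>t s'. exec c s t s' \<and> s' 1 0 = h (s 6 0) (s 7 0)"
  shows "computable (\<lambda>n. h (f n) (g n))"
proof -
  obtain cf where cf: "\<And>n. \<exists>t s. exec cf (input_memory [] n) t s \<and> s 1 0 = f n"
    using f unfolding computable_def by blast
  obtain cg where cg: "\<And>n. \<exists>t s. exec cg (input_memory [] n) t s \<and> s 1 0 = g n"
    using g unfolding computable_def by blast
  \<comment> \<open>The ranges are disjoint and avoid array 1, so \<open>n\<close> stays available
    for the second program; array 1 is sent to 6 and 7, the arrays from which \<open>c\<close> reads
    its operands.\<close>
  define \<rho>f where "\<rho>f = (\<lambda>x::nat. 3 * x + 3)"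
  define \<rho>g where "\<rho>g = (\<lambda>x::nat. 3 * x + 4)"
  have injs: "inj \<rho>f" "inj \<rho>g" by (auto simp: inj_def \<rho>f_def \<rho>g_def)
  have nf: "1 \<notin> range \<rho>f" "\<And>x. \<rho>g x \<notin> range \<rho>f" and ng: "\<And>x. \<rho>f x \<notin> range \<rho>g" "Suc 0 \<notin> range \<rho>g"
    by (auto simp: \<rho>f_def \<rho>g_def) presburger+
  define P where "P = Seq (Store 6 (Const 0) (Read 1 (Const 0))) (Seq (rename_com \<rho>f cf)
    (Seq (Store 7 (Const 0) (Read 1 (Const 0))) (Seq (rename_com \<rho>g cg) c)))"
  have "\<exists>t s. exec P (input_memory [] n) t s \<and> s 1 0 = h (f n) (g n)" for n
  proof -
    let ?s0 = "input_memory [] n"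
    define s1 where "s1 = ?s0(6 := (?s0 6)(0 := n))"
    have e1: "exec (Store 6 (Const 0) (Read 1 (Const 0))) ?s0 1 s1"
      using exec.Store[of 6 "Const 0" "Read 1 (Const 0)" ?s0]
      by (simp add: s1_def input_memory_def)
    have "s1 (\<rho>f x) = input_memory [] n x" for x
      by (auto simp: s1_def \<rho>f_def input_memory_def fun_eq_iff)
    note r1 = this
    obtain t2 s' where s': "exec cf (input_memory [] n) t2 s'" "s' 1 0 = f n" using cf by blast
    obtain s2 where e2: "exec (rename_com \<rho>f cf) s1 t2 s2" and s2: "\<And>x. s2 (\<rho>f x) = s' x"
      "\<And>y. y \<notin> range \<rho>f \<Longrightarrow> s2 y = s1 y"
      using exec_rename[OF s'(1) injs(1) r1] by blast
    define s3 where "s3 = s2(7 := (s2 7)(0 := s2 1 0))"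
    have e3: "exec (Store 7 (Const 0) (Read 1 (Const 0))) s2 1 s3"
      using exec.Store[of 7 "Const 0" "Read 1 (Const 0)" s2] by (simp add: s3_def)
    have "s3 (\<rho>g x) = input_memory [] n x" for x
      using s2(2)[OF nf(1)] s2(2)[OF nf(2), of x]
      by (auto simp: s3_def s1_def \<rho>g_def input_memory_def fun_eq_iff)
    note r3 = this
    obtain t4 s'' where s'': "exec cg (input_memory [] n) t4 s''" "s'' 1 0 = g n" using cg by blast
    obtain s4 where e4: "exec (rename_com \<rho>g cg) s3 t4 s4" and s4: "\<And>x. s4 (\<rho>g x) = s'' x"
      "\<And>y. y \<notin> range \<rho>g \<Longrightarrow> s4 y = s3 y"
      using exec_rename[OF s''(1) injs(2) r3] by blast
    obtain t5 s5 where e5: "exec c s4 t5 s5" "s5 1 0 = h (s4 6 0) (s4 7 0)" using op by blast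
    have "s4 7 0 = g n" using s4(1)[of 1] s''(2) by (simp add: \<rho>g_def)
    moreover have "s4 6 0 = f n"
      using s4(2)[OF ng(1), of 1] s2(1)[of 1] s'(2) by (simp add: \<rho>f_def s3_def)
    ultimately have "s5 1 0 = h (f n) (g n)" using e5(2) by simp
    then show ?thesis
      using exec.Seq[OF e1 exec.Seq[OF e2 exec.Seq[OF e3 exec.Seq[OF e4 e5(1)]]]]
      unfolding P_def by blast
  qed
  then show ?thesis unfolding computable_def by blast
qed

lemma computable_add: "computable f \<Longrightarrow> computable g \<Longrightarrow> computable (\<lambda>n. f n + g n)"
proof (rule computable_binary[where h = "(+)"])
  show "\<exists>t s'. exec (Store 1 (Const 0) (Add (Read 6 (Const 0)) (Read 7 (Const 0)))) s t s' \<and>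
      s' 1 0 = s 6 0 + s 7 0" for s
    by (intro exI conjI, rule exec.Store) simp
qed

lemma computable_mult: "computable f \<Longrightarrow> computable g \<Longrightarrow> computable (\<lambda>n. f n * g n)"
proof (rule computable_binary[where h = "(*)"])
  let ?b = "Seq (Store 1 (Const 0) (Add (Read 1 (Const 0)) (Read 7 (Const 0))))
    (Store 6 (Const 0) (Sub (Read 6 (Const 0)) (Const 1)))"
  let ?w = "While (Less (Const 0) (Read 6 (Const 0))) ?b"
  \<comment> \<open>Stated with the accumulator \<open>s 1 0\<close>, since the induction on the
    counter \<open>s 6 0\<close> passes through memories with a nonzero partial sum.\<close>
  have loop: "\<exists>t s'. exec ?w s t s' \<and> s' 1 0 = s 1 0 + s 6 0 * s 7 0" for s
  proof (induction "s 6 0" arbitrary: s)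
    case 0
    then show ?case by (intro exI[of _ 1] exI[of _ s] conjI exec.WhileFalse) auto
  next
    case (Suc n)
    define s1 where "s1 = s(1 := (s 1)(0 := s 1 0 + s 7 0))"
    define s2 where "s2 = s1(6 := (s1 6)(0 := s1 6 0 - 1))"
    have "exec ?b s (1 + 1) s2"
      using exec.Store[of 1 "Const 0" "Add (Read 1 (Const 0)) (Read 7 (Const 0))" s]
        exec.Store[of 6 "Const 0" "Sub (Read 6 (Const 0)) (Const 1)" s1]
      by (intro exec.Seq[of _ _ _ s1]) (simp_all add: s1_def s2_def)
    moreover have s2: "s2 6 0 = n" "s2 7 0 = s 7 0" "s2 1 0 = s 1 0 + s 7 0"
      using Suc(2)[symmetric] by (simp_all add: s1_def s2_def)
    moreover from Suc(1)[of s2, OF s2(1)[symmetric]] obtain t s' where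
      "exec ?w s2 t s'" "s' 1 0 = s2 1 0 + s2 6 0 * s2 7 0" by blast
    moreover have "bval (Less (Const 0) (Read 6 (Const 0))) s" using Suc(2) by simp
    ultimately have "exec ?w s (Suc (1 + 1 + t)) s'" "s' 1 0 = s 1 0 + Suc n * s 7 0"
      using exec.WhileTrue by (blast, simp)
    then show ?case using Suc(2) by metis
  qed
  show "\<exists>t s'. exec (Seq (Store 1 (Const 0) (Const 0)) ?w) s t s' \<and> s' 1 0 = s 6 0 * s 7 0" for s
  proof -
    obtain t s' where "exec ?w (s(1 := (s 1)(0 := 0))) t s'" "s' 1 0 = s 6 0 * s 7 0"
      using loop[of "s(1 := (s 1)(0 := 0))"] by auto
    then show ?thesis
      using exec.Seq[OF exec.Store[of 1 "Const 0" "Const 0" s]] by fastforce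
  qed
qed

lemma computable_power: "computable f \<Longrightarrow> computable (\<lambda>n. f n ^ e)"
  by (induction e) (simp_all add: computable_const computable_mult)

section \<open>Programs with bounded loops\<close>

text \<open>The bound of a loop is read from array 2, which programs may not change.\<close>

datatype prog =
    PSkip
  | PStore nat aexp aexp
  | PSeq prog prog
  | PIf bexp prog prog
  | PFor nat nat prog

primrec compile :: "prog \<Rightarrow> com" where
  "compile PSkip = Skip"
| "compile (PStore x a b) = Store x a b"
| "compile (PSeq p q) = Seq (compile p) (compile q)"
| "compile (PIf b p q) = Cond b (compile p) (compile q)"
| "compile (PFor x j p) = Seq (Store x (Const 0) (Const 0))
     (While (Less (Read x (Const 0)) (Read 2 (Const j)))
       (Seq (compile p) (Store x (Const 0) (Add (Read x (Const 0)) (Const 1)))))"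

definition set_cell :: "nat \<Rightarrow> nat \<Rightarrow> nat \<Rightarrow> memory \<Rightarrow> memory" where
  "set_cell x i a s = s(x := (s x)(i := a))"

lemma exec_Store: "exec (Store x a b) s 1 (set_cell x (aval a s) (aval b s) s)"
  unfolding set_cell_def by (rule exec.Store)

lemma set_cell_apply: "set_cell x i a s y j = (if y = x \<and> j = i then a else s y j)"
  by (simp add: set_cell_def)

lemma set_cell_other [simp]: "y \<noteq> x \<Longrightarrow> set_cell x i a s y = s y"
  by (simp add: set_cell_def)

lemma set_cell_same [simp]: "set_cell x i a s x = (s x)(i := a)"
  by (simp add: set_cell_def)

text \<open>Bounded loops make the semantics a total function: correctness is proved by rewriting
  with \<open>sem\<close>, and steps are counted once and for all in
  \<open>exec_compile\<close>.\<close>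

primrec sem :: "prog \<Rightarrow> memory \<Rightarrow> memory" where
  "sem PSkip s = s"
| "sem (PStore x a b) s = set_cell x (aval a s) (aval b s) s"
| "sem (PSeq p q) s = sem q (sem p s)"
| "sem (PIf b p q) s = (if bval b s then sem p s else sem q s)"
| "sem (PFor x j p) s =
     ((\<lambda>s. set_cell x 0 (Suc (sem p s x 0)) (sem p s)) ^^ (s 2 j)) (set_cell x 0 0 s)"

primrec writes :: "prog \<Rightarrow> nat set" where
  "writes PSkip = {}"
| "writes (PStore x a b) = {x}"
| "writes (PSeq p q) = writes p \<union> writes q"
| "writes (PIf b p q) = writes p \<union> writes q"
| "writes (PFor x j p) = insert x (writes p)"

primrec wf_prog :: "prog \<Rightarrow> bool" where
  "wf_prog PSkip = True"
| "wf_prog (PStore x a b) = (x \<noteq> 2)"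
| "wf_prog (PSeq p q) = (wf_prog p \<and> wf_prog q)"
| "wf_prog (PIf b p q) = (wf_prog p \<and> wf_prog q)"
| "wf_prog (PFor x j p) = (x \<noteq> 2 \<and> x \<notin> writes p \<and> wf_prog p)"

primrec loop_depth :: "prog \<Rightarrow> nat" where
  "loop_depth PSkip = 0"
| "loop_depth (PStore x a b) = 0"
| "loop_depth (PSeq p q) = max (loop_depth p) (loop_depth q)"
| "loop_depth (PIf b p q) = max (loop_depth p) (loop_depth q)"
| "loop_depth (PFor x j p) = Suc (loop_depth p)"

primrec weight :: "prog \<Rightarrow> nat" where
  "weight PSkip = 1"
| "weight (PStore x a b) = 1"
| "weight (PSeq p q) = weight p + weight q"
| "weight (PIf b p q) = Suc (weight p + weight q)"
| "weight (PFor x j p) = weight p + 4"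

lemma sem_frame: "x \<notin> writes p \<Longrightarrow> sem p s x = s x"
proof (induction p arbitrary: s)
  case (PFor y j p)
  have "((\<lambda>s. set_cell y 0 (Suc (sem p s y 0)) (sem p s)) ^^ n) u x = u x" for n u
    using PFor by (induction n) auto
  then show ?case using PFor.prems by simp
qed auto

lemma caps_not_written: "wf_prog p \<Longrightarrow> 2 \<notin> writes p"
  by (induction p) auto

lemma sem_caps: "wf_prog p \<Longrightarrow> sem p s 2 = s 2"
  by (simp add: sem_frame caps_not_written)

text \<open>Invariant rule for loops. The value of the counter and the unchanged bounds are supplied
  in the step, so \<open>I\<close> need not mention them.\<close>

lemma sem_For_induct:
  assumes "wf_prog (PFor x j p)"
    and "I 0 (set_cell x 0 0 s)"
    and "\<And>i u. \<lbrakk>i < s 2 j; I i u; u x 0 = i; u 2 = s 2\<rbrakk> \<Longrightarrow> I (Suc i) (set_cell x 0 (Suc i) (sem p u))"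
  shows "I (s 2 j) (sem (PFor x j p) s)"
proof -
  let ?f = "\<lambda>s. set_cell x 0 (Suc (sem p s x 0)) (sem p s)"
  have "i \<le> s 2 j \<Longrightarrow> I i ((?f ^^ i) (set_cell x 0 0 s)) \<and> (?f ^^ i) (set_cell x 0 0 s) x 0 = i
      \<and> (?f ^^ i) (set_cell x 0 0 s) 2 = s 2" for i
  proof (induction i)
    case 0
    then show ?case using assms(1,2) by simp
  next
    case (Suc i)
    then have IH: "I i ((?f ^^ i) (set_cell x 0 0 s))" "(?f ^^ i) (set_cell x 0 0 s) x 0 = i"
      "(?f ^^ i) (set_cell x 0 0 s) 2 = s 2" by auto
    then show ?case
      using assms(1) assms(3)[OF _ IH] Suc.prems by (simp add: sem_frame sem_caps)
  qed
  then show ?thesis by simp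
qed

text \<open>If the body takes at most \<open>T\<close> steps, a loop takes at most
  \<open>N * (T + 2) + 2\<close>; the summand 4 in its \<open>weight\<close> absorbs the overhead,
  and each nesting level contributes one factor \<open>Suc N\<close>.\<close>

lemma exec_compile:
  assumes "wf_prog p" "\<And>j. s 2 j \<le> N"
  shows "\<exists>t. exec (compile p) s t (sem p s) \<and> t \<le> weight p * Suc N ^ loop_depth p"
  using assms
proof (induction p arbitrary: s)
  case PSkip
  then show ?case using exec.Skip[of s] by (intro exI[of _ 1]) simp
next
  case (PStore x a b)
  then show ?case using exec_Store[of x a b s] by (intro exI[of _ 1]) simp
next
  case (PSeq p q)
  obtain t where t: "exec (compile p) s t (sem p s)" "t \<le> weight p * Suc N ^ loop_depth p"
    using PSeq.IH(1)[of s] PSeq.prems by auto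
  obtain t' where t': "exec (compile q) (sem p s) t' (sem q (sem p s))"
    "t' \<le> weight q * Suc N ^ loop_depth q"
    using PSeq.IH(2)[of "sem p s"] PSeq.prems by (auto simp: sem_caps)
  have "Suc N ^ loop_depth p \<le> Suc N ^ loop_depth (PSeq p q)"
    "Suc N ^ loop_depth q \<le> Suc N ^ loop_depth (PSeq p q)"
    by (intro power_increasing; simp)+
  then have "t \<le> weight p * Suc N ^ loop_depth (PSeq p q)"
    "t' \<le> weight q * Suc N ^ loop_depth (PSeq p q)"
    using t(2) t'(2) by (meson le_trans mult_le_mono2)+
  then have "t + t' \<le> weight (PSeq p q) * Suc N ^ loop_depth (PSeq p q)"
    by (simp only: weight.simps add_mult_distrib add_mono)
  then show ?case using exec.Seq[OF t(1) t'(1)] by auto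
next
  case (PIf b p q)
  let ?M = "Suc N ^ loop_depth (PIf b p q)"
  obtain t where t: "exec (compile p) s t (sem p s)" "t \<le> weight p * Suc N ^ loop_depth p"
    using PIf.IH(1)[of s] PIf.prems by auto
  obtain t' where t': "exec (compile q) s t' (sem q s)" "t' \<le> weight q * Suc N ^ loop_depth q"
    using PIf.IH(2)[of s] PIf.prems by auto
  have "Suc N ^ loop_depth p \<le> ?M" "Suc N ^ loop_depth q \<le> ?M"
    by (intro power_increasing; simp)+
  then have "t \<le> weight p * ?M" "t' \<le> weight q * ?M"
    using t(2) t'(2) by (meson le_trans mult_le_mono2)+
  moreover have "1 \<le> ?M" by simp
  moreover have "weight (PIf b p q) * ?M = ?M + weight p * ?M + weight q * ?M"
    by (simp only: weight.simps mult_Suc add_mult_distrib add.assoc)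
  ultimately have "Suc t \<le> weight (PIf b p q) * ?M" "Suc t' \<le> weight (PIf b p q) * ?M"
    by linarith+
  then show ?case
    using exec.CondTrue[OF _ t(1), of b "compile q"] exec.CondFalse[OF _ t'(1), of b "compile p"]
    by (cases "bval b s") auto
next
  case (PFor x j p)
  let ?c = "Less (Read x (Const 0)) (Read 2 (Const j))"
  let ?b = "Seq (compile p) (Store x (Const 0) (Add (Read x (Const 0)) (Const 1)))"
  let ?f = "\<lambda>s. set_cell x 0 (Suc (sem p s x 0)) (sem p s)"
  let ?T = "weight p * Suc N ^ loop_depth p"
  have wf: "x \<noteq> 2" "x \<notin> writes p" "wf_prog p" using PFor.prems by auto
  have loop: "\<exists>t. exec (While ?c ?b) u t ((?f ^^ n) u) \<and> t \<le> n * (?T + 2) + 1"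
    if "u 2 = s 2" "u x 0 + n = s 2 j" for n u
    using that
  proof (induction n arbitrary: u)
    case 0
    then show ?case using exec.WhileFalse[of ?c u] by (intro exI[of _ 1]) simp
  next
    case (Suc n)
    obtain t where t: "exec (compile p) u t (sem p u)" "t \<le> ?T"
      using PFor.IH[of u] wf PFor.prems Suc.prems by auto
    have b: "exec ?b u (t + 1) (?f u)"
      using exec.Seq[OF t(1) exec_Store[of x "Const 0" "Add (Read x (Const 0)) (Const 1)"]] by simp
    have "?f u 2 = s 2" "?f u x 0 + n = s 2 j"
      using Suc.prems wf by (simp_all add: sem_frame sem_caps)
    from Suc.IH[OF this] obtain t' where t': "exec (While ?c ?b) (?f u) t' ((?f ^^ n) (?f u))"
      "t' \<le> n * (?T + 2) + 1" by blast
    have "bval ?c u" using Suc.prems by simp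
    moreover have "(?f ^^ n) (?f u) = (?f ^^ Suc n) u"
      by (simp only: funpow_Suc_right o_apply)
    ultimately have "exec (While ?c ?b) u (Suc (t + 1 + t')) ((?f ^^ Suc n) u)"
      using exec.WhileTrue[OF _ b t'(1)] by metis
    moreover have "Suc (t + 1 + t') \<le> Suc n * (?T + 2) + 1" using t(2) t'(2) by simp
    ultimately show ?case by blast
  qed
  obtain t where t: "exec (While ?c ?b) (set_cell x 0 0 s) t (sem (PFor x j p) s)"
    "t \<le> s 2 j * (?T + 2) + 1"
    using loop[of "set_cell x 0 0 s" "s 2 j"] wf by auto
  have "s 2 j * (?T + 2) + 1 \<le> N * (?T + 2) + 1"
    using PFor.prems(2)[of j] by (intro add_mono mult_right_mono) auto
  moreover have "1 + (N * (?T + 2) + 1) \<le> (weight p + 4) * (Suc N * Suc N ^ loop_depth p)"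
  proof -
    have "1 \<le> Suc N ^ loop_depth p" by simp
    then have "N * 2 + 2 \<le> (N * 2 + 2) * Suc N ^ loop_depth p" by (metis mult_le_mono2 mult.right_neutral)
    then show ?thesis by (simp add: algebra_simps)
  qed
  ultimately have "1 + t \<le> weight (PFor x j p) * Suc N ^ loop_depth (PFor x j p)"
    using t(2) by simp
  moreover have "exec (Store x (Const 0) (Const 0)) s 1 (set_cell x 0 0 s)"
    using exec_Store[of x "Const 0" "Const 0" s] by simp
  ultimately show ?case using exec.Seq[OF _ t(1)] unfolding compile.simps by blast
qed

subsection \<open>Formulas with bounded quantifiers\<close>

datatype fm = FB bexp | FN fm | FA fm fm | FE fm

definition qvar :: "nat \<Rightarrow> nat" where "qvar l = 20 + 2 * l"
definition flag :: "nat \<Rightarrow> nat" where "flag l = 21 + 2 * l"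

text \<open>The argument \<open>l\<close> is a de Bruijn level. The quantifier at depth
  \<open>l\<close> keeps its variable in the memory, in the array \<open>qvar l\<close>, exactly
  where the compiled loop has its counter.\<close>

primrec fval :: "nat \<Rightarrow> fm \<Rightarrow> memory \<Rightarrow> bool" where
  "fval l (FB b) s = bval b s"
| "fval l (FN \<phi>) s = (\<not> fval l \<phi> s)"
| "fval l (FA \<phi> \<psi>) s = (fval l \<phi> s \<and> fval l \<psi> s)"
| "fval l (FE \<phi>) s = (\<exists>i < s 2 0. fval (Suc l) \<phi> (set_cell (qvar l) 0 i s))"

primrec wf_aexp :: "nat \<Rightarrow> aexp \<Rightarrow> bool" where
  "wf_aexp l (Const n) = True"
| "wf_aexp l (Read x a) = (wf_aexp l a \<and> (x < 20 \<or> a = Const 0 \<and> (\<exists>m<l. x = qvar m)))"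
| "wf_aexp l (Add a b) = (wf_aexp l a \<and> wf_aexp l b)"
| "wf_aexp l (Sub a b) = (wf_aexp l a \<and> wf_aexp l b)"

primrec wf_bexp :: "nat \<Rightarrow> bexp \<Rightarrow> bool" where
  "wf_bexp l (Less a b) = (wf_aexp l a \<and> wf_aexp l b)"
| "wf_bexp l (BNot b) = wf_bexp l b"
| "wf_bexp l (BAnd b c) = (wf_bexp l b \<and> wf_bexp l c)"

primrec wf_fm :: "nat \<Rightarrow> fm \<Rightarrow> bool" where
  "wf_fm l (FB b) = wf_bexp l b"
| "wf_fm l (FN \<phi>) = wf_fm l \<phi>"
| "wf_fm l (FA \<phi> \<psi>) = (wf_fm l \<phi> \<and> wf_fm l \<psi>)"
| "wf_fm l (FE \<phi>) = wf_fm (Suc l) \<phi>"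

text \<open>All that a well-formed formula at level \<open>l\<close> can read. Running
  \<open>decide\<close> at this level or deeper only spoils truth values and inner variables, so it
  cannot change the value of a formula at level \<open>l\<close>.\<close>

definition agree :: "nat \<Rightarrow> memory \<Rightarrow> memory \<Rightarrow> bool" where
  "agree l s u \<longleftrightarrow> (\<forall>x<20. s x = u x) \<and> (\<forall>m<l. s (qvar m) 0 = u (qvar m) 0)"

lemma wf_aexp_Suc: "wf_aexp l a \<Longrightarrow> wf_aexp (Suc l) a"
  by (induction a) (auto simp: less_Suc_eq)

lemma aval_agree: "wf_aexp l a \<Longrightarrow> agree l s u \<Longrightarrow> aval a s = aval a u"
  by (induction a) (auto simp: agree_def)

lemma bval_agree: "wf_bexp l b \<Longrightarrow> agree l s u \<Longrightarrow> bval b s = bval b u"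
  by (induction b) (auto simp: aval_agree)

lemma agree_set_cell: "agree l s u \<Longrightarrow> agree (Suc l) (set_cell (qvar l) 0 i s) (set_cell (qvar l) 0 i u)"
  by (auto simp: agree_def set_cell_apply less_Suc_eq qvar_def fun_eq_iff)

lemma fval_agree: "wf_fm l \<phi> \<Longrightarrow> agree l s u \<Longrightarrow> fval l \<phi> s = fval l \<phi> u"
proof (induction \<phi> arbitrary: l s u)
  case (FE \<phi>)
  have "s 2 = u 2" using FE.prems by (simp add: agree_def)
  moreover have "fval (Suc l) \<phi> (set_cell (qvar l) 0 i s) = fval (Suc l) \<phi> (set_cell (qvar l) 0 i u)" for i
    using FE by (simp add: agree_set_cell)
  ultimately show ?case by simp
qed (auto simp: bval_agree)

lemma aval_set_qvar: "wf_aexp l a \<Longrightarrow> aval a (set_cell (qvar l) 0 i s) = aval a s"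
  by (rule aval_agree) (auto simp: agree_def set_cell_apply qvar_def fun_eq_iff)

text \<open>Model checking by nested loops with the result in \<open>flag l\<close>. A conjunction
  may reuse \<open>flag l\<close> for its second part: that part is skipped if the first one left 0,
  which is then already the answer.\<close>

primrec decide :: "nat \<Rightarrow> fm \<Rightarrow> prog" where
  "decide l (FB b) = PIf b (PStore (flag l) (Const 0) (Const 1)) (PStore (flag l) (Const 0) (Const 0))"
| "decide l (FN \<phi>) = PSeq (decide l \<phi>)
     (PStore (flag l) (Const 0) (Sub (Const 1) (Read (flag l) (Const 0))))"
| "decide l (FA \<phi> \<psi>) = PSeq (decide l \<phi>)
     (PIf (Less (Const 0) (Read (flag l) (Const 0))) (decide l \<psi>) PSkip)"
| "decide l (FE \<phi>) = PSeq (PStore (flag l) (Const 0) (Const 0))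
     (PFor (qvar l) 0 (PSeq (decide (Suc l) \<phi>)
       (PIf (Less (Const 0) (Read (flag (Suc l)) (Const 0))) (PStore (flag l) (Const 0) (Const 1)) PSkip)))"

lemma writes_decide: "x \<in> writes (decide l \<phi>) \<Longrightarrow> qvar l \<le> x"
  by (induction \<phi> arbitrary: l) (fastforce simp: flag_def qvar_def)+

lemma wf_decide: "wf_prog (decide l \<phi>)"
proof (induction \<phi> arbitrary: l)
  case (FE \<phi>)
  have "qvar l \<notin> writes (decide (Suc l) \<phi>)" using writes_decide[of "qvar l" "Suc l" \<phi>]
    by (auto simp: qvar_def)
  then show ?case using FE by (auto simp: flag_def qvar_def)
qed (auto simp: flag_def)

lemma decide_frame: "x < qvar l \<Longrightarrow> sem (decide l \<phi>) s x = s x"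
  using writes_decide[of x l \<phi>] by (intro sem_frame) auto

lemma agree_decide: "l \<le> m \<Longrightarrow> agree l (sem (decide m \<phi>) s) s"
  by (auto simp: agree_def decide_frame qvar_def)

lemma sem_decide: "wf_fm l \<phi> \<Longrightarrow> sem (decide l \<phi>) s (flag l) 0 = of_bool (fval l \<phi> s)"
proof (induction \<phi> arbitrary: l s)
  case (FA \<phi> \<psi>)
  have "fval l \<psi> (sem (decide l \<phi>) s) = fval l \<psi> s"
    using FA.prems by (intro fval_agree agree_decide) auto
  then show ?case using FA by auto
next
  case (FE \<phi>)
  define p where "p = PSeq (decide (Suc l) \<phi>)
       (PIf (Less (Const 0) (Read (flag (Suc l)) (Const 0))) (PStore (flag l) (Const 0) (Const 1)) PSkip)"
  define s0 where "s0 = set_cell (flag l) 0 0 s"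
  have wf: "wf_prog (PFor (qvar l) 0 p)"
    using wf_decide[of l "FE \<phi>"] by (simp add: p_def)
  let ?I = "\<lambda>i u. u (flag l) 0 = of_bool (\<exists>j<i. fval (Suc l) \<phi> (set_cell (qvar l) 0 j s)) \<and> agree l u s"
  have "?I (s0 2 0) (sem (PFor (qvar l) 0 p) s0)"
  proof (rule sem_For_induct[OF wf, where I = ?I])
    show "?I 0 (set_cell (qvar l) 0 0 s0)"
      by (auto simp: s0_def set_cell_apply agree_def flag_def qvar_def fun_eq_iff)
  next
    fix i u assume u: "i < s0 2 0" "?I i u" "u (qvar l) 0 = i" "u 2 = s0 2"
    have ag: "agree (Suc l) u (set_cell (qvar l) 0 i s)"
      using u by (auto simp: agree_def set_cell_apply qvar_def less_Suc_eq fun_eq_iff)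
    have "sem (decide (Suc l) \<phi>) u (flag (Suc l)) 0 = of_bool (fval (Suc l) \<phi> (set_cell (qvar l) 0 i s))"
      using FE ag by (simp add: fval_agree)
    moreover have "sem (decide (Suc l) \<phi>) u (flag l) = u (flag l)"
      by (simp add: decide_frame flag_def qvar_def)
    moreover have "agree l (sem (decide (Suc l) \<phi>) u) s"
      using agree_decide[of l "Suc l" \<phi> u] u(2) by (auto simp: agree_def)
    ultimately show "?I (Suc i) (set_cell (qvar l) 0 (Suc i) (sem p u))"
      using u(2) unfolding p_def
      by (auto simp: agree_def set_cell_apply flag_def qvar_def less_Suc_eq fun_eq_iff)
  qed
  then show ?case by (simp add: p_def s0_def flag_def)
qed auto

definition FO :: "fm \<Rightarrow> fm \<Rightarrow> fm" where "FO \<phi> \<psi> = FN (FA (FN \<phi>) (FN \<psi>))"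
definition FI :: "fm \<Rightarrow> fm \<Rightarrow> fm" where "FI \<phi> \<psi> = FN (FA \<phi> (FN \<psi>))"
definition FAll :: "fm \<Rightarrow> fm" where "FAll \<phi> = FN (FE (FN \<phi>))"
definition FLess :: "aexp \<Rightarrow> aexp \<Rightarrow> fm" where "FLess a b = FB (Less a b)"
definition FEq :: "aexp \<Rightarrow> aexp \<Rightarrow> fm" where "FEq a b = FA (FN (FLess a b)) (FN (FLess b a))"

lemma fval_derived [simp]:
  "fval l (FO \<phi> \<psi>) s \<longleftrightarrow> fval l \<phi> s \<or> fval l \<psi> s"
  "fval l (FI \<phi> \<psi>) s \<longleftrightarrow> (fval l \<phi> s \<longrightarrow> fval l \<psi> s)"
  "fval l (FAll \<phi>) s \<longleftrightarrow> (\<forall>i<s 2 0. fval (Suc l) \<phi> (set_cell (qvar l) 0 i s))"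
  "fval l (FLess a b) s \<longleftrightarrow> aval a s < aval b s"
  "fval l (FEq a b) s \<longleftrightarrow> aval a s = aval b s"
  by (auto simp: FO_def FI_def FAll_def FLess_def FEq_def)

lemma wf_fm_derived [simp]:
  "wf_fm l (FO \<phi> \<psi>) \<longleftrightarrow> wf_fm l \<phi> \<and> wf_fm l \<psi>"
  "wf_fm l (FI \<phi> \<psi>) \<longleftrightarrow> wf_fm l \<phi> \<and> wf_fm l \<psi>"
  "wf_fm l (FAll \<phi>) \<longleftrightarrow> wf_fm (Suc l) \<phi>"
  "wf_fm l (FLess a b) \<longleftrightarrow> wf_aexp l a \<and> wf_aexp l b"
  "wf_fm l (FEq a b) \<longleftrightarrow> wf_aexp l a \<and> wf_aexp l b"
  by (auto simp: FO_def FI_def FAll_def FLess_def FEq_def)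

section \<open>Circuits and certificates\<close>

text \<open>The code of gates is prefix-free: the tags 0 and 1 determine its length, and after 2 and
  3 the length is written down.\<close>

lemma encode_gate_append_inject:
  "encode_gate g @ x = encode_gate g' @ y \<longleftrightarrow> g = g' \<and> x = y"
  by (cases g; cases g') (auto simp: append_eq_append_conv)

lemma encode_circuit_inject: "encode_circuit C = encode_circuit C' \<longleftrightarrow> C = C'"
proof
  show "encode_circuit C = encode_circuit C' \<Longrightarrow> C = C'"
  proof (induction C arbitrary: C')
    case Nil
    then show ?case by (cases C'; cases "hd C'") (auto simp: encode_circuit_def)
  next
    case (Cons g C)
    from Cons.prems obtain g' D where C': "C' = g' # D"
      by (cases C'; cases g) (auto simp: encode_circuit_def)
    with Cons show ?case
      by (simp add: encode_circuit_def encode_gate_append_inject del: encode_gate.simps)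
  qed
qed simp

lemma length_foldl_values:
  "length (foldl (\<lambda>vs g. vs @ [gate_value S vs g]) vs0 C) = length vs0 + length C"
  by (induction C arbitrary: vs0) auto

lemma length_node_values: "length (node_values S C) = length C"
  by (simp add: node_values_def length_foldl_values)

lemma node_values_snoc: "node_values S (C @ [g]) = node_values S C @ [gate_value S (node_values S C) g]"
  by (simp add: node_values_def)

lemma node_values_append: "\<exists>vs. node_values S (C @ D) = node_values S C @ vs"
proof (induction D rule: rev_induct)
  case (snoc g D)
  then show ?case using node_values_snoc[of S "C @ D" g] by (metis append_assoc)
qed simp

lemma node_values_nth_append: "i < length C \<Longrightarrow> node_values S (C @ D) ! i = node_values S C ! i"
  using node_values_append[of S C D] by (auto simp: nth_append length_node_values)

section \<open>Node values and the paths from the inputs to a node\<close>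

definition circuit_value :: "nat set \<Rightarrow> circuit \<Rightarrow> nat \<Rightarrow> bool" where
  "circuit_value S C v = node_values S C ! v"

text \<open>The values of nodes before \<open>v\<close> are final when the fold reaches
  \<open>v\<close>, because later values are only appended, and by topological order no other values
  are used.\<close>

lemma circuit_value_eq:
  assumes "is_circuit C" "v < length C"
  shows "circuit_value S C v = (case C ! v of Input \<Rightarrow> v \<in> S | Neg i \<Rightarrow> \<not> circuit_value S C i
    | Conj js \<Rightarrow> (\<forall>j\<in>set js. circuit_value S C j) | Disj js \<Rightarrow> (\<exists>j\<in>set js. circuit_value S C j))"
proof -
  have C: "C = take v C @ [C ! v] @ drop (Suc v) C" using assms(2) by (simp add: id_take_nth_drop)
  have len: "length (node_values S (take v C)) = v" using assms(2) by (simp add: length_node_values)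
  have "node_values S C ! v = node_values S (take v C @ [C ! v]) ! v"
    using node_values_nth_append[of v "take v C @ [C ! v]" S "drop (Suc v) C"] C assms(2) by simp
  also have "\<dots> = gate_value S (node_values S (take v C)) (C ! v)"
    using len by (simp add: node_values_snoc nth_append)
  finally have *: "circuit_value S C v = gate_value S (node_values S (take v C)) (C ! v)"
    by (simp add: circuit_value_def)
  have "node_values S (take v C) ! j = circuit_value S C j" if "j \<in> set (preds (C ! v))" for j
  proof -
    have "j < v" using that assms by (auto simp: is_circuit_def)
    then show ?thesis using node_values_nth_append[of j "take v C" S "drop v C"] assms(2)
      by (simp add: circuit_value_def)
  qed
  with * len show ?thesis by (cases "C ! v") auto
qed

lemma satisfies_iff: "C \<noteq> [] \<Longrightarrow> satisfies S C \<longleftrightarrow> circuit_value S C (length C - 1)"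
  by (metis circuit_value_def last_conv_nth length_0_conv length_node_values satisfies_def)

text \<open>All paths from the inputs to \<open>v\<close> have length at most \<open>h\<close> and at most \<open>g\<close> large gates.\<close>

primrec cone :: "circuit \<Rightarrow> nat \<Rightarrow> nat \<Rightarrow> nat \<Rightarrow> bool" where
  "cone C 0 g v \<longleftrightarrow> C ! v = Input"
| "cone C (Suc h) g v \<longleftrightarrow> C ! v = Input \<or>
     (if large_gate (C ! v) then g > 0 \<and> (\<forall>j\<in>set (preds (C ! v)). cone C h (g - 1) j)
      else (\<forall>j\<in>set (preds (C ! v)). cone C h g j))"

definition input_path :: "circuit \<Rightarrow> nat \<Rightarrow> nat list \<Rightarrow> bool" where
  "input_path C v p \<longleftrightarrow>
     p \<noteq> [] \<and> hd p \<in> input_nodes C \<and> last p = v \<and> (\<forall>i\<in>set p. i < length C) \<and>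
     (\<forall>i. Suc i < length p \<longrightarrow> p ! i \<in> set (preds (C ! (p ! Suc i))))"

lemma input_path_snoc:
  assumes "input_path C j p" "j \<in> set (preds (C ! v))" "v < length C"
  shows "input_path C v (p @ [v])"
  unfolding input_path_def
proof (intro conjI allI impI)
  fix i assume i: "Suc i < length (p @ [v])"
  show "(p @ [v]) ! i \<in> set (preds (C ! ((p @ [v]) ! Suc i)))"
  proof (cases "Suc i < length p")
    case True
    then show ?thesis using assms by (simp add: input_path_def nth_append)
  next
    case False
    then have "i = length p - 1" "p \<noteq> []" using i assms by (auto simp: input_path_def)
    then show ?thesis using assms by (simp add: input_path_def nth_append last_conv_nth)
  qed
qed (use assms in \<open>auto simp: input_path_def\<close>)

lemma preds_nonempty: "gate_ok g \<Longrightarrow> g \<noteq> Input \<Longrightarrow> preds g \<noteq> []"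
  by (cases g) auto

lemma input_path_exists:
  assumes "is_circuit C" "v < length C"
  shows "\<exists>p. input_path C v p"
  using assms(2)
proof (induction v rule: less_induct)
  case (less v)
  show ?case
  proof (cases "C ! v = Input")
    case True
    then have "input_path C v [v]" using less by (simp add: input_path_def input_nodes_def)
    then show ?thesis ..
  next
    case False
    then obtain j where j: "j \<in> set (preds (C ! v))"
      using preds_nonempty[of "C ! v"] assms(1) less.prems by (fastforce simp: is_circuit_def neq_Nil_conv)
    then have "j < v" using assms(1) less.prems by (auto simp: is_circuit_def)
    then show ?thesis using less j input_path_snoc by (meson order.strict_trans)
  qed
qed

text \<open>A path to a predecessor of \<open>v\<close> extends to a path to \<open>v\<close>, so
  its bounds are smaller by one level, and by one large gate if \<open>v\<close> is large. That
  \<open>g\<close> is positive at a large gate requires an actual path; it exists because only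
  inputs lack predecessors.\<close>

lemma coneI:
  assumes "is_circuit C" "v < length C"
    and "\<And>p. input_path C v p \<Longrightarrow> length p \<le> Suc h \<and> length (filter (\<lambda>i. large_gate (C ! i)) p) \<le> g"
  shows "cone C h g v"
  using assms(2,3)
proof (induction h arbitrary: g v)
  case 0
  show ?case
  proof (rule ccontr)
    assume "\<not> cone C 0 g v"
    then obtain j where j: "j \<in> set (preds (C ! v))"
      using preds_nonempty[of "C ! v"] assms(1) 0(1) by (fastforce simp: is_circuit_def neq_Nil_conv)
    then have "j < length C" using assms(1) 0(1) by (fastforce simp: is_circuit_def)
    then obtain p where p: "input_path C j p" using input_path_exists assms(1) by blast
    then show False using 0(2)[OF input_path_snoc[OF p j 0(1)]] by (simp add: input_path_def)
  qed
next
  case (Suc h)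
  show ?case
  proof (cases "C ! v = Input")
    case False
    have lt: "j < length C" if "j \<in> set (preds (C ! v))" for j
      using that assms(1) Suc.prems(1) by (fastforce simp: is_circuit_def)
    have path: "length p \<le> Suc h \<and>
       length (filter (\<lambda>i. large_gate (C ! i)) p) + of_bool (large_gate (C ! v)) \<le> g"
      if "j \<in> set (preds (C ! v))" "input_path C j p" for j p
      using Suc.prems(2)[OF input_path_snoc[OF that(2,1) Suc.prems(1)]] by auto
    have "g > 0" if "large_gate (C ! v)"
    proof -
      have "preds (C ! v) \<noteq> []" using that by (auto simp: large_gate_def)
      then obtain j where j: "j \<in> set (preds (C ! v))" by (meson last_in_set)
      then show ?thesis using path[OF j] input_path_exists[OF assms(1) lt[OF j]] that by fastforce
    qed
    moreover have "cone C h (g - of_bool (large_gate (C ! v))) j" if "j \<in> set (preds (C ! v))" for j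
      using path[OF that] by (intro Suc.IH lt[OF that]) fastforce
    ultimately show ?thesis by auto
  qed simp
qed

lemma cone_output:
  assumes "is_circuit C" "weft_at_most t C" "depth_at_most d C"
  shows "cone C d t (length C - 1)"
proof (rule coneI[OF assms(1)])
  show "length C - 1 < length C" using assms(1) by (simp add: is_circuit_def)
next
  fix p assume "input_path C (length C - 1) p"
  then have "input_output_path C p" by (simp add: input_path_def input_output_path_def)
  then show "length p \<le> Suc d \<and> length (filter (\<lambda>i. large_gate (C ! i)) p) \<le> t"
    using assms by (force simp: depth_at_most_def weft_at_most_def)
qed

text \<open>Three-valued evaluation: \<open>v\<close> gets the value \<open>b\<close> from the values in \<open>A\<close> within \<open>h\<close> levels.\<close>

primrec derivable :: "circuit \<Rightarrow> (bool \<Rightarrow> nat \<Rightarrow> bool) \<Rightarrow> nat \<Rightarrow> bool \<Rightarrow> nat \<Rightarrow> bool" where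
  "derivable C A 0 b v = A b v"
| "derivable C A (Suc h) b v \<longleftrightarrow> A b v \<or> (case C ! v of
      Input \<Rightarrow> False
    | Neg i \<Rightarrow> derivable C A h (\<not> b) i
    | Conj js \<Rightarrow> if b then (\<forall>j\<in>set js. derivable C A h b j) else (\<exists>j\<in>set js. derivable C A h b j)
    | Disj js \<Rightarrow> if b then (\<exists>j\<in>set js. derivable C A h b j) else (\<forall>j\<in>set js. derivable C A h b j))"

lemma derivable_mono_height: "derivable C A h b v \<Longrightarrow> h \<le> h' \<Longrightarrow> derivable C A h' b v"
proof (induction h arbitrary: h' b v)
  case 0
  then show ?case by (cases h') auto
next
  case (Suc h)
  then obtain h'' where h': "h' = Suc h''" "h \<le> h''" by (cases h') auto
  show ?case using Suc.prems(1) Suc.IH[OF _ h'(2)] by (auto simp: h'(1) split: gate.splits if_splits)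
qed

lemma derivable_sound:
  assumes "is_circuit C" "\<And>b v. A b v \<Longrightarrow> v < length C \<Longrightarrow> circuit_value S C v = b"
  shows "derivable C A h b v \<Longrightarrow> v < length C \<Longrightarrow> circuit_value S C v = b"
proof (induction h arbitrary: b v)
  case 0
  then show ?case using assms(2) by simp
next
  case (Suc h)
  have lt: "j < length C" if "j \<in> set (preds (C ! v))" for j
    using that assms(1) Suc.prems(2) by (fastforce simp: is_circuit_def)
  have T: "circuit_value S C j" if "derivable C A h True j" "j \<in> set (preds (C ! v))" for j
    using Suc.IH[OF that(1) lt[OF that(2)]] by simp
  have F: "\<not> circuit_value S C j" if "derivable C A h False j" "j \<in> set (preds (C ! v))" for j
    using Suc.IH[OF that(1) lt[OF that(2)]] by simp
  show ?case
  proof (cases "A b v")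
    case True
    then show ?thesis using assms(2) Suc.prems(2) by blast
  next
    case False
    then show ?thesis
      using Suc.prems(1) T F circuit_value_eq[OF assms(1) Suc.prems(2), of S]
      by (cases "C ! v"; cases b) auto
  qed
qed

text \<open>A wrong claim of this kind about a large gate is contradicted by a single predecessor, whereas
  the opposite claim is itself witnessed by a single predecessor and need not be assumed.\<close>

definition refutable :: "gate \<Rightarrow> bool \<Rightarrow> bool" where
  "refutable g b \<longleftrightarrow> g = Input \<or> large_gate g \<and> (\<exists>js. g = (if b then Conj js else Disj js))"

text \<open>The number \<open>g\<close> is the remaining allowance of large gates; once it is 0, the
  facts in \<open>F\<close> concern inputs only and are thus observable. The last clause ranges over
  all \<open>A\<close> extending \<open>F\<close> so that certificates of several nodes can be
  united.\<close>

definition certificate :: "circuit \<Rightarrow> nat set \<Rightarrow> nat \<Rightarrow> nat \<Rightarrow> nat \<Rightarrow> (nat \<times> bool) set \<Rightarrow> bool" where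
  "certificate C S h g v F \<longleftrightarrow> finite F \<and> card F \<le> 2 ^ h \<and>
     (\<forall>x b. (x, b) \<in> F \<longrightarrow>
        x < length C \<and> circuit_value S C x = b \<and> refutable (C ! x) b \<and> (g = 0 \<longrightarrow> C ! x = Input)) \<and>
     (\<forall>A. (\<forall>x b. (x, b) \<in> F \<longrightarrow> A b x) \<longrightarrow> derivable C A h (circuit_value S C v) v)"

lemma certificate_singleton:
  assumes "v < length C" "refutable (C ! v) (circuit_value S C v)" "g = 0 \<longrightarrow> C ! v = Input"
  shows "certificate C S h g v {(v, circuit_value S C v)}"
proof -
  have "(1::nat) \<le> 2 ^ h" by simp
  moreover have "derivable C A h (circuit_value S C v) v" if "A (circuit_value S C v) v" for A
    using that by (cases h) auto
  ultimately show ?thesis using assms by (simp add: certificate_def)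
qed

lemma derivable_step:
  assumes "is_circuit C" "v < length C" "C ! v \<noteq> Input"
    and d: "\<And>j. j \<in> set (preds (C ! v)) \<Longrightarrow> derivable C A h (circuit_value S C j) j"
  shows "derivable C A (Suc h) (circuit_value S C v) v"
proof (cases "C ! v")
  case (Neg i)
  then show ?thesis using circuit_value_eq[OF assms(1,2), of S] d[of i] by simp
next
  case (Conj js)
  show ?thesis
  proof (cases "\<forall>j\<in>set js. circuit_value S C j")
    case True
    then have "\<forall>j\<in>set js. derivable C A h True j" using d Conj by fastforce
    then show ?thesis using circuit_value_eq[OF assms(1,2), of S] True Conj by simp
  next
    case False
    then obtain j where "j \<in> set js" "\<not> circuit_value S C j" by blast
    then have "\<exists>j\<in>set js. derivable C A h False j" using d[of j] Conj by auto
    then show ?thesis using circuit_value_eq[OF assms(1,2), of S] False Conj by simp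
  qed
next
  case (Disj js)
  show ?thesis
  proof (cases "\<forall>j\<in>set js. \<not> circuit_value S C j")
    case True
    then have "\<forall>j\<in>set js. derivable C A h False j" using d Disj by fastforce
    then show ?thesis using circuit_value_eq[OF assms(1,2), of S] True Disj by simp
  next
    case False
    then obtain j where "j \<in> set js" "circuit_value S C j" by blast
    then have "\<exists>j\<in>set js. derivable C A h True j" using d[of j] Disj by auto
    then show ?thesis using circuit_value_eq[OF assms(1,2), of S] False Disj by simp
  qed
qed (use assms in simp)

text \<open>A small gate unites the certificates of its at most two predecessors, whence
  \<open>2 ^ h\<close>. A large gate is itself a fact if its value is refutable; otherwise it is a
  false conjunction or a true disjunction, and one predecessor with the same value suffices, at the
  cost of one unit of \<open>g\<close>.\<close>

lemma certificate_exists: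
  assumes C: "is_circuit C"
  shows "cone C h g v \<Longrightarrow> v < length C \<Longrightarrow> \<exists>F. certificate C S h g v F"
proof (induction h arbitrary: g v)
  case 0
  then show ?case using certificate_singleton[of v C S g] by (auto simp: refutable_def)
next
  case (Suc h)
  let ?c = "circuit_value S C v"
  have lt: "j < length C" if "j \<in> set (preds (C ! v))" for j
    using that C Suc.prems(2) by (fastforce simp: is_circuit_def)
  note val = circuit_value_eq[OF C Suc.prems(2), of S]
  show ?case
  proof (cases "refutable (C ! v) ?c \<and> (g = 0 \<longrightarrow> C ! v = Input)")
    case True
    then show ?thesis using certificate_singleton[OF Suc.prems(2), of S g "Suc h"] by blast
  next
    case False
    then have ni: "C ! v \<noteq> Input" by (auto simp: refutable_def)
    show ?thesis
    proof (cases "large_gate (C ! v)")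
      case True
      then have g: "g > 0" and ch: "\<And>j. j \<in> set (preds (C ! v)) \<Longrightarrow> cone C h (g - 1) j"
        using Suc.prems(1) ni by auto
      have "\<exists>j \<in> set (preds (C ! v)). circuit_value S C j = ?c \<and>
         (\<forall>A. derivable C A h ?c j \<longrightarrow> derivable C A (Suc h) ?c v)"
        using False True g val by (cases "C ! v"; cases ?c) (auto simp: refutable_def large_gate_def)
      then obtain j where j: "j \<in> set (preds (C ! v))" "circuit_value S C j = ?c"
         "\<And>A. derivable C A h ?c j \<Longrightarrow> derivable C A (Suc h) ?c v" by blast
      obtain F where F: "certificate C S h (g - 1) j F" using Suc.IH[OF ch[OF j(1)] lt[OF j(1)]] by blast
      then have "certificate C S (Suc h) g v F"
        unfolding certificate_def j(2) using j(3) g by (simp del: derivable.simps)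
      then show ?thesis ..
    next
      case False
      then have ch: "\<And>j. j \<in> set (preds (C ! v)) \<Longrightarrow> cone C h g j" using Suc.prems(1) ni by auto
      then have "\<forall>j\<in>set (preds (C ! v)). \<exists>F. certificate C S h g j F" using Suc.IH lt by blast
      then obtain F where F: "\<And>j. j \<in> set (preds (C ! v)) \<Longrightarrow> certificate C S h g j (F j)" by metis
      let ?F = "\<Union>j\<in>set (preds (C ! v)). F j"
      have "card ?F \<le> (\<Sum>j\<in>set (preds (C ! v)). card (F j))" by (rule card_UN_le) simp
      also have "\<dots> \<le> (\<Sum>j\<in>set (preds (C ! v)). 2 ^ h)"
        using F by (intro sum_mono) (simp add: certificate_def)
      also have "\<dots> = card (set (preds (C ! v))) * 2 ^ h" by simp
      also have "\<dots> \<le> 2 * 2 ^ h"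
        using False card_length[of "preds (C ! v)"] by (intro mult_right_mono) (auto simp: large_gate_def)
      finally have card: "card ?F \<le> 2 ^ Suc h" by simp
      have fin: "finite ?F" using F by (simp add: certificate_def)
      have "derivable C A (Suc h) ?c v" if A: "\<forall>x b. (x, b) \<in> ?F \<longrightarrow> A b x" for A
      proof -
        have d: "derivable C A h (circuit_value S C j) j" if j: "j \<in> set (preds (C ! v))" for j
        proof -
          have "\<forall>x b. (x, b) \<in> F j \<longrightarrow> A b x" using A j by blast
          then show ?thesis using F[OF j] by (simp add: certificate_def)
        qed
        show ?thesis using derivable_step[OF C Suc.prems(2) ni d] by simp
      qed
      moreover have "x < length C \<and> circuit_value S C x = b \<and> refutable (C ! x) b \<and> (g = 0 \<longrightarrow> C ! x = Input)"
        if xb: "(x, b) \<in> ?F" for x b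
      proof -
        obtain j where j: "j \<in> set (preds (C ! v))" "(x, b) \<in> F j" using xb by blast
        show ?thesis
          using F[OF j(1), unfolded certificate_def, THEN conjunct2, THEN conjunct2, THEN conjunct1] j(2)
          by blast
      qed
      ultimately show ?thesis
        unfolding certificate_def by (intro exI[of _ ?F] conjI fin card) blast+
    qed
  qed
qed

text \<open>Claims in \<open>A\<close> need not be true, only irrefutable by few inputs. A wrong
  claim about a large gate is contradicted by one predecessor, whose certificate consists of at most
  \<open>2 ^ d\<close> inputs; any \<open>D\<close> containing their values derives the refutation.
  The choice of \<open>D\<close> may depend on \<open>X\<close>, as each row observes few
  inputs.\<close>

lemma derivable_from_unrefuted:
  assumes C: "is_circuit C"
    and A: "\<And>b x. A b x \<Longrightarrow> refutable (C ! x) b"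
    and unref: "\<And>b x X. A b x \<Longrightarrow> x < length C \<Longrightarrow> finite X \<Longrightarrow> card X \<le> 2 ^ d \<Longrightarrow> X \<subseteq> input_nodes C \<Longrightarrow>
      \<exists>D. (\<forall>y\<in>X. D (circuit_value S C y) y) \<and> \<not> derivable C D d (\<not> b) x"
  shows "derivable C A h b v \<Longrightarrow> cone C h 1 v \<or> cone C h 0 v \<Longrightarrow> h \<le> d \<Longrightarrow> v < length C \<Longrightarrow> circuit_value S C v = b"
proof (induction h arbitrary: b v)
  case 0
  show ?case
  proof (rule ccontr)
    assume *: "circuit_value S C v \<noteq> b"
    have v: "v \<in> input_nodes C" using 0 by (auto simp: input_nodes_def)
    have "(1::nat) \<le> 2 ^ d" by simp
    then obtain D where "D (circuit_value S C v) v" "\<not> derivable C D d (\<not> b) v"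
      using unref[of b v "{v}"] 0 v by auto
    then show False using * derivable_mono_height[of C D 0 "\<not> b" v d] by auto
  qed
next
  case (Suc h)
  have lt: "j < length C" if "j \<in> set (preds (C ! v))" for j
    using that C Suc.prems(4) by (fastforce simp: is_circuit_def)
  note val = circuit_value_eq[OF C Suc.prems(4), of S]
  show ?case
  proof (cases "A b v")
    case False
    have ch: "cone C h 1 j \<or> cone C h 0 j" if "j \<in> set (preds (C ! v))" "C ! v \<noteq> Input" for j
      using Suc.prems(2) that by (auto split: if_splits)
    have IH: "circuit_value S C j = b'" if "j \<in> set (preds (C ! v))" "C ! v \<noteq> Input" "derivable C A h b' j" for j b'
      using Suc.IH[OF that(3) ch[OF that(1,2)]] lt[OF that(1)] Suc.prems(3) by simp
    have T: "circuit_value S C j" if "derivable C A h True j" "j \<in> set (preds (C ! v))" "C ! v \<noteq> Input" for j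
      using IH[OF that(2,3,1)] by simp
    have F: "\<not> circuit_value S C j" if "derivable C A h False j" "j \<in> set (preds (C ! v))" "C ! v \<noteq> Input" for j
      using IH[OF that(2,3,1)] by simp
    show ?thesis using Suc.prems(1) False val T F by (cases "C ! v"; cases b) auto
  next
    case True
    show ?thesis
    proof (rule ccontr)
      assume *: "circuit_value S C v \<noteq> b"
      show False
      proof (cases "C ! v = Input")
        case inp: True
        have "(1::nat) \<le> 2 ^ d" by simp
        then obtain D where "D (circuit_value S C v) v" "\<not> derivable C D d (\<not> b) v"
          using unref[of b v "{v}"] True Suc.prems(4) inp by (auto simp: input_nodes_def)
        then show False using * derivable_mono_height[of C D 0 "\<not> b" v d] by auto
      next
        case ni: False
        then have large: "large_gate (C ! v)" and form: "\<exists>js. C ! v = (if b then Conj js else Disj js)"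
          using A[OF True] by (auto simp: refutable_def)
        have "\<exists>j\<in>set (preds (C ! v)). circuit_value S C j = (\<not> b)"
          using form * val by (auto split: if_splits)
        then obtain j where j: "j \<in> set (preds (C ! v))" "circuit_value S C j = (\<not> b)" by blast
        have step: "derivable C D (Suc h) (\<not> b) v" if "derivable C D h (\<not> b) j" for D
          using form j(1) that by (auto split: if_splits)
        \<comment> \<open>Weft 1 enters here: below a large gate there are only small ones, so the
          certificate of \<open>j\<close> speaks of inputs.\<close>
        have "cone C h 0 j" using Suc.prems(2) ni large j(1) by auto
        from certificate_exists[OF C this lt[OF j(1)], of S] obtain F where "certificate C S h 0 j F" ..
        then have F: "finite F" "card F \<le> 2 ^ h"
          "\<And>x b. (x, b) \<in> F \<Longrightarrow> x < length C \<and> circuit_value S C x = b \<and> C ! x = Input"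
          "\<And>D. (\<forall>x b. (x, b) \<in> F \<longrightarrow> D b x) \<Longrightarrow> derivable C D h (\<not> b) j"
          unfolding certificate_def using j(2) by auto
        have "(2::nat) ^ h \<le> 2 ^ d" using Suc.prems(3) by (intro power_increasing) auto
        then have "card (fst ` F) \<le> 2 ^ d" using card_image_le[OF F(1), of fst] F(2) by linarith
        moreover have "fst ` F \<subseteq> input_nodes C" using F(3) by (auto simp: input_nodes_def)
        ultimately obtain D where D: "\<And>y. y \<in> fst ` F \<Longrightarrow> D (circuit_value S C y) y"
          "\<not> derivable C D d (\<not> b) v"
          using unref[OF True Suc.prems(4), of "fst ` F"] F(1) by blast
        have "\<forall>x b. (x, b) \<in> F \<longrightarrow> D b x" using D(1) F(3) by force
        then show False using D(2) F(4) step derivable_mono_height Suc.prems(3) by blast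
      qed
    qed
  qed
qed

section \<open>From circuits to cliques\<close>

text \<open>
  A row consists of four blocks of length \<open>R\<close>: nodes assumed to be true, nodes assumed to be false, indices,
  and the claimed entries at these indices. Nodes are shifted by one; 0 is padding in the first two
  blocks and the left sentinel in the last one.
\<close>

definition assumed :: "nat \<Rightarrow> (nat \<Rightarrow> nat) \<Rightarrow> bool \<Rightarrow> nat \<Rightarrow> bool" where
  "assumed R r b x \<longleftrightarrow> (\<exists>l<R. r ((if b then 0 else R) + l) = Suc x)"

definition observed :: "circuit \<Rightarrow> nat \<Rightarrow> (nat \<Rightarrow> nat) \<Rightarrow> bool \<Rightarrow> nat \<Rightarrow> bool" where
  "observed C R r b x \<longleftrightarrow> C ! x = Input \<and>
     (if b then \<exists>l<R. r (3 * R + l) = Suc x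
      else \<exists>l<R. \<exists>m<R. r (2 * R + m) = Suc (r (2 * R + l)) \<and> r (3 * R + l) < Suc x \<and> Suc x < r (3 * R + m))"

text \<open>Comparing in both directions also forces equal indices to have equal entries, and
  conversely. Rows that are pairwise in this relation are samples of a single strictly increasing
  sequence.\<close>

definition same_order :: "nat \<Rightarrow> (nat \<Rightarrow> nat) \<Rightarrow> (nat \<Rightarrow> nat) \<Rightarrow> bool" where
  "same_order R r q \<longleftrightarrow> (\<forall>l<R. \<forall>m<R.
     (r (2 * R + l) < q (2 * R + m) \<longleftrightarrow> r (3 * R + l) < q (3 * R + m)) \<and>
     (q (2 * R + m) < r (2 * R + l) \<longleftrightarrow> q (3 * R + m) < r (3 * R + l)))"

text \<open>A single row does not force its inner entries to lie strictly between the sentinels. In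
  a clique this follows from the order, because other rows carry the sentinel indices.\<close>

definition slots_ok :: "circuit \<Rightarrow> nat \<Rightarrow> nat \<Rightarrow> (nat \<Rightarrow> nat) \<Rightarrow> bool" where
  "slots_ok C k R r \<longleftrightarrow> (\<forall>l<R. r (2 * R + l) < k + 2 \<and>
     (r (2 * R + l) = 0 \<longrightarrow> r (3 * R + l) = 0) \<and>
     (r (2 * R + l) = k + 1 \<longrightarrow> r (3 * R + l) = length C + 1) \<and>
     (r (3 * R + l) = 0 \<or> length C < r (3 * R + l) \<or> C ! (r (3 * R + l) - 1) = Input))"

definition claims_ok :: "circuit \<Rightarrow> nat \<Rightarrow> nat \<Rightarrow> (nat \<Rightarrow> nat) \<Rightarrow> bool \<Rightarrow> bool" where
  "claims_ok C R d r b \<longleftrightarrow> (\<forall>l<R. r ((if b then 0 else R) + l) = 0 \<or>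
     r ((if b then 0 else R) + l) < length C + 1 \<and>
     refutable (C ! (r ((if b then 0 else R) + l) - 1)) b \<and>
     \<not> derivable C (observed C R r) d (\<not> b) (r ((if b then 0 else R) + l) - 1))"

definition good_row :: "circuit \<Rightarrow> nat \<Rightarrow> nat \<Rightarrow> nat \<Rightarrow> (nat \<Rightarrow> nat) \<Rightarrow> bool" where
  "good_row C k R d r \<longleftrightarrow> slots_ok C k R r \<and> same_order R r r \<and> claims_ok C R d r True \<and>
     claims_ok C R d r False \<and> derivable C (assumed R r) d True (length C - 1)"

text \<open>Conditions on a single row are imposed through adjacency, so defective rows become
  isolated vertices. The last conjunct makes the relation irreflexive and vertices with equal rows
  non-adjacent.\<close>

definition compatible :: "circuit \<Rightarrow> nat \<Rightarrow> nat \<Rightarrow> nat \<Rightarrow> (nat \<Rightarrow> nat) \<Rightarrow> (nat \<Rightarrow> nat) \<Rightarrow> bool" where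
  "compatible C k R d r q \<longleftrightarrow> good_row C k R d r \<and> good_row C k R d q \<and> (\<forall>l<2 * R. r l = q l) \<and>
     same_order R r q \<and> (\<exists>l<4 * R. r l \<noteq> q l)"

lemma same_orderD:
  assumes "same_order R r q" "l < R" "m < R"
  shows "r (2 * R + l) < q (2 * R + m) \<longleftrightarrow> r (3 * R + l) < q (3 * R + m)"
    "q (2 * R + m) < r (2 * R + l) \<longleftrightarrow> q (3 * R + m) < r (3 * R + l)"
  using assms by (simp_all add: same_order_def)

lemma same_order_sym: "same_order R r q \<Longrightarrow> same_order R q r"
  by (simp add: same_order_def)

lemma compatible_sym: "compatible C k R d r q \<Longrightarrow> compatible C k R d q r"
  by (simp add: compatible_def same_order_sym) (metis (no_types))

lemma compatible_irrefl: "\<not> compatible C k R d r r"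
  unfolding compatible_def by blast

section \<open>Equivalence of satisfying assignments and cliques of rows\<close>

definition is_clique :: "('v \<Rightarrow> 'v \<Rightarrow> bool) \<Rightarrow> 'v set \<Rightarrow> bool" where
  "is_clique adj Q \<longleftrightarrow> (\<forall>u\<in>Q. \<forall>v\<in>Q. u \<noteq> v \<longrightarrow> adj u v)"

lemma less_four_blocks:
  assumes "l < 4 * (R::nat)"
  obtains "l < 2 * R" | m where "m < R" "l = 2 * R + m" | m where "m < R" "l = 3 * R + m"
proof -
  consider "l < 2 * R" | "2 * R \<le> l" "l < 3 * R" | "3 * R \<le> l" by linarith
  then show ?thesis
  proof cases
    case 2
    then have "l - 2 * R < R" "l = 2 * R + (l - 2 * R)" by auto
    then show ?thesis using that(2) by blast
  next
    case 3
    then have "l - 3 * R < R" "l = 3 * R + (l - 3 * R)" using assms by auto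
    then show ?thesis using that(3) by blast
  qed (use that(1) in blast)
qed

lemma pad_to_function:
  assumes "finite X" "card X \<le> R"
  shows "\<exists>f::nat \<Rightarrow> nat. (\<forall>l. f l \<in> insert 0 X) \<and> (\<forall>x\<in>X. \<exists>l<R. f l = x)"
proof -
  obtain xs where xs: "set xs = X" "length xs = card X"
    using finite_distinct_list[OF assms(1)] distinct_card by force
  let ?f = "\<lambda>l. if l < length xs then xs ! l else 0"
  have 1: "\<forall>l. ?f l \<in> insert 0 X" using xs(1) by auto
  have 2: "\<exists>l<R. ?f l = x" if "x \<in> X" for x
  proof -
    obtain l where "l < length xs" "xs ! l = x" using \<open>x \<in> X\<close> xs(1) by (metis in_set_conv_nth)
    then show ?thesis using xs(2) assms(2) by (intro exI[of _ l]) auto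
  qed
  show ?thesis by (intro exI[of _ ?f] conjI ballI 1 2)
qed

lemma consecutive_between:
  fixes a :: "nat \<Rightarrow> nat"
  assumes "a 0 < y" "y < a (Suc k)" "\<And>i. i \<le> Suc k \<Longrightarrow> a i \<noteq> y"
  shows "\<exists>i\<le>k. a i < y \<and> y < a (Suc i)"
  using assms
proof (induction k)
  case (Suc k)
  show ?case
  proof (cases "y < a (Suc k)")
    case True
    then obtain i where "i \<le> k" "a i < y" "y < a (Suc i)" using Suc.IH Suc.prems(1,3) by auto
    then show ?thesis by (intro exI[of _ i]) auto
  next
    case False
    moreover have "a (Suc k) \<noteq> y" using Suc.prems(3) by simp
    ultimately show ?thesis using Suc.prems(2) by (intro exI[of _ "Suc k"]) auto
  qed
qed auto

text \<open>Nothing but surjectivity is asked of the numbering \<open>row\<close>: two vertices with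
  the same row are never adjacent, so repetitions do no harm.\<close>

locale clique_setting =
  fixes C :: circuit and k d R B P :: nat and row :: "nat \<Rightarrow> nat \<Rightarrow> nat"
  assumes C: "is_circuit C" "weft_at_most 1 C" "depth_at_most d C"
    and R: "R = 2 * 2 ^ d"
    and B: "k + 2 \<le> B" "length C + 2 \<le> B"
    and row: "\<And>f. (\<And>l. l < 4 * R \<Longrightarrow> f l < B) \<Longrightarrow> \<exists>u<P. \<forall>l<4 * R. row u l = f l"
begin

lemma R_pos: "R > 0" by (simp add: R)

lemma length_C: "length C > 0" using C(1) by (simp add: is_circuit_def)

abbreviation "adj u v \<equiv> compatible C k R d (row u) (row v)"

definition "slot_lists = {\<sigma>. set \<sigma> \<subseteq> {..<k + 2} \<and> length \<sigma> = R}"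

lemma card_slot_lists: "card slot_lists = (k + 2) ^ R"
  using card_lists_length_eq[of "{..<k + 2}" R] by (simp add: slot_lists_def)

lemma slot_lists_nth: "\<sigma> \<in> slot_lists \<Longrightarrow> l < R \<Longrightarrow> \<sigma> ! l < k + 2"
  using nth_mem[of l \<sigma>] by (auto simp: slot_lists_def simp del: nth_mem)

lemma slot_lists_length: "\<sigma> \<in> slot_lists \<Longrightarrow> length \<sigma> = R"
  by (simp add: slot_lists_def)

text \<open>By counting, the index tuples of the clique are all tuples. The constant ones define the
  global sequence \<open>a\<close>, whose inner entries give \<open>S\<close>; the other ones serve
  to inspect any desired set of inputs.\<close>

lemma satisfying_if_clique:
  assumes Q: "Q \<subseteq> {..<P}" "card Q = (k + 2) ^ R" "is_clique adj Q"
  shows "\<exists>S \<subseteq> input_nodes C. card S = k \<and> satisfies S C"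
proof -
  have finQ: "finite Q" using Q(1) finite_subset by blast
  have "(2::nat) \<le> (k + 2) ^ R"
    using power_increasing[of 1 R "k + 2"] R_pos by simp
  \<comment> \<open>Goodness of a row is only known from an edge at it, so every vertex needs a
    second one in the clique.\<close>
  then have two: "\<exists>v\<in>Q. v \<noteq> u" for u
    using Q(2) by (metis card_le_Suc0_iff_eq finQ not_less_eq_eq numeral_2_eq_2)
  have adjQ: "adj u v" if "u \<in> Q" "v \<in> Q" "u \<noteq> v" for u v
    using Q(3) that by (simp add: is_clique_def)
  have good: "good_row C k R d (row u)" if "u \<in> Q" for u
    using two[of u] adjQ[OF that] by (metis compatible_def)
  have order: "same_order R (row u) (row v)" if "u \<in> Q" "v \<in> Q" for u v
    using adjQ[OF that] good[OF that(1)] by (cases "u = v") (auto simp: compatible_def good_row_def)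
  have claims: "row u l = row v l" if "u \<in> Q" "v \<in> Q" "l < 2 * R" for u v l
    using adjQ[OF that(1,2)] that(3) by (cases "u = v") (auto simp: compatible_def)
  define sig where "sig u = map (\<lambda>l. row u (2 * R + l)) [0..<R]" for u
  have sig_nth: "sig u ! l = row u (2 * R + l)" if "l < R" for u l
    using that by (simp add: sig_def)
  have same: "row u (3 * R + l) = row v (3 * R + m)"
    if "u \<in> Q" "v \<in> Q" "l < R" "m < R" "row u (2 * R + l) = row v (2 * R + m)" for u v l m
  proof -
    have "\<not> row u (3 * R + l) < row v (3 * R + m)" "\<not> row v (3 * R + m) < row u (3 * R + l)"
      using same_orderD[OF order[OF that(1,2)] that(3,4)] that(5) by auto
    then show ?thesis by simp
  qed
  have "inj_on sig Q"
  proof (rule inj_onI, rule ccontr)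
    fix u v assume uv: "u \<in> Q" "v \<in> Q" "sig u = sig v" "u \<noteq> v"
    have s: "row u (2 * R + m) = row v (2 * R + m)" if "m < R" for m
      using sig_nth[OF that] uv(3) by metis
    have "row u l = row v l" if "l < 4 * R" for l
      using that
    proof (cases rule: less_four_blocks)
      case 1
      then show ?thesis by (rule claims[OF uv(1,2)])
    next
      case (2 m)
      then show ?thesis using s by simp
    next
      case (3 m)
      then show ?thesis using same[OF uv(1,2) _ _ s] by simp
    qed
    then show False using adjQ[OF uv(1,2,4)] by (auto simp: compatible_def)
  qed
  then have "card (sig ` Q) = card slot_lists" using Q(2) card_slot_lists by (simp add: card_image)
  moreover have "sig ` Q \<subseteq> slot_lists"
    using good by (auto simp: sig_def good_row_def slots_ok_def slot_lists_def)
  moreover have "finite slot_lists"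
    using finite_lists_length_eq[of "{..<k + 2}" R] by (simp add: slot_lists_def)
  ultimately have sigQ: "sig ` Q = slot_lists" using card_subset_eq by blast
  have vertex: "\<exists>u\<in>Q. \<forall>l<R. row u (2 * R + l) = \<sigma> ! l" if "\<sigma> \<in> slot_lists" for \<sigma>
  proof -
    have "\<sigma> \<in> sig ` Q" using sigQ that by simp
    then obtain u where "u \<in> Q" "\<sigma> = sig u" by blast
    then show ?thesis using sig_nth by (intro bexI[of _ u]) auto
  qed
  have "\<exists>u. u \<in> Q \<and> row u (2 * R) = i" if "i < k + 2" for i
  proof -
    have "replicate R i \<in> slot_lists" using that by (auto simp: slot_lists_def)
    from vertex[OF this] obtain u where u: "u \<in> Q" "\<And>l. l < R \<Longrightarrow> row u (2 * R + l) = replicate R i ! l" by blast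
    show ?thesis using u(1) u(2)[OF R_pos] R_pos by (intro exI[of _ u]) simp
  qed
  then have "\<forall>i\<in>{..<k + 2}. \<exists>u. u \<in> Q \<and> row u (2 * R) = i" by simp
  from bchoice[OF this] obtain U where U: "\<And>i. i < k + 2 \<Longrightarrow> U i \<in> Q \<and> row (U i) (2 * R) = i" by auto
  define a where "a i = row (U i) (3 * R)" for i
  have tau: "row u (3 * R + l) = a (row u (2 * R + l))" if "u \<in> Q" "l < R" for u l
  proof -
    have "row u (2 * R + l) < k + 2" using good[OF that(1)] that(2) by (simp add: good_row_def slots_ok_def)
    then show ?thesis using same[OF that(1), of "U (row u (2 * R + l))" l 0] U that R_pos by (simp add: a_def)
  qed
  have mono: "a i < a j \<longleftrightarrow> i < j" if "i < k + 2" "j < k + 2" for i j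
    using same_orderD(1)[OF order[of "U i" "U j"] R_pos R_pos] U[OF that(1)] U[OF that(2)]
    by (simp add: a_def)
  have slot: "slots_ok C k R (row (U i))" if "i < k + 2" for i
    using good U[OF that] by (simp add: good_row_def)
  have a0: "a 0 = 0" using slot[of 0] U[of 0] R_pos by (force simp: slots_ok_def a_def)
  have ak: "a (Suc k) = Suc (length C)" using slot[of "Suc k"] U[of "Suc k"] R_pos
    by (force simp: slots_ok_def a_def)
  have a_pos: "0 < a i" if "0 < i" "i \<le> k" for i using mono[of 0 i] a0 that by simp
  have a_le: "a i \<le> length C" if "i \<le> k" for i using mono[of i "Suc k"] ak that by simp
  have a_inp: "C ! (a i - 1) = Input" if "0 < i" "i \<le> k" for i
  proof -
    have "a i = 0 \<or> length C < a i \<or> C ! (a i - 1) = Input"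
      using slot[of i] that R_pos by (force simp: slots_ok_def a_def)
    then show ?thesis using a_pos[OF that] a_le[OF that(2)] by auto
  qed
  define S where "S = (\<lambda>i. a i - 1) ` {1..k}"
  have "inj_on (\<lambda>i. a i - 1) {1..k}"
  proof (rule inj_onI)
    fix i j assume ij: "i \<in> {1..k}" "j \<in> {1..k}" "a i - 1 = a j - 1"
    then have "a i = a j" using a_pos[of i] a_pos[of j] by auto
    then show "i = j" using mono[of i j] mono[of j i] ij by (auto simp: not_less_iff_gr_or_eq)
  qed
  then have cardS: "card S = k" by (simp add: S_def card_image)
  have S_inp: "S \<subseteq> input_nodes C"
  proof
    fix x assume "x \<in> S"
    then obtain i where i: "1 \<le> i" "i \<le> k" "x = a i - 1" by (auto simp: S_def)
    then show "x \<in> input_nodes C" using a_pos[of i] a_le[of i] a_inp[of i]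
      by (auto simp: input_nodes_def)
  qed
  \<comment> \<open>Two indices suffice to decide an input: the index of its entry, taken twice, if
    it is in \<open>S\<close>, and otherwise the consecutive indices whose entries enclose
    it.\<close>
  have witness: "\<exists>i j. i < k + 2 \<and> j < k + 2 \<and>
      (\<forall>u\<in>Q. (\<exists>l<R. row u (2 * R + l) = i) \<longrightarrow> (\<exists>l<R. row u (2 * R + l) = j) \<longrightarrow>
        observed C R (row u) (circuit_value S C y) y)" if y: "y \<in> input_nodes C" for y
  proof -
    have yC: "C ! y = Input" "y < length C" using y by (auto simp: input_nodes_def)
    then have val: "circuit_value S C y \<longleftrightarrow> y \<in> S" using circuit_value_eq[OF C(1), of y S] by simp
    show ?thesis
    proof (cases "y \<in> S")
      case True
      then obtain i where i: "1 \<le> i" "i \<le> k" "Suc y = a i" using a_pos by (force simp: S_def)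
      then have "observed C R (row u) (circuit_value S C y) y" if "u \<in> Q" "\<exists>l<R. row u (2 * R + l) = i" for u
        using val True yC that tau[OF that(1)] by (auto simp: observed_def)
      then show ?thesis using i by (intro exI[of _ i]) auto
    next
      case False
      have "Suc y \<noteq> a i" if "i \<le> Suc k" for i
      proof
        assume e: "Suc y = a i"
        then have "i \<noteq> 0" "i \<noteq> Suc k" using a0 ak yC by (metis nat.distinct(1), metis nat.inject less_irrefl)
        then have "y \<in> S" using that e unfolding S_def by (intro image_eqI[of _ _ i]) auto
        then show False using False by blast
      qed
      then obtain i where i: "i \<le> k" "a i < Suc y" "Suc y < a (Suc i)"
        using consecutive_between[of a "Suc y" k] a0 ak yC by force
      have "observed C R (row u) (circuit_value S C y) y"
        if u: "u \<in> Q" "\<exists>l<R. row u (2 * R + l) = i" "\<exists>l<R. row u (2 * R + l) = Suc i" for u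
      proof -
        obtain l m where lm: "l < R" "row u (2 * R + l) = i" "m < R" "row u (2 * R + m) = Suc i"
          using u(2,3) by blast
        then have "row u (3 * R + l) = a i" "row u (3 * R + m) = a (Suc i)" using tau[OF u(1)] by metis+
        then have "\<exists>l<R. \<exists>m<R. row u (2 * R + m) = Suc (row u (2 * R + l)) \<and> row u (3 * R + l) < Suc y \<and>
            Suc y < row u (3 * R + m)"
          using lm i by (intro exI[of _ l] exI[of _ m] conjI) simp_all
        then show ?thesis using val False yC by (simp add: observed_def)
      qed
      then show ?thesis using i(1) by (intro exI[of _ i] exI[of _ "Suc i"]) auto
    qed
  qed
  obtain u0 where u0: "u0 \<in> Q" using two by blast
  define A where "A = assumed R (row u0)"
  have claim: "refutable (C ! x) b \<and> (\<forall>u\<in>Q. \<not> derivable C (observed C R (row u)) d (\<not> b) x)"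
    if A: "A b x" for b x
  proof -
    obtain l where l: "l < R" "row u0 ((if b then 0 else R) + l) = Suc x"
      using A unfolding A_def assumed_def by blast
    have "claims_ok C R d (row u) b" if "u \<in> Q" for u
      using good[OF that] by (cases b) (simp_all add: good_row_def)
    moreover have "row u ((if b then 0 else R) + l) = Suc x" if "u \<in> Q" for u
      using claims[OF that u0, of "(if b then 0 else R) + l"] l by auto
    ultimately have "refutable (C ! x) b \<and> \<not> derivable C (observed C R (row u)) d (\<not> b) x" if "u \<in> Q" for u
      using that l(1) unfolding claims_ok_def by (metis diff_Suc_1 nat.distinct(1))
    then show ?thesis using u0 by blast
  qed
  have "circuit_value S C (length C - 1) = True"
  proof (rule derivable_from_unrefuted[OF C(1), of A d])
    show "derivable C A d True (length C - 1)"
      using good[OF u0] by (simp add: good_row_def A_def)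
    show "cone C d 1 (length C - 1) \<or> cone C d 0 (length C - 1)" using cone_output[OF C] by simp
  next
    fix b x X assume *: "A b x" "x < length C" "finite X" "card X \<le> 2 ^ d" "X \<subseteq> input_nodes C"
    define W where "W y i j \<longleftrightarrow> (\<forall>u\<in>Q. (\<exists>l<R. row u (2 * R + l) = i) \<longrightarrow> (\<exists>l<R. row u (2 * R + l) = j) \<longrightarrow>
        observed C R (row u) (circuit_value S C y) y)" for y i j
    have "\<forall>y. y \<in> input_nodes C \<longrightarrow> (\<exists>i j. i < k + 2 \<and> j < k + 2 \<and> W y i j)"
      unfolding W_def using witness by blast
    then obtain I J where IJ: "\<And>y. y \<in> input_nodes C \<Longrightarrow> I y < k + 2 \<and> J y < k + 2 \<and> W y (I y) (J y)" by metis
    let ?Y = "I ` X \<union> J ` X"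
    have "card ?Y \<le> card (I ` X) + card (J ` X)" by (rule card_Un_le)
    also have "\<dots> \<le> R" using card_image_le[OF *(3), of I] card_image_le[OF *(3), of J] *(4) R by linarith
    finally have "\<exists>f. (\<forall>l. f l \<in> insert 0 ?Y) \<and> (\<forall>i\<in>?Y. \<exists>l<R. f l = i)"
      using *(3) by (intro pad_to_function) auto
    then obtain f where ff: "(\<forall>l. f l \<in> insert 0 ?Y) \<and> (\<forall>i\<in>?Y. \<exists>l<R. f l = i)" ..
    have "f l < k + 2" for l
    proof -
      have "f l \<in> insert 0 ?Y" using ff by simp
      then consider "f l = 0" | y where "y \<in> X" "f l = I y" | y where "y \<in> X" "f l = J y" by auto
      then show ?thesis using IJ *(5) by cases auto
    qed
    then have "map f [0..<R] \<in> slot_lists" by (auto simp: slot_lists_def)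
    from vertex[OF this] obtain u where u: "u \<in> Q" "\<And>l. l < R \<Longrightarrow> row u (2 * R + l) = f l" by auto
    have "observed C R (row u) (circuit_value S C y) y" if y: "y \<in> X" for y
    proof -
      have "\<exists>l<R. f l = I y" "\<exists>l<R. f l = J y" using ff y by auto
      then have "\<exists>l<R. row u (2 * R + l) = I y" "\<exists>l<R. row u (2 * R + l) = J y" using u(2) by auto
      moreover have "W y (I y) (J y)" using IJ y *(5) by blast
      ultimately show ?thesis using u(1) unfolding W_def by simp
    qed
    then show "\<exists>D. (\<forall>y\<in>X. D (circuit_value S C y) y) \<and> \<not> derivable C D d (\<not> b) x"
      using claim[OF *(1)] u(1) by (intro exI[of _ "observed C R (row u)"]) simp
  qed (use claim length_C in auto)
  then show ?thesis using cardS S_inp satisfies_iff[of C S] length_C by auto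
qed

text \<open>All rows of the clique share the claims of one certificate of the output and differ in
  their indices; the entries come from the sorted assignment. Since claims and observations are
  true, no claim is refuted.\<close>

lemma clique_if_satisfying:
  assumes S: "S \<subseteq> input_nodes C" "card S = k" "satisfies S C"
  shows "\<exists>Q \<subseteq> {..<P}. card Q = (k + 2) ^ R \<and> is_clique adj Q"
proof -
  have finS: "finite S" using S(1) by (rule finite_subset) (simp add: input_nodes_def)
  define xs where "xs = sorted_list_of_set S"
  have xs: "set xs = S" "length xs = k" "sorted_wrt (<) xs"
    using finS S(2) by (auto simp: xs_def)
  define a where "a i = (if i = 0 then 0 else if i \<le> k then Suc (xs ! (i - 1)) else Suc (length C))" for i
  have S_lt: "x < length C" "C ! x = Input" if "x \<in> S" for x using S(1) that by (auto simp: input_nodes_def)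
  have nth_S: "xs ! i \<in> S" if "i < k" for i using xs that by auto
  have a_less: "a i < a j" if "i < j" "j < k + 2" for i j
  proof -
    have "xs ! (i - 1) < xs ! (j - 1)" if "0 < i" "j \<le> k"
      using sorted_wrt_nth_less[OF xs(3), of "i - 1" "j - 1"] that \<open>i < j\<close> xs(2) by simp
    moreover have "xs ! (i - 1) < length C" if "0 < i" "i \<le> k"
      using S_lt nth_S[of "i - 1"] that by simp
    ultimately show ?thesis using that by (auto simp: a_def)
  qed
  have mono: "a i < a j \<longleftrightarrow> i < j" if "i < k + 2" "j < k + 2" for i j
    using a_less[of i j] a_less[of j i] that by (metis linorder_neqE_nat not_less_iff_gr_or_eq)
  have a_le: "a i \<le> Suc (length C)" for i
    using S_lt nth_S[of "i - 1"] by (auto simp: a_def less_imp_le)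
  have a_S: "x \<in> S \<longleftrightarrow> (\<exists>i<k + 2. a i = Suc x)" if "x < length C" for x
  proof
    assume "x \<in> S"
    then obtain i where "i < k" "xs ! i = x" using xs by (metis in_set_conv_nth)
    then show "\<exists>i<k + 2. a i = Suc x" by (intro exI[of _ "Suc i"]) (auto simp: a_def)
  next
    assume "\<exists>i<k + 2. a i = Suc x"
    then obtain i where "i < k + 2" "a i = Suc x" by blast
    then show "x \<in> S" using that nth_S[of "i - 1"] by (auto simp: a_def split: if_splits)
  qed
  have out: "circuit_value S C (length C - 1)" using S(3) satisfies_iff[of C S] length_C by auto
  obtain F where "certificate C S d 1 (length C - 1) F"
    using certificate_exists[OF C(1) cone_output[OF C], of S] length_C by auto
  then have F: "finite F" "card F \<le> 2 ^ d"
    "\<And>x b. (x, b) \<in> F \<Longrightarrow> x < length C \<and> circuit_value S C x = b \<and> refutable (C ! x) b"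
    "\<And>A. (\<And>x b. (x, b) \<in> F \<Longrightarrow> A b x) \<Longrightarrow> derivable C A d True (length C - 1)"
    unfolding certificate_def using out by auto
  have "\<exists>f. (\<forall>l. f l \<in> insert 0 {Suc x | x. (x, b) \<in> F}) \<and> (\<forall>y\<in>{Suc x | x. (x, b) \<in> F}. \<exists>l<R. f l = y)" for b
  proof (rule pad_to_function)
    have sub: "{Suc x | x. (x, b) \<in> F} \<subseteq> (\<lambda>z. Suc (fst z)) ` F" by force
    then show "finite {Suc x | x. (x, b) \<in> F}" using F(1) finite_subset by blast
    have "card {Suc x | x. (x, b) \<in> F} \<le> card F"
      using card_mono[OF _ sub] card_image_le[OF F(1)] F(1) by (meson finite_imageI le_trans)
    then show "card {Suc x | x. (x, b) \<in> F} \<le> R" using F(2) R by linarith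
  qed
  then have "\<exists>f. \<forall>b. (\<forall>l. f b l \<in> insert 0 {Suc x | x. (x, b) \<in> F}) \<and>
      (\<forall>y\<in>{Suc x | x. (x, b) \<in> F}. \<exists>l<R. f b l = y)"
    by (intro choice allI)
  then obtain f where ff: "\<forall>b. (\<forall>l. f b l \<in> insert 0 {Suc x | x. (x, b) \<in> F}) \<and>
      (\<forall>y\<in>{Suc x | x. (x, b) \<in> F}. \<exists>l<R. f b l = y)" ..
  have f: "f b l \<in> insert 0 {Suc x | x. (x, b) \<in> F}"
    "y \<in> {Suc x | x. (x, b) \<in> F} \<Longrightarrow> \<exists>l<R. f b l = y" for b l y
    using spec[OF ff, of b] by (auto simp del: insert_iff)
  have f_le: "f b l \<le> length C" for b l using f(1)[where b = b and l = l] F(3) by force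
  define g where "g \<sigma> l = (if l < R then f True l else if l < 2 * R then f False (l - R)
    else if l < 3 * R then \<sigma> ! (l - 2 * R) else a (\<sigma> ! (l - 3 * R)))" for \<sigma> l
  have "\<exists>u<P. \<forall>l<4 * R. row u l = g \<sigma> l" if \<sigma>: "\<sigma> \<in> slot_lists" for \<sigma>
  proof (rule row)
    fix l assume l: "l < 4 * R"
    have "\<sigma> ! (l - 2 * R) < k + 2" if "2 * R \<le> l" "l < 3 * R"
      using slot_lists_nth[OF \<sigma>, of "l - 2 * R"] that by simp
    then show "g \<sigma> l < B"
      using B f_le[of True l] f_le[of False "l - R"] a_le[of "\<sigma> ! (l - 3 * R)"] by (auto simp: g_def)
  qed
  then have "\<forall>\<sigma>\<in>slot_lists. \<exists>u. u < P \<and> (\<forall>l<4 * R. row u l = g \<sigma> l)" by simp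
  from bchoice[OF this] obtain U where
    U: "\<And>\<sigma>. \<sigma> \<in> slot_lists \<Longrightarrow> U \<sigma> < P \<and> (\<forall>l<4 * R. row (U \<sigma>) l = g \<sigma> l)" by auto
  have row_claim: "row (U \<sigma>) ((if b then 0 else R) + l) = f b l" if "\<sigma> \<in> slot_lists" "l < R" for \<sigma> b l
    using U[OF that(1)] that(2) by (auto simp: g_def)
  have row_slot: "row (U \<sigma>) (2 * R + l) = \<sigma> ! l" and row_val: "row (U \<sigma>) (3 * R + l) = a (\<sigma> ! l)"
    if "\<sigma> \<in> slot_lists" "l < R" for \<sigma> l
    using U[OF that(1)] that(2) by (auto simp: g_def)
  note slot_lt = slot_lists_nth
  have order: "same_order R (row (U \<sigma>)) (row (U \<sigma>'))" if "\<sigma> \<in> slot_lists" "\<sigma>' \<in> slot_lists" for \<sigma> \<sigma>'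
    unfolding same_order_def
  proof (intro allI impI)
    fix l m assume "l < R" "m < R"
    then show "(row (U \<sigma>) (2 * R + l) < row (U \<sigma>') (2 * R + m) \<longleftrightarrow> row (U \<sigma>) (3 * R + l) < row (U \<sigma>') (3 * R + m)) \<and>
      (row (U \<sigma>') (2 * R + m) < row (U \<sigma>) (2 * R + l) \<longleftrightarrow> row (U \<sigma>') (3 * R + m) < row (U \<sigma>) (3 * R + l))"
      using mono[OF slot_lt slot_lt, of \<sigma> l \<sigma>' m] mono[OF slot_lt slot_lt, of \<sigma>' m \<sigma> l] that
      by (simp add: row_slot row_val)
  qed
  have good: "good_row C k R d (row (U \<sigma>))" if \<sigma>: "\<sigma> \<in> slot_lists" for \<sigma>
    unfolding good_row_def
  proof (intro conjI)
    show "slots_ok C k R (row (U \<sigma>))"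
      unfolding slots_ok_def
    proof (intro allI impI)
      fix l assume l: "l < R"
      have "a (\<sigma> ! l) = 0 \<or> length C < a (\<sigma> ! l) \<or> C ! (a (\<sigma> ! l) - 1) = Input"
        using S_lt(2)[OF nth_S] by (auto simp: a_def)
      then show "row (U \<sigma>) (2 * R + l) < k + 2 \<and> (row (U \<sigma>) (2 * R + l) = 0 \<longrightarrow> row (U \<sigma>) (3 * R + l) = 0) \<and>
        (row (U \<sigma>) (2 * R + l) = k + 1 \<longrightarrow> row (U \<sigma>) (3 * R + l) = length C + 1) \<and>
        (row (U \<sigma>) (3 * R + l) = 0 \<or> length C < row (U \<sigma>) (3 * R + l) \<or>
          C ! (row (U \<sigma>) (3 * R + l) - 1) = Input)"
        using slot_lt[OF \<sigma> l] by (simp add: row_slot[OF \<sigma> l] row_val[OF \<sigma> l] a_def)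
    qed
    have obs: "circuit_value S C x = b" if x: "observed C R (row (U \<sigma>)) b x" "x < length C" for b x
    proof -
      have val: "circuit_value S C x \<longleftrightarrow> x \<in> S"
        using circuit_value_eq[OF C(1) x(2), of S] x(1) by (simp add: observed_def)
      show ?thesis
      proof (cases b)
        case True
        then obtain l where "l < R" "a (\<sigma> ! l) = Suc x" using x(1) row_val[OF \<sigma>] by (auto simp: observed_def)
        then show ?thesis using val a_S[OF x(2)] slot_lt[OF \<sigma>] True by blast
      next
        case False
        then obtain l m where lm: "l < R" "m < R" "\<sigma> ! m = Suc (\<sigma> ! l)" "a (\<sigma> ! l) < Suc x" "Suc x < a (\<sigma> ! m)"
          using x(1) row_val[OF \<sigma>] row_slot[OF \<sigma>] by (auto simp: observed_def)
        have "x \<notin> S"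
        proof
          assume "x \<in> S"
          then obtain i where i: "i < k + 2" "a i = Suc x" using a_S[OF x(2)] by blast
          then show False
            using mono[of "\<sigma> ! l" i] mono[of i "\<sigma> ! m"] slot_lt[OF \<sigma> lm(1)] slot_lt[OF \<sigma> lm(2)] lm(3-5)
            by auto
        qed
        then show ?thesis using val False by simp
      qed
    qed
    have "claims_ok C R d (row (U \<sigma>)) b" for b
      unfolding claims_ok_def
    proof (intro allI impI)
      fix l assume l: "l < R"
      have "\<not> derivable C (observed C R (row (U \<sigma>))) d (\<not> b) x" if "(x, b) \<in> F" for x
        using derivable_sound[OF C(1) obs, of "\<lambda>b x. observed C R (row (U \<sigma>)) b x" d "\<not> b" x] F(3)[OF that]
        by auto
      then show "row (U \<sigma>) ((if b then 0 else R) + l) = 0 \<or>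
         row (U \<sigma>) ((if b then 0 else R) + l) < length C + 1 \<and>
         refutable (C ! (row (U \<sigma>) ((if b then 0 else R) + l) - 1)) b \<and>
         \<not> derivable C (observed C R (row (U \<sigma>))) d (\<not> b) (row (U \<sigma>) ((if b then 0 else R) + l) - 1)"
        unfolding row_claim[OF \<sigma> l] using f(1)[of b l] F(3) by fastforce
    qed
    then show "claims_ok C R d (row (U \<sigma>)) True" "claims_ok C R d (row (U \<sigma>)) False" by blast+
    show "derivable C (assumed R (row (U \<sigma>))) d True (length C - 1)"
    proof (rule F(4))
      fix x b assume "(x, b) \<in> F"
      then obtain l where "l < R" "f b l = Suc x" using f(2)[of "Suc x" b] by blast
      then show "assumed R (row (U \<sigma>)) b x"
        using row_claim[OF \<sigma>, of l b] unfolding assumed_def by (intro exI[of _ l]) simp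
    qed
  qed (rule order[OF \<sigma> \<sigma>])
  have diff: "\<exists>l<R. \<sigma> ! l \<noteq> \<sigma>' ! l" if "\<sigma> \<in> slot_lists" "\<sigma>' \<in> slot_lists" "\<sigma> \<noteq> \<sigma>'" for \<sigma> \<sigma>'
    using that slot_lists_length[OF that(1)] slot_lists_length[OF that(2)] by (auto simp: list_eq_iff_nth_eq)
  have adjU: "adj (U \<sigma>) (U \<sigma>')" if s: "\<sigma> \<in> slot_lists" "\<sigma>' \<in> slot_lists" "\<sigma> \<noteq> \<sigma>'" for \<sigma> \<sigma>'
    unfolding compatible_def
  proof (intro conjI good order s allI impI)
    fix l assume "l < 2 * R"
    then show "row (U \<sigma>) l = row (U \<sigma>') l" using U[OF s(1)] U[OF s(2)] by (auto simp: g_def)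
  next
    obtain l where "l < R" "\<sigma> ! l \<noteq> \<sigma>' ! l" using diff[OF s] by blast
    then show "\<exists>l<4 * R. row (U \<sigma>) l \<noteq> row (U \<sigma>') l"
      using row_slot[OF s(1), of l] row_slot[OF s(2), of l] by (intro exI[of _ "2 * R + l"]) auto
  qed
  have "inj_on U slot_lists"
    using adjU compatible_irrefl by (metis (no_types, lifting) inj_onI)
  then have "card (U ` slot_lists) = (k + 2) ^ R" using card_slot_lists by (simp add: card_image)
  moreover have "is_clique adj (U ` slot_lists)"
    using adjU unfolding is_clique_def by blast
  moreover have "U ` slot_lists \<subseteq> {..<P}" using U by blast
  ultimately show ?thesis by blast
qed

end

section \<open>Gadget graphs\<close>

text \<open>A gadget \<open>(b, y, z)\<close> is an additional vertex on side \<open>b\<close> with the base vertices \<open>y\<close> and \<open>z\<close> as neighbours.\<close>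

type_synonym gadget = "bool \<times> nat \<times> nat"

definition gadget_edges :: "nat \<Rightarrow> gadget list \<Rightarrow> (nat \<times> nat) list" where
  "gadget_edges n T =
     concat (map (\<lambda>t. [(fst (snd (T ! t)), n + t), (snd (snd (T ! t)), n + t)]) [0..<length T])"

definition gadget_edge_set :: "nat \<Rightarrow> gadget list \<Rightarrow> nat set set" where
  "gadget_edge_set n T = set (map (\<lambda>(u, v). {u, v}) (gadget_edges n T))"

definition gadget_side :: "nat \<Rightarrow> (nat \<Rightarrow> bool) \<Rightarrow> gadget list \<Rightarrow> nat set" where
  "gadget_side n base T = {v. v < n + length T \<and> (if v < n then base v else fst (T ! (v - n)))}"

text \<open>Each edge takes five cells, the last three being the encoded weight: sign bit 0,
  numerator 1, denominator 1.\<close>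

definition gadget_cells :: "nat \<Rightarrow> nat \<Rightarrow> gadget \<Rightarrow> nat list" where
  "gadget_cells n t g = [fst (snd g), n + t, 0, 1, 1, snd (snd g), n + t, 0, 1, 1]"

definition gadget_word :: "nat \<Rightarrow> (nat \<Rightarrow> bool) \<Rightarrow> gadget list \<Rightarrow> word" where
  "gadget_word n base T = [n + length T, 2 * length T]
     @ concat (map (\<lambda>t. gadget_cells n t (T ! t)) [0..<length T])
     @ map (\<lambda>v. of_bool (base v)) [0..<n] @ map (\<lambda>g. of_bool (fst g)) T"

definition valid_gadgets :: "nat \<Rightarrow> gadget list \<Rightarrow> bool" where
  "valid_gadgets n T \<longleftrightarrow> (\<forall>g\<in>set T. fst (snd g) < n \<and> snd (snd g) < n \<and> fst (snd g) \<noteq> snd (snd g))"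

definition cut_size :: "nat \<Rightarrow> gadget list \<Rightarrow> nat set \<Rightarrow> nat" where
  "cut_size n T X = (\<Sum>t<length T. of_bool ((fst (snd (T ! t)) \<in> X) \<noteq> (n + t \<in> X)) +
     of_bool ((snd (snd (T ! t)) \<in> X) \<noteq> (n + t \<in> X)))"

lemma gadget_edge_set_iff:
  "e \<in> gadget_edge_set n T \<longleftrightarrow>
     (\<exists>t<length T. e = {fst (snd (T ! t)), n + t} \<or> e = {snd (snd (T ! t)), n + t})"
  unfolding gadget_edge_set_def gadget_edges_def by fastforce

lemma valid_gadgetsD:
  assumes "valid_gadgets n T" "t < length T"
  shows "fst (snd (T ! t)) < n" "snd (snd (T ! t)) < n" "fst (snd (T ! t)) \<noteq> snd (snd (T ! t))"
  using assms by (auto simp: valid_gadgets_def)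

lemma length_gadget_edges: "length (gadget_edges n T) = 2 * length T"
  by (simp add: gadget_edges_def length_concat comp_def sum_list_triv)

lemma distinct_gadget_edges:
  assumes "valid_gadgets n T"
  shows "distinct (map (\<lambda>(u, v). {u, v}) (gadget_edges n T))"
proof -
  have "distinct (map (\<lambda>(u, v). {u, v}) (concat (map (\<lambda>t. [(fst (snd (T ! t)), n + t), (snd (snd (T ! t)), n + t)]) [0..<m])))"
    if "m \<le> length T" for m
    using that
  proof (induction m)
    case (Suc m)
    note v = valid_gadgetsD[OF assms]
    have "m < length T" using Suc.prems by simp
    note vm = v[OF this]
    have new: "{y, n + m} \<noteq> {y', n + t}" if "t < m" "y' < n" for y y' t
      using that by (auto simp: doubleton_eq_iff)
    have "{y, n + m} \<notin> set (map (\<lambda>(u, v). {u, v}) (concat (map (\<lambda>t. [(fst (snd (T ! t)), n + t), (snd (snd (T ! t)), n + t)]) [0..<m])))"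
      for y
      using new v(1,2) Suc.prems by fastforce
    then show ?case using Suc vm by (auto simp: doubleton_eq_iff)
  qed simp
  then show ?thesis by (simp add: gadget_edges_def)
qed

lemma simple_gadget_graph: "valid_gadgets n T \<Longrightarrow> simple_graph {0..<n + length T} (gadget_edge_set n T)"
  using valid_gadgetsD[of n T] by (fastforce simp: simple_graph_def gadget_edge_set_iff card_2_iff)

text \<open>The two classes are the base and the gadget vertices, regardless of the two sides of the
  cut.\<close>

lemma bipartite_gadget_graph:
  assumes "valid_gadgets n T"
  shows "bipartite {0..<n + length T} (gadget_edge_set n T)"
  unfolding bipartite_def
proof (rule exI[of _ "{0..<n}"], rule exI[of _ "{n..<n + length T}"], intro conjI ballI)
  fix e assume "e \<in> gadget_edge_set n T"
  then obtain t where "t < length T" "e = {fst (snd (T ! t)), n + t} \<or> e = {snd (snd (T ! t)), n + t}"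
    by (auto simp: gadget_edge_set_iff)
  then show "\<exists>x\<in>{0..<n}. \<exists>y\<in>{n..<n + length T}. e = {x, y}"
    using valid_gadgetsD[OF assms] by fastforce
qed auto

text \<open>A gadget vertex in the subgraph keeps at most its two edges. A subgraph without gadget
  vertices has no edges at all, since every edge contains one.\<close>

lemma degenerate_gadget_graph:
  assumes "valid_gadgets n T"
  shows "degenerate 2 {0..<n + length T} (gadget_edge_set n T)"
  unfolding degenerate_def
proof (intro allI impI, elim conjE)
  fix V' E' assume V': "V' \<subseteq> {0..<n + length T}" "V' \<noteq> {}" and E': "E' \<subseteq> gadget_edge_set n T" "simple_graph V' E'"
  show "\<exists>v\<in>V'. degree E' v \<le> 2"
  proof (cases "\<exists>t. n + t \<in> V'")
    case True
    then obtain t where t: "n + t \<in> V'" by blast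
    have "{e \<in> E'. n + t \<in> e} \<subseteq> {{fst (snd (T ! t)), n + t}, {snd (snd (T ! t)), n + t}}"
    proof
      fix e assume e: "e \<in> {e \<in> E'. n + t \<in> e}"
      then have "e \<in> gadget_edge_set n T" using E'(1) by blast
      then obtain t' where t': "t' < length T" "e = {fst (snd (T ! t')), n + t'} \<or> e = {snd (snd (T ! t')), n + t'}"
        by (auto simp: gadget_edge_set_iff)
      then have "t' = t" using e valid_gadgetsD(1,2)[OF assms t'(1)] by auto
      then show "e \<in> {{fst (snd (T ! t)), n + t}, {snd (snd (T ! t)), n + t}}" using t' by auto
    qed
    then have "degree E' (n + t) \<le> card {{fst (snd (T ! t)), n + t}, {snd (snd (T ! t)), n + t}}"
      unfolding degree_def by (intro card_mono) auto
    also have "\<dots> \<le> 2" by (simp add: card_insert_if)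
    finally show ?thesis using t by blast
  next
    case False
    have "E' = {}"
    proof (rule ccontr)
      assume "E' \<noteq> {}"
      then obtain e where e: "e \<in> E'" "e \<in> gadget_edge_set n T" using E'(1) by blast
      then obtain t where "n + t \<in> e" by (auto simp: gadget_edge_set_iff)
      note e(1) this
      then show False using False E'(2) unfolding simple_graph_def by blast
    qed
    then show ?thesis using V'(2) by (auto simp: degree_def)
  qed
qed

section \<open>Unique decoding of instances and the size of a cut\<close>

lemma encode_rat_1: "encode_rat 1 = [0, 1, 1]"
  by (simp add: encode_rat_def)

lemma length_encode_rat: "length (encode_rat q) = 3"
  by (simp add: encode_rat_def split: prod.split)

lemma encode_rat_inject: "encode_rat p = encode_rat q \<Longrightarrow> p = q"
proof -
  assume *: "encode_rat p = encode_rat q"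
  obtain a b where p: "quotient_of p = (a, b)" by fastforce
  obtain c d where q: "quotient_of q = (c, d)" by fastforce
  have "b > 0" "d > 0" using quotient_of_denom_pos p q by blast+
  then have "(a, b) = (c, d)" using * p q by (auto simp: encode_rat_def split: if_splits)
  then show "p = q" using p q quotient_of_inject_eq by metis
qed

lemma encodes_gadget_word:
  assumes "valid_gadgets n T"
  shows "encodes (gadget_word n base T) {0..<n + length T} (gadget_edge_set n T) (\<lambda>e. 1)
    (gadget_side n base T) ({0..<n + length T} - gadget_side n base T)"
  unfolding encodes_def
proof (intro conjI exI[of _ "n + length T"] exI[of _ "gadget_edges n T"])
  show "partition_of {0..<n + length T} (gadget_side n base T) ({0..<n + length T} - gadget_side n base T)"
    by (auto simp: partition_of_def gadget_side_def)
  have cells: "concat (map (\<lambda>(u, v). [u, v] @ encode_rat 1) (gadget_edges n T)) =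
      concat (map (\<lambda>t. gadget_cells n t (T ! t)) [0..<length T])"
  proof -
    have "concat (map (\<lambda>(u, v). [u, v] @ encode_rat 1) (concat (map (\<lambda>t. [(fst (snd (T ! t)), n + t), (snd (snd (T ! t)), n + t)]) xs)))
       = concat (map (\<lambda>t. gadget_cells n t (T ! t)) xs)" for xs
      by (induction xs) (simp_all add: gadget_cells_def encode_rat_1)
    then show ?thesis by (simp add: gadget_edges_def)
  qed
  have "map (\<lambda>v. if v \<in> gadget_side n base T then 1 else 0) [0..<n + length T]
      = map (\<lambda>v. of_bool (base v)) [0..<n] @ map (\<lambda>g. of_bool (fst g) :: nat) T" (is "?l = ?r")
  proof (rule nth_equalityI)
    fix i assume "i < length ?l"
    then show "?l ! i = ?r ! i" by (auto simp: gadget_side_def nth_append)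
  qed simp
  then show "gadget_word n base T = [n + length T, length (gadget_edges n T)] @
      concat (map (\<lambda>(u, v). [u, v] @ encode_rat 1) (gadget_edges n T)) @
      map (\<lambda>v. if v \<in> gadget_side n base T then 1 else 0) [0..<n + length T]"
    unfolding gadget_word_def cells length_gadget_edges by simp
qed (use assms in \<open>simp_all add: simple_gadget_graph distinct_gadget_edges, simp add: gadget_edge_set_def\<close>)

lemma length_concat_map: "(\<And>x. length (f x) = m) \<Longrightarrow> length (concat (map f xs)) = m * length xs"
  by (induction xs) auto

lemma concat_map_inject:
  assumes "length xs = length ys" "\<And>x. length (f x) = m" "\<And>x. length (g x) = m"
    "concat (map f xs) = concat (map g ys)"
  shows "map f xs = map g ys"
  using assms(1,4) by (induction rule: list_induct2) (auto simp: assms(2,3) append_eq_append_conv)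

text \<open>Membership in \<open>LS_Max_Cut\<close> asks for some instance that the word encodes;
  this pins it to the intended one. The header fixes the number of edges, and each edge takes five
  cells, so the word splits in one way. Weights are determined on edges only.\<close>

lemma encodes_unique:
  assumes "encodes w V E \<omega> A B" "encodes w V' E' \<omega>' A' B'"
  shows "V' = V \<and> E' = E \<and> A' = A \<and> B' = B \<and> (\<forall>e\<in>E. \<omega>' e = \<omega> e)"
proof -
  let ?f = "\<lambda>\<omega> (u, v). [u, v] @ encode_rat (\<omega> {u, v})"
  obtain n es where 1: "V = {0..<n}" "E = set (map (\<lambda>(u, v). {u, v}) es)"
    "w = [n, length es] @ concat (map (?f \<omega>) es) @ map (\<lambda>v. if v \<in> A then 1 else 0) [0..<n]"
    using assms(1) unfolding encodes_def by blast
  obtain n' es' where 2: "V' = {0..<n'}" "E' = set (map (\<lambda>(u, v). {u, v}) es')"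
    "w = [n', length es'] @ concat (map (?f \<omega>') es') @ map (\<lambda>v. if v \<in> A' then 1 else 0) [0..<n']"
    using assms(2) unfolding encodes_def by blast
  have n: "n' = n" "length es' = length es" using 1(3) 2(3) by auto
  have len: "length (?f \<omega> x) = 5" for \<omega> x by (cases x) (simp add: length_encode_rat)
  have "length (concat (map (?f \<omega>) es)) = length (concat (map (?f \<omega>') es'))"
    unfolding length_concat_map[of "?f \<omega>", OF len] length_concat_map[of "?f \<omega>'", OF len] n(2) ..
  then have eq: "concat (map (?f \<omega>) es) = concat (map (?f \<omega>') es')"
    "map (\<lambda>v. if v \<in> A then 1 else 0 :: nat) [0..<n] = map (\<lambda>v. if v \<in> A' then 1 else 0) [0..<n]"
    using 1(3) 2(3) n by (auto simp: append_eq_append_conv)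
  have maps: "map (?f \<omega>) es = map (?f \<omega>') es'"
    by (rule concat_map_inject[OF n(2)[symmetric] len len eq(1)])
  have es: "es ! i = es' ! i \<and> \<omega> {fst (es ! i), snd (es ! i)} = \<omega>' {fst (es ! i), snd (es ! i)}"
    if "i < length es" for i
  proof -
    have "?f \<omega> (es ! i) = ?f \<omega>' (es' ! i)" using arg_cong[OF maps, of "\<lambda>l. l ! i"] that n(2) by simp
    then show ?thesis by (cases "es ! i"; cases "es' ! i") (auto dest: encode_rat_inject)
  qed
  then have "es' = es" using n(2) by (simp add: list_eq_iff_nth_eq)
  moreover have "v \<in> A \<longleftrightarrow> v \<in> A'" if "v < n" for v
    using eq(2) that by (auto simp: map_eq_conv split: if_splits)
  then have "A' \<inter> {0..<n} = A \<inter> {0..<n}" by auto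
  moreover have "A \<subseteq> {0..<n}" "A' \<subseteq> {0..<n}" "B = {0..<n} - A" "B' = {0..<n} - A'"
    using assms 1(1) 2(1) n(1) unfolding encodes_def partition_of_def by blast+
  moreover have "\<omega>' e = \<omega> e" if "e \<in> E" for e
  proof -
    obtain i where i: "i < length es" "e = (case es ! i of (u, v) \<Rightarrow> {u, v})"
      using \<open>e \<in> E\<close> 1(2) by (auto simp: in_set_conv_nth)
    then have "e = {fst (es ! i), snd (es ! i)}" by (simp add: case_prod_beta)
    then show ?thesis using es[OF i(1)] by metis
  qed
  ultimately show ?thesis using 1 2 n by auto
qed

lemma total_weight_cut:
  assumes "valid_gadgets n T" "X \<subseteq> {0..<n + length T}" "\<And>e. e \<in> gadget_edge_set n T \<Longrightarrow> \<omega> e = 1"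
  shows "total_weight \<omega> (edges_between (gadget_edge_set n T) X ({0..<n + length T} - X)) = of_nat (cut_size n T X)"
proof -
  let ?E = "gadget_edge_set n T" and ?V = "{0..<n + length T}"
  define crosses where "crosses e \<longleftrightarrow> (\<exists>x\<in>X. \<exists>y\<in>?V - X. e = {x, y})" for e :: "nat set"
  have fin: "finite ?E" by (simp add: gadget_edge_set_def)
  have crosses: "crosses {a, b} \<longleftrightarrow> (a \<in> X) \<noteq> (b \<in> X)" if "a \<in> ?V" "b \<in> ?V" for a b
  proof
    assume "(a \<in> X) \<noteq> (b \<in> X)"
    then show "crosses {a, b}" unfolding crosses_def using that by (metis DiffI insert_commute)
  qed (auto simp: crosses_def doubleton_eq_iff)
  have "edges_between ?E X (?V - X) = {e \<in> ?E. crosses e}"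
    by (auto simp: edges_between_def crosses_def)
  then have "total_weight \<omega> (edges_between ?E X (?V - X)) = (\<Sum>e\<in>{e \<in> ?E. crosses e}. 1)"
    unfolding total_weight_def using assms(3) by (intro sum.cong) auto
  also have "\<dots> = of_nat (\<Sum>e\<in>?E. of_bool (crosses e))"
    using fin by (simp add: sum.If_cases of_bool_def Int_def)
  also have "(\<Sum>e\<in>?E. of_bool (crosses e)) = (\<Sum>e\<leftarrow>map (\<lambda>(u, v). {u, v}) (gadget_edges n T). of_bool (crosses e) :: nat)"
    using distinct_gadget_edges[OF assms(1)] unfolding gadget_edge_set_def
    by (simp only: sum_list_distinct_conv_sum_set)
  also have "\<dots> = (\<Sum>t\<leftarrow>[0..<length T]. of_bool (crosses {fst (snd (T ! t)), n + t}) + of_bool (crosses {snd (snd (T ! t)), n + t}))"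
  proof -
    have "(\<Sum>e\<leftarrow>map (\<lambda>(u, v). {u, v}) (concat (map (\<lambda>t. [(fst (snd (T ! t)), n + t), (snd (snd (T ! t)), n + t)]) xs)).
        of_bool (crosses e) :: nat) = (\<Sum>t\<leftarrow>xs. of_bool (crosses {fst (snd (T ! t)), n + t}) +
          of_bool (crosses {snd (snd (T ! t)), n + t}))" for xs
      by (induction xs) simp_all
    then show ?thesis unfolding gadget_edges_def .
  qed
  also have "\<dots> = cut_size n T X"
  proof -
    have "of_bool (crosses {fst (snd (T ! t)), n + t}) + of_bool (crosses {snd (snd (T ! t)), n + t})
       = of_bool ((fst (snd (T ! t)) \<in> X) \<noteq> (n + t \<in> X)) + (of_bool ((snd (snd (T ! t)) \<in> X) \<noteq> (n + t \<in> X)) :: nat)"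
      if "t < length T" for t
      using valid_gadgetsD[OF assms(1) that] that by (simp add: crosses)
    then show ?thesis unfolding cut_size_def by (simp add: interv_sum_list_conv_sum_set_nat atLeast0LessThan)
  qed
  finally show ?thesis .
qed

lemma LS_Max_Cut_gadget_word_iff:
  assumes "valid_gadgets n T"
  shows "(gadget_word n base T, k) \<in> LS_Max_Cut \<longleftrightarrow>
    (\<exists>S \<subseteq> {0..<n + length T}. card S \<le> k \<and>
      cut_size n T (gadget_side n base T) < cut_size n T (sym_diff (gadget_side n base T) S))"
proof -
  let ?V = "{0..<n + length T}" and ?E = "gadget_edge_set n T" and ?A = "gadget_side n base T"
  have A: "?A \<subseteq> ?V" by (auto simp: gadget_side_def)
  have flip: "improving_flip ?V ?E \<omega> ?A (?V - ?A) k S \<longleftrightarrow>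
      S \<subseteq> ?V \<and> card S \<le> k \<and> cut_size n T ?A < cut_size n T (sym_diff ?A S)"
    if "\<And>e. e \<in> ?E \<Longrightarrow> \<omega> e = 1" for \<omega> S
  proof (cases "S \<subseteq> ?V")
    case True
    then have "sym_diff (?V - ?A) S = ?V - sym_diff ?A S" "sym_diff ?A S \<subseteq> ?V" using A by auto
    then show ?thesis
      using total_weight_cut[OF assms A that] total_weight_cut[OF assms _ that, of "sym_diff ?A S"]
      by (simp add: improving_flip_def)
  qed (simp add: improving_flip_def)
  show ?thesis
  proof
    assume "(gadget_word n base T, k) \<in> LS_Max_Cut"
    then obtain V E \<omega> A B S where *: "encodes (gadget_word n base T) V E \<omega> A B" "improving_flip V E \<omega> A B k S"
      by (auto simp: LS_Max_Cut_def)
    then show "\<exists>S \<subseteq> ?V. card S \<le> k \<and> cut_size n T ?A < cut_size n T (sym_diff ?A S)"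
      using encodes_unique[OF encodes_gadget_word[OF assms] *(1)] flip[of \<omega> S] by auto
  next
    assume "\<exists>S \<subseteq> ?V. card S \<le> k \<and> cut_size n T ?A < cut_size n T (sym_diff ?A S)"
    then show "(gadget_word n base T, k) \<in> LS_Max_Cut"
      using flip[of "\<lambda>e. 1"] encodes_gadget_word[OF assms, of base] unfolding LS_Max_Cut_def by blast
  qed
qed

lemma gadget_word_instance:
  assumes "valid_gadgets n T"
  shows "(gadget_word n base T, k) \<in> bipartite_2_degenerate_unit_weight_instances"
  unfolding bipartite_2_degenerate_unit_weight_instances_def
  using encodes_gadget_word[OF assms, of base] bipartite_gadget_graph[OF assms]
    degenerate_gadget_graph[OF assms] by fastforce

text \<open>The change of the cut caused by a gadget when the vertices in \<open>S\<close> and possibly the gadget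
  vertex itself (\<open>f\<close>) change sides.\<close>

definition gadget_gain :: "(nat \<Rightarrow> bool) \<Rightarrow> nat set \<Rightarrow> gadget \<Rightarrow> bool \<Rightarrow> int" where
  "gadget_gain base S g f =
     (if base (fst (snd g)) = fst g then 1 else -1) * of_bool ((fst (snd g) \<in> S) \<noteq> f) +
     (if base (snd (snd g)) = fst g then 1 else -1) * of_bool ((snd (snd g) \<in> S) \<noteq> f)"

text \<open>An edge changes its state iff exactly one of its ends is flipped. It is then gained if
  its ends were on the same side, and lost otherwise, which is the sign in
  \<open>gadget_gain\<close>.\<close>

lemma cut_size_flip:
  assumes "valid_gadgets n T" "S \<subseteq> {0..<n + length T}"
  shows "int (cut_size n T (sym_diff (gadget_side n base T) S)) - int (cut_size n T (gadget_side n base T))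
    = (\<Sum>t<length T. gadget_gain base S (T ! t) (n + t \<in> S))"
proof -
  have "int (of_bool ((fst (snd (T ! t)) \<in> sym_diff (gadget_side n base T) S) \<noteq> (n + t \<in> sym_diff (gadget_side n base T) S)) +
     of_bool ((snd (snd (T ! t)) \<in> sym_diff (gadget_side n base T) S) \<noteq> (n + t \<in> sym_diff (gadget_side n base T) S)))
    - int (of_bool ((fst (snd (T ! t)) \<in> gadget_side n base T) \<noteq> (n + t \<in> gadget_side n base T)) +
     of_bool ((snd (snd (T ! t)) \<in> gadget_side n base T) \<noteq> (n + t \<in> gadget_side n base T)))
    = gadget_gain base S (T ! t) (n + t \<in> S)" if "t < length T" for t
    using valid_gadgetsD[OF assms(1) that] that
    by (auto simp: gadget_side_def gadget_gain_def of_bool_def)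
  then show ?thesis
    unfolding cut_size_def of_nat_sum sum_subtractf[symmetric] by (intro sum.cong) auto
qed

section \<open>From cliques to local search\<close>

lemma sum_nth_eq_sum_list: "(\<Sum>t<length T. \<phi> (T ! t)) = (\<Sum>g\<leftarrow>T. \<phi> g)"
  for \<phi> :: "'a \<Rightarrow> 'b::comm_monoid_add"
  by (simp add: sum_list_sum_nth atLeast0LessThan)

lemma sum_list_map_concat: "(\<Sum>g\<leftarrow>concat (map f xs). \<phi> g) = (\<Sum>x\<leftarrow>xs. \<Sum>g\<leftarrow>f x. \<phi> g)"
  for \<phi> :: "'a \<Rightarrow> 'b::comm_monoid_add"
  by (induction xs) auto

lemma sum_list_upt: "(\<Sum>x\<leftarrow>[0..<n]. \<phi> x) = (\<Sum>x<n. \<phi> x)" for \<phi> :: "nat \<Rightarrow> 'b::comm_monoid_add"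
  by (induction n) (auto simp: add.commute)

lemma int_sum_list: "int (\<Sum>g\<leftarrow>T. f g) = (\<Sum>g\<leftarrow>T. int (f g))"
  by (induction T) auto

lemma card_off_diagonal:
  assumes "finite X"
  shows "card (SIGMA u:X. X - {u}) = card X * (card X - 1)"
  using assms by (simp add: card_SigmaI)

text \<open>
  The base vertices \<open>P\<close>, \<open>P + 1\<close> and \<open>P + 2\<close>, \<open>P + 3\<close> are the hubs on the two sides, locked by gadgets whose
  edges are all cut. The gadgets \<open>(False, u, P)\<close> charge one for flipping \<open>u\<close>, the gadgets \<open>(True, u, P + 2)\<close>
  compensate for the edges from \<open>u\<close> to the midpoints \<open>(False, u, j)\<close>. Blocks have constant length so that
  the position of the side bits in the output is known in advance.
\<close>

definition block :: "(nat \<Rightarrow> nat \<Rightarrow> bool) \<Rightarrow> nat \<Rightarrow> nat \<Rightarrow> nat \<Rightarrow> nat \<Rightarrow> nat \<Rightarrow> gadget list" where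
  "block adj \<kappa> P u j i =
     [(False, P, P + 1), (True, P + 2, P + 3), (False, P, P + 1), (True, P + 2, P + 3),
      (False, P, P + 1), (True, P + 2, P + 3)]
     @ (if i < \<kappa> \<and> j + 1 < \<kappa> \<and> 0 < i + j then [(False, u, P), (False, u, P)]
        else [(False, P, P + 1), (False, P, P + 1)])
     @ (if i < \<kappa> \<and> adj u j then [(False, u, j), (True, u, P + 2), (True, u, P + 2)]
        else [(False, P, P + 1), (False, P, P + 1), (False, P, P + 1)])"

definition clique_gadgets :: "(nat \<Rightarrow> nat \<Rightarrow> bool) \<Rightarrow> nat \<Rightarrow> nat \<Rightarrow> gadget list" where
  "clique_gadgets adj \<kappa> P = concat (map (\<lambda>u. concat (map (\<lambda>j. concat (map (\<lambda>i.
     block adj \<kappa> P u j i) [0..<P])) [0..<P])) [0..<P])"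

lemma length_block: "length (block adj \<kappa> P u j i) = 11"
  by (simp add: block_def)

lemma length_clique_gadgets: "length (clique_gadgets adj \<kappa> P) = 11 * (P * P * P)"
  by (simp add: clique_gadgets_def length_concat comp_def length_block sum_list_triv)

lemma sum_clique_gadgets:
  "(\<Sum>g\<leftarrow>clique_gadgets adj \<kappa> P. \<phi> g) = (\<Sum>u<P. \<Sum>j<P. \<Sum>i<P. \<Sum>g\<leftarrow>block adj \<kappa> P u j i. \<phi> g)"
  for \<phi> :: "gadget \<Rightarrow> 'b::comm_monoid_add"
  by (simp add: clique_gadgets_def sum_list_map_concat sum_list_upt)

lemma in_clique_gadgets:
  assumes "g \<in> set (clique_gadgets adj \<kappa> P)"
  obtains "g = (False, P, P + 1)" | "g = (True, P + 2, P + 3)"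
  | u where "u < P" "g = (False, u, P)"
  | u where "u < P" "g = (True, u, P + 2)"
  | u j where "u < P" "j < P" "adj u j" "g = (False, u, j)"
proof -
  obtain u j i where "u < P" "j < P" "g \<in> set (block adj \<kappa> P u j i)"
    using assms by (auto simp: clique_gadgets_def)
  then show ?thesis
    using that unfolding block_def by (auto split: if_splits)
qed

locale clique_cut =
  fixes adj :: "nat \<Rightarrow> nat \<Rightarrow> bool" and \<kappa> P :: nat
  assumes adj_sym: "adj u v \<Longrightarrow> adj v u" and adj_irrefl: "\<not> adj u u"
    and \<kappa>: "2 \<le> \<kappa>" "\<kappa> \<le> P"
begin

abbreviation "n \<equiv> P + 4"
abbreviation "T \<equiv> clique_gadgets adj \<kappa> P"
abbreviation "base \<equiv> (\<lambda>v. v < P + 2)"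
abbreviation "budget \<equiv> \<kappa> + \<kappa> * \<kappa> * (\<kappa> - 1)"

lemma valid: "valid_gadgets n T"
  unfolding valid_gadgets_def
proof
  fix g assume "g \<in> set T"
  then show "fst (snd g) < n \<and> snd (snd g) < n \<and> fst (snd g) \<noteq> snd (snd g)"
    by (cases rule: in_clique_gadgets) (use adj_irrefl in auto)
qed

lemma budget_le: "budget \<le> P * P * P"
proof -
  have "\<kappa> + \<kappa> * \<kappa> * (\<kappa> - 1) \<le> \<kappa> * \<kappa> + \<kappa> * \<kappa> * (\<kappa> - 1)" using \<kappa>(1) by simp
  also have "\<dots> = \<kappa> * \<kappa> * \<kappa>" using \<kappa>(1) by (cases \<kappa>) (simp_all add: algebra_simps)
  also have "\<dots> \<le> P * P * P" using \<kappa>(2) by (intro mult_mono) auto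
  finally show ?thesis .
qed

section \<open>Gains of a flip set, charged against penalties and budget\<close>

lemma card_flipped_le:
  assumes "S \<subseteq> {0..<n + length T}"
  shows "card (S \<inter> {..<P}) + (\<Sum>t<length T. of_bool (n + t \<in> S)) \<le> card S"
proof -
  have fin: "finite S" using assms finite_subset by blast
  have "(\<Sum>t<length T. of_bool (n + t \<in> S)) = card {t \<in> {..<length T}. n + t \<in> S}"
    by (simp add: sum.If_cases of_bool_def Int_def)
  also have "\<dots> = card ((+) n ` {t \<in> {..<length T}. n + t \<in> S})"
    by (simp add: card_image)
  finally have "card (S \<inter> {..<P}) + (\<Sum>t<length T. of_bool (n + t \<in> S))
     = card (S \<inter> {..<P} \<union> (+) n ` {t \<in> {..<length T}. n + t \<in> S})"
    using fin by (subst card_Un_disjoint) auto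
  also have "\<dots> \<le> card S" using fin by (intro card_mono) auto
  finally show ?thesis .
qed

text \<open>Three locks per side in each block outweigh its at most two compensating gadgets, so a
  flipped hub costs at least 1 in each of the \<open>P * P * P\<close> blocks. Flipping a gadget
  vertex wins back at most 1 against this estimate, and the budget allows at most
  \<open>P * P * P\<close> such flips.\<close>

lemma no_gain_if_hub_flipped:
  assumes S: "S \<subseteq> {0..<n + length T}" "card S \<le> budget" and hub: "h \<in> S" "P \<le> h" "h < n"
  shows "(\<Sum>t<length T. gadget_gain base S (T ! t) (n + t \<in> S)) \<le> 0"
proof -
  define loss :: "gadget \<Rightarrow> int" where "loss g =
    (if g = (False, P, P + 1) then - of_bool (P \<in> S \<or> P + 1 \<in> S)
     else if g = (True, P + 2, P + 3) then - of_bool (P + 2 \<in> S \<or> P + 3 \<in> S)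
     else of_bool (fst g))" for g
  have gain: "gadget_gain base S g f \<le> loss g + of_bool f" if "g \<in> set T" for g f
    using that by (cases rule: in_clique_gadgets) (auto simp: gadget_gain_def loss_def)
  have "(\<Sum>t<length T. gadget_gain base S (T ! t) (n + t \<in> S)) \<le> (\<Sum>t<length T. loss (T ! t) + of_bool (n + t \<in> S))"
    by (intro sum_mono gain) simp
  also have "\<dots> = (\<Sum>g\<leftarrow>T. loss g) + int (\<Sum>t<length T. of_bool (n + t \<in> S))"
    by (simp add: sum.distrib sum_nth_eq_sum_list)
  also have "(\<Sum>g\<leftarrow>T. loss g) \<le> (\<Sum>u<P. \<Sum>j<P. \<Sum>i<P. -1)"
    unfolding sum_clique_gadgets
  proof (intro sum_mono)
    fix u j i assume "u \<in> {..<P}" "j \<in> {..<P}"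
    moreover have "h = P \<or> h = P + 1 \<or> h = P + 2 \<or> h = P + 3" using hub by auto
    ultimately show "(\<Sum>g\<leftarrow>block adj \<kappa> P u j i. loss g) \<le> -1"
      using hub(1) by (auto simp: block_def loss_def)
  qed
  also have "(\<Sum>u<P. \<Sum>j<P. \<Sum>i<P. -1) = - int (P * P * P)" by simp
  finally have "(\<Sum>t<length T. gadget_gain base S (T ! t) (n + t \<in> S)) \<le>
      - int (P * P * P) + int (\<Sum>t<length T. of_bool (n + t \<in> S))" by simp
  moreover have "(\<Sum>t<length T. of_bool (n + t \<in> S)) \<le> P * P * P"
    using card_flipped_le[OF S(1)] S(2) budget_le by linarith
  ultimately show ?thesis by linarith
qed

text \<open>The gain of a gadget whose own vertex stays, provided that no hub is flipped. Flipping
  that vertex pays only at a midpoint whose two neighbours are flipped (\<open>inside\<close>),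
  where it recovers both lost edges, that is, 2.\<close>

definition value_bound :: "nat set \<Rightarrow> gadget \<Rightarrow> int" where
  "value_bound S g =
     (if snd (snd g) < P then - of_bool (fst (snd g) \<in> S) - of_bool (snd (snd g) \<in> S)
      else if fst (snd g) < P then (if fst g then 1 else -1) * of_bool (fst (snd g) \<in> S) else 0)"

definition inside :: "nat set \<Rightarrow> gadget \<Rightarrow> bool" where
  "inside S g \<longleftrightarrow> snd (snd g) < P \<and> fst (snd g) \<in> S \<and> snd (snd g) \<in> S"

definition adj_pairs :: "nat set \<Rightarrow> (nat \<times> nat) set" where
  "adj_pairs S = {(u, j). u \<in> S \<inter> {..<P} \<and> j \<in> S \<inter> {..<P} \<and> adj u j}"

lemma gain_le:
  assumes "S \<inter> {P..<n} = {}" "g \<in> set T"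
  shows "gadget_gain base S g f \<le> value_bound S g + 2 * of_bool (inside S g \<and> f)"
proof -
  have "P \<notin> S" "P + 1 \<notin> S" "P + 2 \<notin> S" "P + 3 \<notin> S" using assms(1) by auto
  with assms(2) show ?thesis
    by (cases rule: in_clique_gadgets) (auto simp: gadget_gain_def value_bound_def inside_def)
qed

lemma gain_eq:
  assumes "S \<inter> {P..<n} = {}" "g \<in> set T"
  shows "gadget_gain base S g (inside S g) = value_bound S g + 2 * of_bool (inside S g)"
proof -
  have "P \<notin> S" "P + 1 \<notin> S" "P + 2 \<notin> S" "P + 3 \<notin> S" using assms(1) by auto
  with assms(2) show ?thesis
    by (cases rule: in_clique_gadgets) (auto simp: gadget_gain_def value_bound_def inside_def)
qed

lemma sum_of_bool_less: "m \<le> P \<Longrightarrow> (\<Sum>i<P. of_bool (i < m)) = int m"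
proof -
  assume "m \<le> P"
  then have "{..<P} \<inter> {i. i < m} = {..<m}" by auto
  then show ?thesis by (simp add: sum.If_cases of_bool_def)
qed

text \<open>The pairs with \<open>i < \<kappa>\<close> and \<open>j < \<kappa> - 1\<close> number
  \<open>\<kappa> * (\<kappa> - 1)\<close>; excluding the pair (0, 0) subtracts the 1 that makes the
  gain of a clique strictly positive.\<close>

lemma penalty_count:
  "(\<Sum>j<P. \<Sum>i<P. of_bool (i < \<kappa> \<and> j + 1 < \<kappa> \<and> 0 < i + j)) = int \<kappa> * (int \<kappa> - 1) - 1"
proof -
  have "(of_bool (i < \<kappa> \<and> j + 1 < \<kappa> \<and> 0 < i + j) :: int) =
     of_bool (i < \<kappa>) * of_bool (j < \<kappa> - 1) - of_bool (i < 1) * of_bool (j < 1)" for i j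
    using \<kappa>(1) by auto
  then have "(\<Sum>j<P. \<Sum>i<P. of_bool (i < \<kappa> \<and> j + 1 < \<kappa> \<and> 0 < i + j)) =
     (\<Sum>j<P. \<Sum>i<P. of_bool (i < \<kappa>) * of_bool (j < \<kappa> - 1) - of_bool (i < 1) * of_bool (j < 1) :: int)"
    by presburger
  also have "\<dots> = int \<kappa> * int (\<kappa> - 1) - int 1 * int 1"
    using \<kappa> by (simp only: sum_subtractf sum_distrib_right[symmetric] sum_distrib_left[symmetric] sum_of_bool_less)
  finally show ?thesis using \<kappa>(1) by (simp add: of_nat_diff)
qed

text \<open>Per copy of an adjacent ordered pair, the midpoint charges \<open>u\<close> and
  \<open>j\<close> one each and the two compensating gadgets refund two to \<open>u\<close>. The
  remainder \<open>F u - F j\<close> cancels over both orders by symmetry of \<open>adj\<close>, so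
  only the penalties are left.\<close>

lemma sum_value_bound:
  "(\<Sum>g\<leftarrow>T. value_bound S g) = - 2 * (int \<kappa> * (int \<kappa> - 1) - 1) * int (card (S \<inter> {..<P}))"
proof -
  define F :: "nat \<Rightarrow> int" where "F u = of_bool (u \<in> S)" for u
  define pen :: "nat \<Rightarrow> nat \<Rightarrow> int" where "pen j i = of_bool (i < \<kappa> \<and> j + 1 < \<kappa> \<and> 0 < i + j)" for j i
  define ad :: "nat \<Rightarrow> nat \<Rightarrow> int" where "ad u j = of_bool (adj u j)" for u j
  have "(\<Sum>g\<leftarrow>block adj \<kappa> P u j i. value_bound S g) =
      - 2 * F u * pen j i + of_bool (i < \<kappa>) * (ad u j * F u - ad u j * F j)" if "u < P" "j < P" for u j i
    using that by (auto simp: block_def value_bound_def F_def pen_def ad_def)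
  then have "(\<Sum>g\<leftarrow>T. value_bound S g) =
      (\<Sum>u<P. \<Sum>j<P. \<Sum>i<P. - 2 * F u * pen j i + of_bool (i < \<kappa>) * (ad u j * F u - ad u j * F j))"
    unfolding sum_clique_gadgets by (intro sum.cong) auto
  also have "\<dots> = (\<Sum>u<P. - 2 * F u * (\<Sum>j<P. \<Sum>i<P. pen j i)) +
      int \<kappa> * ((\<Sum>u<P. \<Sum>j<P. ad u j * F u) - (\<Sum>u<P. \<Sum>j<P. ad u j * F j))"
  proof -
    have i: "(\<Sum>i<P. - 2 * F u * pen j i + of_bool (i < \<kappa>) * x) = - 2 * F u * (\<Sum>i<P. pen j i) + int \<kappa> * x" for u j x
      by (simp only: sum.distrib sum_distrib_left[symmetric] sum_distrib_right[symmetric] sum_of_bool_less[OF \<kappa>(2)])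
    have j: "(\<Sum>j<P. - 2 * F u * (\<Sum>i<P. pen j i) + int \<kappa> * (ad u j * F u - ad u j * F j)) =
        - 2 * F u * (\<Sum>j<P. \<Sum>i<P. pen j i) + int \<kappa> * ((\<Sum>j<P. ad u j * F u) - (\<Sum>j<P. ad u j * F j))" for u
      by (simp only: sum.distrib sum_distrib_left[symmetric] sum_subtractf)
    show ?thesis unfolding i j
      by (simp only: sum.distrib sum_distrib_left[of "int \<kappa>", symmetric] sum_subtractf)
  qed
  also have "(\<Sum>u<P. \<Sum>j<P. ad u j * F j) = (\<Sum>u<P. \<Sum>j<P. ad u j * F u)"
  proof -
    have "ad u j = ad j u" for u j using adj_sym by (auto simp: ad_def)
    then show ?thesis using sum.swap[of "\<lambda>u j. ad u j * F j" "{..<P}" "{..<P}"] by simp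
  qed
  also have "(\<Sum>j<P. \<Sum>i<P. pen j i) = int \<kappa> * (int \<kappa> - 1) - 1"
    unfolding pen_def by (rule penalty_count)
  also have "(\<Sum>u<P. - 2 * F u * (int \<kappa> * (int \<kappa> - 1) - 1)) = - 2 * (int \<kappa> * (int \<kappa> - 1) - 1) * (\<Sum>u<P. F u)"
    unfolding sum_distrib_left by (intro sum.cong refl) (simp only: mult.commute mult.left_commute)
  also have "(\<Sum>u<P. F u) = int (card (S \<inter> {..<P}))"
    by (simp add: F_def sum.If_cases of_bool_def Int_commute)
  finally show ?thesis by simp
qed

lemma sum_inside: "(\<Sum>g\<leftarrow>T. of_bool (inside S g)) = \<kappa> * card (adj_pairs S)"
proof -
  have "(\<Sum>g\<leftarrow>block adj \<kappa> P u j i. of_bool (inside S g)) =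
      of_bool (i < \<kappa>) * (of_bool ((u, j) \<in> adj_pairs S) :: int)" if "u < P" "j < P" for u j i
    using that by (auto simp: block_def inside_def adj_pairs_def)
  then have "(\<Sum>g\<leftarrow>T. of_bool (inside S g)) =
      (\<Sum>u<P. \<Sum>j<P. \<Sum>i<P. of_bool (i < \<kappa>) * (of_bool ((u, j) \<in> adj_pairs S) :: int))"
    unfolding sum_clique_gadgets by (intro sum.cong) auto
  also have "\<dots> = int \<kappa> * (\<Sum>u<P. \<Sum>j<P. of_bool ((u, j) \<in> adj_pairs S))"
    unfolding sum_distrib_right[symmetric] sum_of_bool_less[OF \<kappa>(2)] sum_distrib_left[symmetric] ..
  also have "(\<Sum>u<P. \<Sum>j<P. of_bool ((u, j) \<in> adj_pairs S)) = (\<Sum>p\<in>{..<P} \<times> {..<P}. of_bool (p \<in> adj_pairs S) :: int)"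
    unfolding sum.cartesian_product by (intro sum.cong) (auto split: prod.splits)
  also have "\<dots> = int (card (({..<P} \<times> {..<P}) \<inter> adj_pairs S))"
    by (simp add: sum.If_cases of_bool_def)
  also have "({..<P} \<times> {..<P}) \<inter> adj_pairs S = adj_pairs S" by (auto simp: adj_pairs_def)
  finally have "int (\<Sum>g\<leftarrow>T. of_bool (inside S g)) = int (\<kappa> * card (adj_pairs S))"
    by (simp add: int_sum_list)
  then show ?thesis using of_nat_eq_iff by blast
qed

lemma sum_inside_nth: "(\<Sum>t<length T. of_bool (inside S (T ! t))) = \<kappa> * card (adj_pairs S)"
  using sum_nth_eq_sum_list[of "\<lambda>g. of_bool (inside S g) :: nat" T] sum_inside[of S] by (simp only:)

lemma adj_pairs_off_diagonal: "adj_pairs S \<subseteq> (SIGMA u:S \<inter> {..<P}. S \<inter> {..<P} - {u})"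
  using adj_irrefl by (auto simp: adj_pairs_def)

lemma clique_if_improving:
  assumes S: "S \<subseteq> {0..<n + length T}" "card S \<le> budget"
    and gain: "(\<Sum>t<length T. gadget_gain base S (T ! t) (n + t \<in> S)) > 0"
  shows "\<exists>Q \<subseteq> {..<P}. card Q = \<kappa> \<and> (\<forall>u\<in>Q. \<forall>v\<in>Q. u \<noteq> v \<longrightarrow> adj u v)"
proof -
  let ?Q = "S \<inter> {..<P}"
  define a where "a = card ?Q"
  define D where "D = card (adj_pairs S)"
  define E :: nat where "E = (\<Sum>t<length T. of_bool (inside S (T ! t) \<and> n + t \<in> S))"
  have hubs: "S \<inter> {P..<n} = {}"
  proof (rule ccontr)
    assume "S \<inter> {P..<n} \<noteq> {}"
    then obtain h where "h \<in> S" "P \<le> h" "h < n" by auto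
    from no_gain_if_hub_flipped[OF S this] gain show False by linarith
  qed
  have "(\<Sum>t<length T. gadget_gain base S (T ! t) (n + t \<in> S)) \<le>
      (\<Sum>t<length T. value_bound S (T ! t) + 2 * of_bool (inside S (T ! t) \<and> n + t \<in> S))"
    by (intro sum_mono gain_le[OF hubs]) simp
  also have "\<dots> = (\<Sum>g\<leftarrow>T. value_bound S g) + 2 * int E"
    by (simp add: sum.distrib sum_nth_eq_sum_list sum_distrib_left E_def)
  also have "(\<Sum>g\<leftarrow>T. value_bound S g) = - 2 * (int \<kappa> * (int \<kappa> - 1) - 1) * int a"
    by (simp add: sum_value_bound a_def)
  finally have E_gt: "(int \<kappa> * (int \<kappa> - 1) - 1) * int a < int E" using gain by linarith
  have "E \<le> (\<Sum>t<length T. of_bool (inside S (T ! t)))" unfolding E_def by (intro sum_mono) auto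
  then have E1: "E \<le> \<kappa> * D" unfolding sum_inside_nth D_def .
  have "E \<le> (\<Sum>t<length T. of_bool (n + t \<in> S))" unfolding E_def by (intro sum_mono) auto
  then have E2: "a + E \<le> budget" using card_flipped_le[OF S(1)] S(2) unfolding a_def by linarith
  have card_off: "card (SIGMA u:?Q. ?Q - {u}) = a * (a - 1)"
    unfolding a_def by (rule card_off_diagonal) simp
  have D_le: "D \<le> a * (a - 1)"
    unfolding D_def card_off[symmetric] by (intro card_mono adj_pairs_off_diagonal) auto
  have a_pos: "a > 0" using E_gt E1 D_le by (cases "a = 0") auto
  have \<kappa>1: "int (\<kappa> - 1) = int \<kappa> - 1" and a1: "int (a - 1) = int a - 1"
    using \<kappa>(1) a_pos by (auto simp: of_nat_diff)
  have E1': "int E \<le> int \<kappa> * int D" using E1 by (metis of_nat_le_iff of_nat_mult)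
  have D_le': "int D \<le> int a * (int a - 1)" using D_le a1 by (metis of_nat_le_iff of_nat_mult)
  have E2': "int a + int E \<le> int \<kappa> + int \<kappa> * int \<kappa> * (int \<kappa> - 1)"
    using E2 \<kappa>1 by (metis of_nat_le_iff of_nat_mult of_nat_add)
  \<comment> \<open>Per flipped vertex there are at most \<open>\<kappa> * (a - 1)\<close> useful
    midpoints, which for \<open>a < \<kappa>\<close> falls short of the penalty to be paid.\<close>
  have "\<not> a < \<kappa>"
  proof
    assume "a < \<kappa>"
    have "int \<kappa> * int D \<le> int \<kappa> * (int a * (int a - 1))" using D_le' by (intro mult_left_mono) auto
    then have "(int \<kappa> * (int \<kappa> - 1) - 1) * int a < (int \<kappa> * (int a - 1)) * int a"
      using E_gt E1' by (simp add: algebra_simps)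
    then have "int \<kappa> * (int \<kappa> - 1) - 1 < int \<kappa> * (int a - 1)"
      using a_pos by (simp add: mult_less_cancel_right)
    moreover have "int \<kappa> * (int a - 1) \<le> int \<kappa> * (int \<kappa> - 2)"
      using \<open>a < \<kappa>\<close> by (intro mult_left_mono) auto
    ultimately show False using \<kappa>(1) by (simp add: algebra_simps)
  qed
  \<comment> \<open>Now the budget is the bottleneck: every additional vertex uses up a flip and
    raises the penalty, while fewer midpoints can still be flipped.\<close>
  moreover have "\<not> a > \<kappa>"
  proof
    assume "a > \<kappa>"
    have "int \<kappa> * (int \<kappa> - 1) * int a < int \<kappa> * (1 + int \<kappa> * (int \<kappa> - 1))"
      using E_gt E2' by (simp add: algebra_simps)
    then have "int \<kappa> * ((int \<kappa> - 1) * int a) < int \<kappa> * (1 + int \<kappa> * (int \<kappa> - 1))"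
      by (simp only: mult.assoc)
    then have "(int \<kappa> - 1) * int a < 1 + int \<kappa> * (int \<kappa> - 1)"
      using \<kappa>(1) by (simp add: mult_less_cancel_left)
    moreover have "(int \<kappa> - 1) * (int \<kappa> + 1) \<le> (int \<kappa> - 1) * int a"
      using \<open>a > \<kappa>\<close> \<kappa>(1) by (intro mult_left_mono) auto
    ultimately show False using \<kappa>(1) by (simp add: algebra_simps)
  qed
  ultimately have a\<kappa>: "a = \<kappa>" by simp
  \<comment> \<open>For \<open>a = \<kappa>\<close>, a deficit of one ordered pair would already
    give equality, so strictness leaves no pair missing.\<close>
  have "int \<kappa> * (int \<kappa> * (int \<kappa> - 1) - 1) < int \<kappa> * int D" using E_gt E1' a\<kappa> by (simp add: mult.commute)
  then have "int \<kappa> * (int \<kappa> - 1) - 1 < int D" using \<kappa>(1) by (simp add: mult_less_cancel_left)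
  then have "int (\<kappa> * (\<kappa> - 1)) \<le> int D" unfolding of_nat_mult \<kappa>1 by linarith
  then have "\<kappa> * (\<kappa> - 1) \<le> D" unfolding of_nat_le_iff .
  then have "D = a * (a - 1)" using D_le a\<kappa> by simp
  then have "adj_pairs S = (SIGMA u:?Q. ?Q - {u})"
    using card_subset_eq[OF _ adj_pairs_off_diagonal] card_off unfolding D_def by auto
  then have "\<forall>u\<in>?Q. \<forall>v\<in>?Q. u \<noteq> v \<longrightarrow> adj u v" by (auto simp: adj_pairs_def)
  then show ?thesis using a\<kappa> unfolding a_def by (intro exI[of _ ?Q]) auto
qed

text \<open>Flipping the clique together with all its midpoints uses the budget exactly and gains
  \<open>2 * \<kappa>\<close>.\<close>

lemma improving_if_clique:
  assumes Q: "Q \<subseteq> {..<P}" "card Q = \<kappa>" "\<forall>u\<in>Q. \<forall>v\<in>Q. u \<noteq> v \<longrightarrow> adj u v"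
  shows "\<exists>S \<subseteq> {0..<n + length T}. card S \<le> budget \<and>
    (\<Sum>t<length T. gadget_gain base S (T ! t) (n + t \<in> S)) > 0"
proof -
  define X where "X = {t \<in> {..<length T}. inside Q (T ! t)}"
  define S where "S = Q \<union> (+) n ` X"
  have finQ: "finite Q" using Q(1) finite_subset by blast
  have S: "S \<subseteq> {0..<n + length T}" using Q(1) by (auto simp: S_def X_def)
  have SQ: "S \<inter> {..<P} = Q" and hubs: "S \<inter> {P..<n} = {}" using Q(1) by (auto simp: S_def)
  have "adj_pairs S = (SIGMA u:Q. Q - {u})" unfolding adj_pairs_def SQ using Q(3) adj_irrefl by auto
  then have pairs: "card (adj_pairs S) = \<kappa> * (\<kappa> - 1)" using card_off_diagonal[OF finQ] Q(2) by simp
  have inside: "inside S g = inside Q g" if "g \<in> set T" for g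
    using that Q(1) by (cases rule: in_clique_gadgets) (auto simp: inside_def S_def)
  have sumI: "(\<Sum>t<length T. of_bool (inside S (T ! t))) = \<kappa> * (\<kappa> * (\<kappa> - 1))"
    unfolding sum_inside_nth pairs ..
  have "card X = (\<Sum>t<length T. of_bool (inside S (T ! t)))"
    unfolding X_def using inside by (simp add: sum.If_cases of_bool_def Int_def cong: conj_cong)
  then have cardX: "card X = \<kappa> * (\<kappa> * (\<kappa> - 1))" using sumI by simp
  have "card S \<le> card Q + card ((+) n ` X)" unfolding S_def by (rule card_Un_le)
  also have "\<dots> = budget" using Q(2) cardX by (simp add: card_image)
  finally have cardS: "card S \<le> budget" .
  have flipped: "n + t \<in> S \<longleftrightarrow> inside S (T ! t)" if "t < length T" for t
    using that Q(1) inside[of "T ! t"] by (auto simp: S_def X_def)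
  have "(\<Sum>t<length T. gadget_gain base S (T ! t) (n + t \<in> S)) =
      (\<Sum>t<length T. value_bound S (T ! t) + 2 * of_bool (inside S (T ! t)))"
    using gain_eq[OF hubs] flipped by (intro sum.cong) auto
  also have "\<dots> = (\<Sum>g\<leftarrow>T. value_bound S g) + 2 * int (\<Sum>t<length T. of_bool (inside S (T ! t)))"
    by (simp add: sum.distrib sum_nth_eq_sum_list sum_distrib_left)
  also have "\<dots> = - 2 * (int \<kappa> * (int \<kappa> - 1) - 1) * int \<kappa> + 2 * int (\<kappa> * (\<kappa> * (\<kappa> - 1)))"
    unfolding sumI sum_value_bound SQ Q(2) ..
  also have "\<dots> = 2 * int \<kappa>" using \<kappa>(1) by (simp add: of_nat_diff algebra_simps)
  finally have "(\<Sum>t<length T. gadget_gain base S (T ! t) (n + t \<in> S)) > 0" using \<kappa>(1) by simp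
  with S cardS show ?thesis by blast
qed

theorem LS_Max_Cut_iff_clique:
  "(gadget_word n base T, budget) \<in> LS_Max_Cut \<longleftrightarrow>
    (\<exists>Q \<subseteq> {..<P}. card Q = \<kappa> \<and> (\<forall>u\<in>Q. \<forall>v\<in>Q. u \<noteq> v \<longrightarrow> adj u v))"
proof -
  have improves: "cut_size n T (gadget_side n base T) < cut_size n T (sym_diff (gadget_side n base T) S) \<longleftrightarrow>
      (\<Sum>t<length T. gadget_gain base S (T ! t) (n + t \<in> S)) > 0" if "S \<subseteq> {0..<n + length T}" for S
    using cut_size_flip[OF valid that, of base] by linarith
  show ?thesis
    unfolding LS_Max_Cut_gadget_word_iff[OF valid]
  proof
    assume "\<exists>S\<subseteq>{0..<n + length T}. card S \<le> budget \<and>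
      cut_size n T (gadget_side n base T) < cut_size n T (sym_diff (gadget_side n base T) S)"
    then obtain S where S: "S \<subseteq> {0..<n + length T}" "card S \<le> budget"
      "cut_size n T (gadget_side n base T) < cut_size n T (sym_diff (gadget_side n base T) S)" by blast
    show "\<exists>Q \<subseteq> {..<P}. card Q = \<kappa> \<and> (\<forall>u\<in>Q. \<forall>v\<in>Q. u \<noteq> v \<longrightarrow> adj u v)"
      using clique_if_improving[OF S(1,2)] S(3) improves[OF S(1)] by simp
  next
    assume "\<exists>Q \<subseteq> {..<P}. card Q = \<kappa> \<and> (\<forall>u\<in>Q. \<forall>v\<in>Q. u \<noteq> v \<longrightarrow> adj u v)"
    then obtain Q where "Q \<subseteq> {..<P}" "card Q = \<kappa>" "\<forall>u\<in>Q. \<forall>v\<in>Q. u \<noteq> v \<longrightarrow> adj u v" by blast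
    from improving_if_clique[OF this] obtain S where S: "S \<subseteq> {0..<n + length T}" "card S \<le> budget"
      "(\<Sum>t<length T. gadget_gain base S (T ! t) (n + t \<in> S)) > 0" by blast
    show "\<exists>S\<subseteq>{0..<n + length T}. card S \<le> budget \<and>
      cut_size n T (gadget_side n base T) < cut_size n T (sym_diff (gadget_side n base T) S)"
      using S(1,2,3) improves[OF S(1)] by (intro exI[of _ S] conjI) simp_all
  qed
qed

end

section \<open>Compatibility of rows as a bounded formula\<close>

definition qv :: "nat \<Rightarrow> aexp" where "qv l = Read (qvar l) (Const 0)"

definition cell :: "aexp \<Rightarrow> nat \<Rightarrow> aexp \<Rightarrow> aexp" where
  "cell r c e = Read 7 (Add r (Add (Const c) e))"

text \<open>Nodes are addressed by position plus one, leaving 0 for padding, whereas the input lists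
  bare positions; hence the added 1.\<close>

definition child :: "aexp \<Rightarrow> aexp \<Rightarrow> aexp" where
  "child e j = Add (Read 3 (Add (Read 6 e) j)) (Const 1)"

definition f_assumed :: "nat \<Rightarrow> aexp \<Rightarrow> bool \<Rightarrow> nat \<Rightarrow> aexp \<Rightarrow> fm" where
  "f_assumed R r b l e =
     FE (FA (FLess (qv l) (Const R)) (FEq (cell r (if b then 0 else R) (qv l)) e))"

definition f_observed :: "nat \<Rightarrow> aexp \<Rightarrow> bool \<Rightarrow> nat \<Rightarrow> aexp \<Rightarrow> fm" where
  "f_observed R r b l e = FA (FEq (Read 4 e) (Const 0))
     (if b then FE (FA (FLess (qv l) (Const R)) (FEq (cell r (3 * R) (qv l)) e))
      else FE (FA (FLess (qv l) (Const R)) (FE (FA (FLess (qv (Suc l)) (Const R))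
        (FA (FEq (cell r (2 * R) (qv (Suc l))) (Add (cell r (2 * R) (qv l)) (Const 1)))
        (FA (FLess (cell r (3 * R) (qv l)) e) (FLess e (cell r (3 * R) (qv (Suc l))))))))))"

text \<open>The recursion on the height happens outside the formula, so the formula does not depend
  on the input. For the value \<open>b\<close> all predecessors are needed at a conjunction if
  \<open>b\<close> holds and at a disjunction otherwise, hence the codes 2 and 3 swap.\<close>

primrec f_derivable :: "(bool \<Rightarrow> nat \<Rightarrow> aexp \<Rightarrow> fm) \<Rightarrow> nat \<Rightarrow> bool \<Rightarrow> nat \<Rightarrow> aexp \<Rightarrow> fm" where
  "f_derivable A 0 b l e = A b l e"
| "f_derivable A (Suc h) b l e = FO (A b l e)
     (FO (FA (FEq (Read 4 e) (Const 1)) (f_derivable A h (\<not> b) l (child e (Const 0))))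
     (FO (FA (FEq (Read 4 e) (Const (if b then 2 else 3)))
           (FAll (FI (FLess (qv l) (Read 5 e)) (f_derivable A h b (Suc l) (child e (qv l))))))
         (FA (FEq (Read 4 e) (Const (if b then 3 else 2)))
           (FE (FA (FLess (qv l) (Read 5 e)) (f_derivable A h b (Suc l) (child e (qv l))))))))"

text \<open>In a decoded memory array 4 is 0 at inputs and at all indices outside the circuit, so a
  single test covers the three alternatives in \<open>slots_ok\<close>.\<close>

definition f_slots :: "nat \<Rightarrow> nat \<Rightarrow> aexp \<Rightarrow> fm" where
  "f_slots R l r = FAll (FI (FLess (qv l) (Const R))
     (FA (FLess (cell r (2 * R) (qv l)) (Add (Read 9 (Const 0)) (Const 2)))
     (FA (FI (FEq (cell r (2 * R) (qv l)) (Const 0)) (FEq (cell r (3 * R) (qv l)) (Const 0)))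
     (FA (FI (FEq (cell r (2 * R) (qv l)) (Add (Read 9 (Const 0)) (Const 1)))
             (FEq (cell r (3 * R) (qv l)) (Add (Read 9 (Const 1)) (Const 1))))
         (FEq (Read 4 (cell r (3 * R) (qv l))) (Const 0))))))"

definition FIff :: "fm \<Rightarrow> fm \<Rightarrow> fm" where "FIff \<phi> \<psi> = FA (FI \<phi> \<psi>) (FI \<psi> \<phi>)"

definition f_order :: "nat \<Rightarrow> nat \<Rightarrow> aexp \<Rightarrow> aexp \<Rightarrow> fm" where
  "f_order R l r q = FAll (FI (FLess (qv l) (Const R)) (FAll (FI (FLess (qv (Suc l)) (Const R))
     (FA (FIff (FLess (cell r (2 * R) (qv l)) (cell q (2 * R) (qv (Suc l))))
               (FLess (cell r (3 * R) (qv l)) (cell q (3 * R) (qv (Suc l)))))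
         (FIff (FLess (cell q (2 * R) (qv (Suc l))) (cell r (2 * R) (qv l)))
               (FLess (cell q (3 * R) (qv (Suc l))) (cell r (3 * R) (qv l))))))))"

definition f_claims :: "nat \<Rightarrow> nat \<Rightarrow> nat \<Rightarrow> aexp \<Rightarrow> bool \<Rightarrow> fm" where
  "f_claims R d l r b = (let g = cell r (if b then 0 else R) (qv l) in
     FAll (FI (FLess (qv l) (Const R)) (FO (FEq g (Const 0))
       (FA (FLess g (Add (Read 9 (Const 1)) (Const 1)))
       (FA (FO (FEq (Read 4 g) (Const 0))
               (FA (FEq (Read 4 g) (Const (if b then 2 else 3))) (FLess (Const 2) (Read 5 g))))
           (FN (f_derivable (f_observed R r) d (\<not> b) (Suc l) g)))))))"

definition f_good :: "nat \<Rightarrow> nat \<Rightarrow> aexp \<Rightarrow> fm" where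
  "f_good R d r = FA (f_slots R 0 r) (FA (f_order R 0 r r) (FA (f_claims R d 0 r True)
     (FA (f_claims R d 0 r False) (f_derivable (f_assumed R r) d True 0 (Read 9 (Const 1))))))"

definition f_compatible :: "nat \<Rightarrow> nat \<Rightarrow> aexp \<Rightarrow> aexp \<Rightarrow> fm" where
  "f_compatible R d r q = FA (f_good R d r) (FA (f_good R d q)
     (FA (FAll (FI (FLess (qv 0) (Const (2 * R))) (FEq (cell r 0 (qv 0)) (cell q 0 (qv 0)))))
     (FA (f_order R 0 r q)
         (FE (FA (FLess (qv 0) (Const (4 * R))) (FN (FEq (cell r 0 (qv 0)) (cell q 0 (qv 0)))))))))"

lemma wf_aexp_mono: "wf_aexp l a \<Longrightarrow> l \<le> m \<Longrightarrow> wf_aexp m a"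
  by (induction a) (auto intro: less_le_trans)

lemma wf_aexp_0: "wf_aexp 0 a \<Longrightarrow> wf_aexp l a"
  using wf_aexp_mono by blast

lemma wf_qv [simp]: "m < l \<Longrightarrow> wf_aexp l (qv m)"
  by (auto simp: qv_def)

lemma wf_cell [simp]: "wf_aexp l (cell r c e) \<longleftrightarrow> wf_aexp l r \<and> wf_aexp l e"
  by (auto simp: cell_def)

lemma wf_child [simp]: "wf_aexp l (child e j) \<longleftrightarrow> wf_aexp l e \<and> wf_aexp l j"
  by (auto simp: child_def)

lemma wf_f_derivable:
  "(\<And>b l e. wf_aexp l e \<Longrightarrow> wf_fm l (A b l e)) \<Longrightarrow> wf_aexp l e \<Longrightarrow> wf_fm l (f_derivable A h b l e)"
  by (induction h arbitrary: b l e) (auto simp: wf_aexp_Suc)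

lemma wf_f_observed: "wf_aexp 0 r \<Longrightarrow> wf_aexp l e \<Longrightarrow> wf_fm l (f_observed R r b l e)"
  by (auto simp: f_observed_def wf_aexp_0 wf_aexp_Suc)

lemma wf_f_assumed: "wf_aexp 0 r \<Longrightarrow> wf_aexp l e \<Longrightarrow> wf_fm l (f_assumed R r b l e)"
  by (auto simp: f_assumed_def wf_aexp_0 wf_aexp_Suc)

lemma wf_f_compatible:
  assumes "wf_aexp 0 r" "wf_aexp 0 q"
  shows "wf_fm 0 (f_compatible R d r q)"
proof -
  have "wf_fm 0 (f_good R d r)" if "wf_aexp 0 r" for r
    using that unfolding f_good_def f_claims_def Let_def f_slots_def f_order_def FIff_def
    by (auto intro!: wf_f_derivable wf_f_observed wf_f_assumed simp: wf_aexp_0)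
  with assms show ?thesis
    by (simp add: f_compatible_def f_order_def FIff_def wf_aexp_0)
qed

section \<open>Evaluation of the formulas in a memory that holds a decoded circuit\<close>

definition gate_code :: "gate \<Rightarrow> nat" where
  "gate_code g = (case g of Input \<Rightarrow> 0 | Neg _ \<Rightarrow> 1 | Conj _ \<Rightarrow> 2 | Disj _ \<Rightarrow> 3)"

definition circuit_in_memory :: "circuit \<Rightarrow> memory \<Rightarrow> bool" where
  "circuit_in_memory C s \<longleftrightarrow>
     (\<forall>i<length C. s 4 (Suc i) = gate_code (C ! i) \<and> s 5 (Suc i) = length (preds (C ! i)) \<and>
        (\<forall>j<length (preds (C ! i)). s 3 (s 6 (Suc i) + j) = preds (C ! i) ! j)) \<and>
     s 4 0 = 0 \<and> (\<forall>i>length C. s 4 i = 0)"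

lemma all_less_bounded: "(R::nat) \<le> B \<Longrightarrow> (\<forall>i<B. i < R \<longrightarrow> Q i) \<longleftrightarrow> (\<forall>i<R. Q i)"
  by auto

lemma ex_less_bounded: "(R::nat) \<le> B \<Longrightarrow> (\<exists>i<B. i < R \<and> Q i) \<longleftrightarrow> (\<exists>i<R. Q i)"
  by (meson less_le_trans)

lemma set_qvar_other [simp]: "x < 20 \<Longrightarrow> set_cell (qvar l) i a s x = s x"
  by (simp add: qvar_def)

lemma aval_qv [simp]: "aval (qv m) (set_cell (qvar l) 0 a s) = (if m = l then a else aval (qv m) s)"
  by (auto simp: qv_def set_cell_apply qvar_def)

lemma aval_cell [simp]: "aval (cell r c e) s = s 7 (aval r s + (c + aval e s))"
  by (simp add: cell_def)

lemma aval_child [simp]: "aval (child e j) s = Suc (s 3 (s 6 (aval e s) + aval j s))"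
  by (simp add: child_def)

text \<open>By \<open>cap\<close>, quantifiers bounded by cell 0 of array 2 reach all columns of a
  row and all predecessors of a gate, so nothing is lost by the bound.\<close>

locale decoded_circuit =
  fixes C :: circuit and s0 :: memory and k R d :: nat
  assumes circ: "is_circuit C" and decoded: "circuit_in_memory C s0"
    and cap: "4 * R \<le> s0 2 0" "\<And>i. i < length C \<Longrightarrow> length (preds (C ! i)) \<le> s0 2 0"
    and const_cells: "s0 9 0 = k" "s0 9 1 = length C"
begin

definition ctx :: "memory \<Rightarrow> bool" where "ctx s \<longleftrightarrow> (\<forall>x<20. s x = s0 x)"

lemma ctxD:
  assumes "ctx s"
  shows "s 2 = s0 2" "s 3 = s0 3" "s 4 = s0 4" "s 5 = s0 5" "s 6 = s0 6" "s 7 = s0 7" "s 9 = s0 9"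
  using assms by (simp_all add: ctx_def)

lemma ctx_set [simp]: "ctx s \<Longrightarrow> ctx (set_cell (qvar l) i a s)"
  by (simp add: ctx_def)

lemma ctx_agree: "ctx s \<Longrightarrow> agree 0 s s0"
  by (simp add: ctx_def agree_def)

definition row_of :: "aexp \<Rightarrow> nat \<Rightarrow> nat" where
  "row_of r l = s0 7 (aval r s0 + l)"

lemma aval_row: "ctx s \<Longrightarrow> wf_aexp 0 r \<Longrightarrow> aval r s = aval r s0"
  using aval_agree ctx_agree by blast

lemma aval_set_qvar_0 [simp]: "wf_aexp 0 r \<Longrightarrow> aval r (set_cell (qvar l) 0 i s) = aval r s"
  by (rule aval_set_qvar) (rule wf_aexp_0)

lemma code_simps:
  assumes "v < length C"
  shows "s0 4 (Suc v) = gate_code (C ! v)" "s0 5 (Suc v) = length (preds (C ! v))"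
    "j < length (preds (C ! v)) \<Longrightarrow> s0 3 (s0 6 (Suc v) + j) = preds (C ! v) ! j"
  using assms decoded by (auto simp: circuit_in_memory_def)

lemma fval_observed:
  assumes "ctx s" "wf_aexp 0 r" "wf_aexp l e" "aval e s = Suc v" "v < length C"
  shows "fval l (f_observed R r b l e) s = observed C R (row_of r) b v"
proof -
  have R: "R \<le> s0 2 0" using cap by simp
  have inp: "gate_code (C ! v) = 0 \<longleftrightarrow> C ! v = Input" by (simp add: gate_code_def split: gate.split)
  show ?thesis
    using assms R
    by (cases b) (simp_all add: ctxD[OF assms(1)] aval_row[OF assms(1,2)] f_observed_def observed_def row_of_def aval_set_qvar wf_aexp_Suc
        code_simps inp ex_less_bounded)
qed

lemma fval_assumed:
  assumes "ctx s" "wf_aexp 0 r" "wf_aexp l e" "aval e s = Suc v" "v < length C"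
  shows "fval l (f_assumed R r b l e) s = assumed R (row_of r) b v"
  using assms cap by (simp add: ctxD[OF assms(1)] aval_row[OF assms(1,2)] f_assumed_def assumed_def row_of_def aval_set_qvar ex_less_bounded)

lemma fval_derivable:
  assumes A: "\<And>s l e b v. ctx s \<Longrightarrow> wf_aexp l e \<Longrightarrow> aval e s = Suc v \<Longrightarrow> v < length C \<Longrightarrow>
    fval l (A b l e) s = D b v"
  shows "ctx s \<Longrightarrow> wf_aexp l e \<Longrightarrow> aval e s = Suc v \<Longrightarrow> v < length C \<Longrightarrow>
    fval l (f_derivable A h b l e) s = derivable C D h b v"
proof (induction h arbitrary: s b l e v)
  case 0
  then show ?case using A by simp
next
  case (Suc h)
  let ?js = "preds (C ! v)"
  have lt: "j < length C" if "j \<in> set ?js" for j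
    using that circ Suc.prems(4) by (fastforce simp: is_circuit_def)
  have len: "length ?js \<le> s0 2 0" using cap(2) Suc.prems(4) by blast
  have kids: "fval (Suc l) (f_derivable A h b (Suc l) (child e (qv l))) (set_cell (qvar l) 0 i s)
      = derivable C D h b (?js ! i)" if "i < length ?js" for i
    using Suc.prems that lt[OF nth_mem[OF that]]
    by (intro Suc.IH) (auto simp: wf_aexp_Suc aval_set_qvar code_simps ctxD[OF Suc.prems(1)])
  have neg: "fval l (f_derivable A h (\<not> b) l (child e (Const 0))) s = derivable C D h (\<not> b) i" if "C ! v = Neg i" for i
    using Suc.prems that lt[of i] code_simps(3)[OF Suc.prems(4), of 0]
    by (intro Suc.IH) (auto simp: ctxD[OF Suc.prems(1)])
  have ex: "(\<exists>i<s0 2 0. i < length ?js \<and> fval (Suc l) (f_derivable A h b (Suc l) (child e (qv l))) (set_cell (qvar l) 0 i s))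
      \<longleftrightarrow> (\<exists>j\<in>set ?js. derivable C D h b j)"
    unfolding ex_less_bounded[OF len] by (metis kids in_set_conv_nth)
  have all: "(\<forall>i<s0 2 0. i < length ?js \<longrightarrow> fval (Suc l) (f_derivable A h b (Suc l) (child e (qv l))) (set_cell (qvar l) 0 i s))
      \<longleftrightarrow> (\<forall>j\<in>set ?js. derivable C D h b j)"
    unfolding all_less_bounded[OF len] by (metis kids in_set_conv_nth)
  have "fval l (f_derivable A (Suc h) b l e) s \<longleftrightarrow> D b v \<or>
      (gate_code (C ! v) = 1 \<and> fval l (f_derivable A h (\<not> b) l (child e (Const 0))) s) \<or>
      (gate_code (C ! v) = (if b then 2 else 3) \<and> (\<forall>j\<in>set ?js. derivable C D h b j)) \<or>
      (gate_code (C ! v) = (if b then 3 else 2) \<and> (\<exists>j\<in>set ?js. derivable C D h b j))"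
    using Suc.prems A[OF Suc.prems] unfolding ex[symmetric] all[symmetric]
    by (simp add: aval_set_qvar code_simps ctxD[OF Suc.prems(1)])
  then show ?case using neg by (cases "C ! v") (auto simp: gate_code_def)
qed

lemma fval_slots: "ctx s \<Longrightarrow> wf_aexp 0 r \<Longrightarrow> fval l (f_slots R l r) s = slots_ok C k R (row_of r)"
proof -
  have ty: "s0 4 t = 0 \<longleftrightarrow> t = 0 \<or> length C < t \<or> C ! (t - 1) = Input" for t
  proof (cases "t = 0 \<or> length C < t")
    case True
    then show ?thesis using decoded by (auto simp: circuit_in_memory_def)
  next
    case False
    then have "t - 1 < length C" "Suc (t - 1) = t" by auto
    then show ?thesis using code_simps(1)[of "t - 1"] False by (cases "C ! (t - 1)") (auto simp: gate_code_def)
  qed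
  have R: "R \<le> s0 2 0" using cap by simp
  assume a: "ctx s" "wf_aexp 0 r"
  then show ?thesis
    by (simp add: ctxD[OF a(1)] aval_row[OF a] f_slots_def slots_ok_def row_of_def ty const_cells all_less_bounded[OF R] const_cells[unfolded One_nat_def])
qed

lemma fval_order:
  assumes "ctx s" "wf_aexp 0 r" "wf_aexp 0 q"
  shows "fval l (f_order R l r q) s = same_order R (row_of r) (row_of q)"
proof -
  have R: "R \<le> s0 2 0" using cap by simp
  have iff: "fval l (FIff \<phi> \<psi>) s \<longleftrightarrow> (fval l \<phi> s \<longleftrightarrow> fval l \<psi> s)" for l \<phi> \<psi> s by (auto simp: FIff_def)
  show ?thesis using assms
    by (simp add: ctxD[OF assms(1)] aval_row[OF assms(1,2)] aval_row[OF assms(1,3)] f_order_def same_order_def row_of_def iff all_less_bounded[OF R])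
qed

lemma fval_claims:
  assumes "ctx s" "wf_aexp 0 r"
  shows "fval l (f_claims R d l r b) s = claims_ok C R d (row_of r) b"
proof -
  have R: "R \<le> s0 2 0" using cap by simp
  define g where "g = cell r (if b then 0 else R) (qv l)"
  have "fval (Suc l) (FO (FEq g (Const 0))
       (FA (FLess g (Add (Read 9 (Const 1)) (Const 1)))
       (FA (FO (FEq (Read 4 g) (Const 0))
               (FA (FEq (Read 4 g) (Const (if b then 2 else 3))) (FLess (Const 2) (Read 5 g))))
           (FN (f_derivable (f_observed R r) d (\<not> b) (Suc l) g))))) (set_cell (qvar l) 0 i s) \<longleftrightarrow>
     row_of r ((if b then 0 else R) + i) = 0 \<or> row_of r ((if b then 0 else R) + i) < length C + 1 \<and>
     refutable (C ! (row_of r ((if b then 0 else R) + i) - 1)) b \<and>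
     \<not> derivable C (observed C R (row_of r)) d (\<not> b) (row_of r ((if b then 0 else R) + i) - 1)" for i
  proof -
    let ?s = "set_cell (qvar l) 0 i s"
    have ctx: "ctx ?s" using assms by simp
    have g: "aval g ?s = row_of r ((if b then 0 else R) + i)"
      using assms by (simp add: g_def row_of_def ctxD[OF assms(1)] aval_row[OF assms(1,2)])
    have wf: "wf_aexp (Suc l) g" using assms by (simp add: g_def wf_aexp_0)
    show ?thesis
    proof (cases "0 < aval g ?s \<and> aval g ?s < length C + 1")
      case True
      then obtain v where v: "aval g ?s = Suc v" "v < length C" by (cases "aval g ?s") auto
      have "fval (Suc l) (f_derivable (f_observed R r) d (\<not> b) (Suc l) g) ?s
          = derivable C (observed C R (row_of r)) d (\<not> b) v"
        by (rule fval_derivable[OF fval_observed]) (use assms ctx wf v in auto)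
      moreover have "(gate_code (C ! v) = 0 \<or> gate_code (C ! v) = (if b then 2 else 3) \<and> 2 < length (preds (C ! v)))
          \<longleftrightarrow> refutable (C ! v) b"
        by (cases "C ! v") (auto simp: gate_code_def refutable_def large_gate_def)
      ultimately show ?thesis
        using v by (simp add: g[symmetric] code_simps ctxD[OF assms(1)] const_cells const_cells[unfolded One_nat_def])
    next
      case False
      then show ?thesis by (auto simp: g[symmetric] ctxD[OF assms(1)] const_cells const_cells[unfolded One_nat_def])
    qed
  qed
  then show ?thesis
    using assms unfolding f_claims_def Let_def g_def[symmetric] claims_ok_def
    by (simp add: all_less_bounded[OF R] ctxD[OF assms(1)])
qed

lemma fval_good:
  assumes "ctx s" "wf_aexp 0 r"
  shows "fval 0 (f_good R d r) s = good_row C k R d (row_of r)"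
proof -
  have "length C > 0" using circ by (simp add: is_circuit_def)
  then have "fval 0 (f_derivable (f_assumed R r) d True 0 (Read 9 (Const 1))) s
      = derivable C (assumed R (row_of r)) d True (length C - 1)"
    by (intro fval_derivable[OF fval_assumed]) (use assms const_cells in \<open>auto simp: ctxD[OF assms(1)]\<close>)
  then show ?thesis
    using assms by (simp add: f_good_def good_row_def fval_slots fval_order fval_claims)
qed

lemma fval_compatible:
  assumes "ctx s" "wf_aexp 0 r" "wf_aexp 0 q"
  shows "fval 0 (f_compatible R d r q) s = compatible C k R d (row_of r) (row_of q)"
proof -
  have R: "2 * R \<le> s0 2 0" "4 * R \<le> s0 2 0" using cap by simp_all
  show ?thesis
    using assms by (simp add: ctxD[OF assms(1)] aval_row[OF assms(1,2)] aval_row[OF assms(1,3)]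
      f_compatible_def compatible_def fval_good fval_order row_of_def
      all_less_bounded[OF R(1)] ex_less_bounded[OF R(2)])
qed

end

section \<open>Preparing the input\<close>

text \<open>
  Memory layout: 2 loop bounds (the size bound \<open>B\<close> in cell 0, the number \<open>P\<close> of rows in cell 1), 3 copy of
  the input, 4--6 gate type, number of predecessors and position of their list in the copy (node \<open>i\<close> at
  index \<open>Suc i\<close>), 7 table of rows, 8 start of each row, 9 the constants \<open>k\<close>, \<open>length C\<close> and \<open>\<kappa>\<close>, 10--12 loop
  variables, 13 output pointers (next edge cell, next side bit, next vertex), 14--19 scratch, from 20 on
  quantified variables and truth values.
\<close>

primrec pseq :: "prog list \<Rightarrow> prog" where
  "pseq [] = PSkip"
| "pseq (p # ps) = PSeq p (pseq ps)"

abbreviation cst :: "nat \<Rightarrow> aexp" where "cst \<equiv> Const"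
abbreviation var :: "nat \<Rightarrow> nat \<Rightarrow> aexp" where "var x i \<equiv> Read x (Const i)"

text \<open>The machine cannot multiply, and loops run up to a stored bound. So the accumulator in
  array 17 is increased only while the counter is below the factor \<open>e\<close>, which must not
  exceed that bound.\<close>

definition times_prog :: "nat \<Rightarrow> aexp \<Rightarrow> nat \<Rightarrow> prog" where
  "times_prog c e x = pseq
     [PStore 17 (cst 0) (cst 0),
      PFor 10 c (PIf (Less (var 10 0) e) (PStore 17 (cst 0) (Add (var 17 0) (var x 0))) PSkip),
      PStore x (cst 0) (var 17 0)]"

primrec power_prog :: "nat \<Rightarrow> aexp \<Rightarrow> nat \<Rightarrow> nat \<Rightarrow> prog" where
  "power_prog c e x 0 = PSkip"
| "power_prog c e x (Suc n) = PSeq (power_prog c e x n) (times_prog c e x)"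

lemma wf_power_prog: "x \<noteq> 2 \<Longrightarrow> wf_prog (power_prog c e x n)"
  by (induction n) (simp_all add: times_prog_def)

lemma writes_power_prog: "writes (power_prog c e x n) \<subseteq> {10, 17, x}"
  by (induction n) (auto simp: times_prog_def)

lemma sem_times_prog:
  assumes x: "x \<notin> {2, 9, 10, 17}" and e: "\<And>u. u 2 = s 2 \<Longrightarrow> u 9 = s 9 \<Longrightarrow> aval e u = b" and b: "b \<le> s 2 c"
  shows "sem (times_prog c e x) s x 0 = b * s x 0"
proof -
  let ?p = "PIf (Less (var 10 0) e) (PStore 17 (cst 0) (Add (var 17 0) (var x 0))) PSkip"
  let ?s = "set_cell 17 0 0 s"
  let ?I = "\<lambda>i u. u 17 0 = min i b * s x 0 \<and> u x = s x \<and> u 2 = s 2 \<and> u 9 = s 9"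
  have "?I (?s 2 c) (sem (PFor 10 c ?p) ?s)"
  proof (rule sem_For_induct[where I = ?I])
    show "?I 0 (set_cell 10 0 0 ?s)" using x by simp
  next
    fix i and u :: memory assume u: "i < ?s 2 c" "?I i u" "u 10 0 = i"
    then have "aval e u = b" using e by blast
    then show "?I (Suc i) (set_cell 10 0 (Suc i) (sem ?p u))"
      using u x by (auto simp: min_def)
  qed simp
  then show ?thesis using b by (simp add: times_prog_def min_absorb2)
qed

lemma sem_power_prog:
  assumes x: "x \<notin> {2, 9, 10, 17}" and e: "\<And>u. u 2 = s 2 \<Longrightarrow> u 9 = s 9 \<Longrightarrow> aval e u = b" and b: "b \<le> s 2 c"
  shows "sem (power_prog c e x n) s x 0 = b ^ n * s x 0"
proof (induction n)
  case (Suc n)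
  let ?s = "sem (power_prog c e x n) s"
  have fr: "?s 2 = s 2" "?s 9 = s 9"
    using writes_power_prog[of c e x n] x by (auto intro!: sem_frame)
  show ?case using sem_times_prog[of x ?s e b c] x e b fr Suc by simp
qed simp

text \<open>Cell 0 of array 16 is the read position and cell 1 of array 9 the number of nodes read;
  the latter is raised first, so node \<open>i\<close> is recorded at index
  \<open>Suc i\<close>.\<close>

definition parse_body :: prog where
  "parse_body = pseq
     [PStore 9 (cst 1) (Add (var 9 1) (cst 1)),
      PStore 4 (var 9 1) (Read 3 (var 16 0)),
      PIf (Less (Read 3 (var 16 0)) (cst 1))
        (PStore 16 (cst 0) (Add (var 16 0) (cst 1)))
        (PIf (Less (Read 3 (var 16 0)) (cst 2))
          (pseq [PStore 5 (var 9 1) (cst 1),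
                 PStore 6 (var 9 1) (Add (var 16 0) (cst 1)),
                 PStore 16 (cst 0) (Add (var 16 0) (cst 2))])
          (pseq [PStore 5 (var 9 1) (Read 3 (Add (var 16 0) (cst 1))),
                 PStore 6 (var 9 1) (Add (var 16 0) (cst 2)),
                 PStore 16 (cst 0) (Add (var 16 0) (Add (cst 2) (Read 3 (Add (var 16 0) (cst 1)))))]))]"

definition parse_prog :: prog where
  "parse_prog = pseq
     [PFor 10 0 (PStore 3 (var 10 0) (Read 0 (var 10 0))),
      PStore 9 (cst 0) (var 1 0),
      PStore 16 (cst 0) (cst 1),
      PFor 10 0 (PIf (Less (var 16 0) (Add (var 3 0) (cst 1))) parse_body PSkip)]"

text \<open>Arrays 4 and 5 must still be 0 beyond \<open>m\<close>: an input gate does not write its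
  number of predecessors, and indices outside the circuit have to look like inputs in the
  end.\<close>

definition parsed :: "circuit \<Rightarrow> nat \<Rightarrow> memory \<Rightarrow> bool" where
  "parsed C m s \<longleftrightarrow> s 9 1 = m \<and> s 16 0 = Suc (length (encode_circuit (take m C))) \<and>
     s 3 0 = length (encode_circuit C) \<and>
     (\<forall>i<length (encode_circuit C). s 3 (Suc i) = encode_circuit C ! i) \<and>
     (\<forall>i<m. s 4 (Suc i) = gate_code (C ! i) \<and> s 5 (Suc i) = length (preds (C ! i)) \<and>
        (\<forall>j<length (preds (C ! i)). s 3 (s 6 (Suc i) + j) = preds (C ! i) ! j)) \<and>
     s 4 0 = 0 \<and> (\<forall>i>m. s 4 i = 0 \<and> s 5 i = 0)"

lemma encode_circuit_split:
  assumes "m < length C"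
  shows "encode_circuit C = encode_circuit (take m C) @ encode_gate (C ! m) @ encode_circuit (drop (Suc m) C)"
    "encode_circuit (take (Suc m) C) = encode_circuit (take m C) @ encode_gate (C ! m)"
proof -
  show "encode_circuit C = encode_circuit (take m C) @ encode_gate (C ! m) @ encode_circuit (drop (Suc m) C)"
    using arg_cong[OF id_take_nth_drop[OF assms], of encode_circuit] by (simp add: encode_circuit_def)
  show "encode_circuit (take (Suc m) C) = encode_circuit (take m C) @ encode_gate (C ! m)"
    using assms by (simp add: encode_circuit_def take_Suc_conv_app_nth)
qed

lemma length_encode_gate: "Suc 0 \<le> length (encode_gate g)"
  by (cases g) auto

lemma parse_step:
  assumes p: "parsed C m s" and m: "m < length C"
  shows "parsed C (Suc m) (sem parse_body s)"
proof -
  let ?w = "encode_circuit C" and ?q = "s 16 0"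
  note split = encode_circuit_split[OF m]
  have q: "?q = Suc (length (encode_circuit (take m C)))" using p by (simp add: parsed_def)
  have rd: "s 3 (?q + j) = encode_gate (C ! m) ! j" if "j < length (encode_gate (C ! m))" for j
  proof -
    let ?i = "length (encode_circuit (take m C)) + j"
    have "?i < length ?w" using that split(1) by simp
    then have "s 3 (Suc ?i) = ?w ! ?i" using p by (simp add: parsed_def)
    also have "\<dots> = encode_gate (C ! m) ! j" using that by (subst split(1)) (simp add: nth_append)
    finally show ?thesis using q by simp
  qed
  have old: "s 9 1 = m" "s 9 (Suc 0) = m" "s 3 0 = length ?w" "\<And>i. i < length ?w \<Longrightarrow> s 3 (Suc i) = ?w ! i"
    "\<And>i. i < m \<Longrightarrow> s 4 (Suc i) = gate_code (C ! i) \<and> s 5 (Suc i) = length (preds (C ! i)) \<and>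
        (\<forall>j<length (preds (C ! i)). s 3 (s 6 (Suc i) + j) = preds (C ! i) ! j)"
    "s 4 0 = 0" "\<And>i. i > m \<Longrightarrow> s 4 i = 0 \<and> s 5 i = 0"
    using p by (auto simp: parsed_def)
  have rd0: "s 3 ?q = gate_code (C ! m)" using rd[of 0] by (cases "C ! m") (auto simp: gate_code_def)
  show ?thesis
  proof (cases "C ! m")
    case Input
    then show ?thesis using old rd0 q split(2)
      by (simp add: parsed_def parse_body_def less_Suc_eq gate_code_def)
  next
    case (Neg i)
    then show ?thesis using old rd0 rd[of 1] q split(2)
      by (auto simp: parsed_def parse_body_def less_Suc_eq gate_code_def)
  next
    case (Conj js)
    then have "s 3 (Suc (Suc (length (encode_circuit (take m C))))) = length js"
      "\<And>j. j < length js \<Longrightarrow> s 3 (Suc (Suc (Suc (length (encode_circuit (take m C)) + j)))) = js ! j"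
      using rd[of 1] rd[of "Suc (Suc j)" for j] q by simp_all
    then show ?thesis using Conj old rd0 q split(2)
      by (auto simp: parsed_def parse_body_def less_Suc_eq gate_code_def)
  next
    case (Disj js)
    then have "s 3 (Suc (Suc (length (encode_circuit (take m C))))) = length js"
      "\<And>j. j < length js \<Longrightarrow> s 3 (Suc (Suc (Suc (length (encode_circuit (take m C)) + j)))) = js ! j"
      using rd[of 1] rd[of "Suc (Suc j)" for j] q by simp_all
    then show ?thesis using Disj old rd0 q split(2)
      by (auto simp: parsed_def parse_body_def less_Suc_eq gate_code_def)
  qed
qed

lemma length_le_encode_circuit: "length C \<le> length (encode_circuit C)"
proof (induction C)
  case (Cons g C)
  then show ?case using add_mono[OF length_encode_gate[of g] Cons] by (simp add: encode_circuit_def)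
qed simp

lemma wf_parse_prog: "wf_prog parse_prog"
  by (simp add: parse_prog_def parse_body_def)

lemma sem_parse_prog:
  assumes in0: "s 0 0 = length (encode_circuit C)" "\<And>i. i < length (encode_circuit C) \<Longrightarrow> s 0 (Suc i) = encode_circuit C ! i"
    and cap: "length (encode_circuit C) < s 2 0"
    and zero: "\<And>i. s 4 i = 0" "\<And>i. s 5 i = 0" "\<And>i. s 9 i = 0"
  shows "circuit_in_memory C (sem parse_prog s)" "sem parse_prog s 9 0 = s 1 0" "sem parse_prog s 9 1 = length C"
proof -
  let ?w = "encode_circuit C"
  let ?c = "PStore 3 (var 10 0) (Read 0 (var 10 0))"
  let ?b = "PIf (Less (var 16 0) (Add (var 3 0) (cst 1))) parse_body PSkip"
  define s1 where "s1 = sem (PFor 10 0 ?c) s"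
  let ?I1 = "\<lambda>i u. (\<forall>j<i. u 3 j = s 0 j) \<and> u 0 = s 0"
  have "?I1 (s 2 0) s1"
    unfolding s1_def
  proof (rule sem_For_induct[where I = ?I1])
    fix i and u :: memory assume "i < s 2 0" "?I1 i u" "u 10 0 = i"
    then show "?I1 (Suc i) (set_cell 10 0 (Suc i) (sem ?c u))" by (auto simp: less_Suc_eq)
  qed simp_all
  then have s1: "\<And>j. j < s 2 0 \<Longrightarrow> s1 3 j = s 0 j" by blast
  have fr1: "s1 x = s x" if "x \<noteq> 3" "x \<noteq> 10" for x
    unfolding s1_def using that by (intro sem_frame) simp
  define s2 where "s2 = set_cell 16 0 1 (set_cell 9 0 (s 1 0) s1)"
  have s2: "parsed C 0 s2" "s2 9 0 = s 1 0" "s2 2 = s 2"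
    using s1 cap in0 zero by (simp_all add: parsed_def s2_def fr1 encode_circuit_def)
  \<comment> \<open>The loop bound exceeds the number of gates. Once the read position has passed
    the word, the remaining rounds do nothing, which is why the invariant has a
    \<open>min\<close>.\<close>
  let ?I2 = "\<lambda>i u. parsed C (min i (length C)) u \<and> u 9 0 = s 1 0"
  have "?I2 (s2 2 0) (sem (PFor 10 0 ?b) s2)"
  proof (rule sem_For_induct[where I = ?I2])
    show "wf_prog (PFor 10 0 ?b)" by (simp add: parse_body_def)
    show "?I2 0 (set_cell 10 0 0 s2)" using s2 by (simp add: parsed_def)
  next
    fix i and u :: memory assume u: "i < s2 2 0" "?I2 i u" "u 10 0 = i"
    have loopvar: "parsed C m (set_cell 10 0 a v) \<longleftrightarrow> parsed C m v" for m a v by (simp add: parsed_def)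
    show "?I2 (Suc i) (set_cell 10 0 (Suc i) (sem ?b u))"
    proof (cases "i < length C")
      case True
      then have p: "parsed C i u" using u by simp
      have "u 16 0 < Suc (u 3 0)"
        using p arg_cong[OF encode_circuit_split(1)[OF True], of length] length_encode_gate[of "C ! i"]
        unfolding parsed_def length_append by linarith
      moreover have "sem parse_body u 9 0 = u 9 0"
        using p by (auto simp: parse_body_def parsed_def set_cell_apply)
      ultimately show ?thesis using parse_step[OF p True] u True by (simp add: loopvar)
    next
      case False
      then have p: "parsed C (length C) u" using u by simp
      then have "\<not> u 16 0 < Suc (u 3 0)" by (simp add: parsed_def)
      then show ?thesis using p False u by (simp add: loopvar)
    qed
  qed
  moreover have "min (s2 2 0) (length C) = length C" using s2(3) cap length_le_encode_circuit[of C] by simp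
  moreover have "sem parse_prog s = sem (PFor 10 0 ?b) s2"
    using fr1[of 1] by (simp add: parse_prog_def s1_def s2_def)
  ultimately have p: "parsed C (length C) (sem parse_prog s)" "sem parse_prog s 9 0 = s 1 0" by simp_all
  then show "circuit_in_memory C (sem parse_prog s)" "sem parse_prog s 9 0 = s 1 0" "sem parse_prog s 9 1 = length C"
    by (auto simp: parsed_def circuit_in_memory_def)
qed

text \<open>Row \<open>v\<close> consists of the digits of \<open>v\<close> in base
  \<open>B\<close>, lowest first. Since the machine cannot divide, quotients and remainders by
  \<open>B\<close> are tabulated in arrays 14 and 15 by counting, and the digits are found by
  following the quotients.\<close>

definition table_prog :: prog where
  "table_prog = PFor 10 1 (pseq
     [PStore 14 (var 10 0) (var 16 1),
      PStore 15 (var 10 0) (var 16 2),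
      PIf (Less (Add (var 16 2) (cst 1)) (var 2 0))
        (PStore 16 (cst 2) (Add (var 16 2) (cst 1)))
        (PSeq (PStore 16 (cst 2) (cst 0)) (PStore 16 (cst 1) (Add (var 16 1) (cst 1)))),
      PStore 8 (var 10 0) (var 16 3),
      PStore 16 (cst 4) (var 10 0),
      PFor 11 0 (pseq
        [PStore 7 (var 16 3) (Read 15 (var 16 4)),
         PStore 16 (cst 4) (Read 14 (var 16 4)),
         PStore 16 (cst 3) (Add (var 16 3) (cst 1))])])"

definition table_ok :: "nat \<Rightarrow> nat \<Rightarrow> memory \<Rightarrow> bool" where
  "table_ok B n s \<longleftrightarrow> s 16 1 = n div B \<and> s 16 2 = n mod B \<and> s 16 3 = n * B \<and>
     (\<forall>v<n. s 14 v = v div B \<and> s 15 v = v mod B \<and> s 8 v = v * B \<and>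
        (\<forall>l<B. s 7 (v * B + l) = v div B ^ l mod B))"

lemma wf_table_prog: "wf_prog table_prog"
  by (simp add: table_prog_def)

lemma writes_table_prog: "writes table_prog = {7, 8, 10, 11, 14, 15, 16}"
  by (auto simp: table_prog_def)

lemma sem_table_prog:
  assumes B: "s 2 0 = B" "0 < B" and zero: "s 16 1 = 0" "s 16 2 = 0" "s 16 3 = 0"
    and v: "v < s 2 1" and l: "l < B"
  shows "sem table_prog s 7 (sem table_prog s 8 v + l) = v div B ^ l mod B"
proof -
  let ?in = "pseq [PStore 7 (var 16 3) (Read 15 (var 16 4)),
         PStore 16 (cst 4) (Read 14 (var 16 4)),
         PStore 16 (cst 3) (Add (var 16 3) (cst 1))]"
  let ?pre = "pseq [PStore 14 (var 10 0) (var 16 1),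
      PStore 15 (var 10 0) (var 16 2),
      PIf (Less (Add (var 16 2) (cst 1)) (var 2 0))
        (PStore 16 (cst 2) (Add (var 16 2) (cst 1)))
        (PSeq (PStore 16 (cst 2) (cst 0)) (PStore 16 (cst 1) (Add (var 16 1) (cst 1)))),
      PStore 8 (var 10 0) (var 16 3),
      PStore 16 (cst 4) (var 10 0)]"
  let ?body = "PSeq ?pre (PFor 11 0 ?in)"
  have prog: "sem table_prog s = sem (PFor 10 1 ?body) s" by (simp add: table_prog_def)
  have "table_ok B (s 2 1) (sem (PFor 10 1 ?body) s)"
  proof (rule sem_For_induct[where I = "\<lambda>n u. table_ok B n u"])
    show "table_ok B 0 (set_cell 10 0 0 s)" using zero by (simp add: table_ok_def zero[unfolded One_nat_def])
  next
    fix n and u :: memory assume u: "n < s 2 1" "table_ok B n u" "u 10 0 = n" "u 2 = s 2"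
    define u1 where "u1 = sem ?pre u"
    have divmod: "Suc n div B = (if Suc (n mod B) < B then n div B else Suc (n div B))"
      "Suc n mod B = (if Suc (n mod B) < B then Suc (n mod B) else 0)"
      using mod_less_divisor[OF B(2), of n] by (auto simp: div_Suc mod_Suc)
    have u1: "u1 16 1 = Suc n div B" "u1 16 2 = Suc n mod B" "u1 16 3 = n * B" "u1 16 4 = n" "u1 2 = s 2"
      "\<And>v. v < Suc n \<Longrightarrow> u1 14 v = v div B \<and> u1 15 v = v mod B \<and> u1 8 v = v * B"
      "u1 7 = u 7"
      using u B(1) unfolding u1_def divmod table_ok_def by (auto simp: less_Suc_eq)
    let ?J = "\<lambda>i w. w 16 1 = Suc n div B \<and> w 16 2 = Suc n mod B \<and> w 16 3 = n * B + i \<and> w 16 4 = n div B ^ i \<and>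
      w 14 = u1 14 \<and> w 15 = u1 15 \<and> w 8 = u1 8 \<and>
      (\<forall>v<n. \<forall>l<B. w 7 (v * B + l) = v div B ^ l mod B) \<and> (\<forall>l<i. w 7 (n * B + l) = n div B ^ l mod B)"
    have "?J (u1 2 0) (sem (PFor 11 0 ?in) u1)"
    proof (rule sem_For_induct[where I = ?J])
      show "?J 0 (set_cell 11 0 0 u1)" using u1 u(2) by (simp add: table_ok_def u1(1)[unfolded One_nat_def])
    next
      fix i and w :: memory assume w: "i < u1 2 0" "?J i w" "w 11 0 = i"
      \<comment> \<open>The iterated quotients never exceed \<open>n\<close>, so their table entries
        have already been written.\<close>
      have c: "n div B ^ i < Suc n" by (simp add: le_imp_less_Suc)
      have cur: "w 15 (n div B ^ i) = n div B ^ i mod B" "w 14 (n div B ^ i) = n div B ^ Suc i"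
        using w(2) u1(6)[OF c] by (simp_all add: power_Suc2 div_mult2_eq del: power_Suc)
      have off: "v * B + l \<noteq> n * B + i" if "v < n" "l < B" for v l
      proof -
        have "v * B + l < Suc v * B" using that by simp
        also have "\<dots> \<le> n * B" using that by (intro mult_right_mono) auto
        finally show ?thesis by simp
      qed
      show "?J (Suc i) (set_cell 11 0 (Suc i) (sem ?in w))"
        using w(2) cur off by (auto simp: less_Suc_eq)
    qed simp
    then have J: "?J B (sem (PFor 11 0 ?in) u1)" using u1(5) B(1) by simp
    have "table_ok B (Suc n) (sem (PFor 11 0 ?in) u1)"
      unfolding table_ok_def using J u1(6) by (auto simp: less_Suc_eq)
    then show "table_ok B (Suc n) (set_cell 10 0 (Suc n) (sem ?body u))"
      by (simp add: table_ok_def u1_def)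
  qed simp
  then have ok: "table_ok B (s 2 1) (sem table_prog s)" unfolding prog .
  then show ?thesis using v l by (simp add: table_ok_def)
qed

text \<open>With \<open>n = 4 * R\<close> this provides the surjectivity of \<open>row\<close> that
  the clique construction requires, and explains the number of rows.\<close>

lemma digits_surjective:
  fixes f :: "nat \<Rightarrow> nat"
  assumes "\<And>l. l < n \<Longrightarrow> f l < B" "0 < B"
  shows "\<exists>u < B ^ n. \<forall>l<n. u div B ^ l mod B = f l"
  using assms(1)
proof (induction n arbitrary: f)
  case (Suc n)
  obtain u where u: "u < B ^ n" "\<And>l. l < n \<Longrightarrow> u div B ^ l mod B = f (Suc l)"
    using Suc.IH[of "\<lambda>l. f (Suc l)"] Suc.prems by auto
  have f0: "f 0 < B" using Suc.prems by simp
  let ?u = "f 0 + B * u"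
  have "?u div B ^ l mod B = f l" if "l < Suc n" for l
  proof (cases l)
    case 0
    then show ?thesis using f0 by simp
  next
    case (Suc m)
    then have "?u div B ^ l = u div B ^ m" using f0 assms(2) by (simp add: div_mult2_eq)
    then show ?thesis using u(2)[of m] Suc that by simp
  qed
  moreover have "?u < B ^ Suc n"
  proof -
    have "f 0 + B * u < B * Suc u" using f0 by simp
    also have "\<dots> \<le> B * B ^ n" using u(1) by (intro mult_left_mono) auto
    finally show ?thesis by simp
  qed
  ultimately show ?case by blast
qed simp

section \<open>Writing the instance\<close>

text \<open>Edge cells grow from position 3 and side bits from \<open>bb\<close>, where
  \<open>bits\<close> are those of the base vertices. The header in cells 0 to 2 is left open, since
  it is written last.\<close>

definition emitted :: "nat \<Rightarrow> nat list \<Rightarrow> nat \<Rightarrow> gadget list \<Rightarrow> (nat \<Rightarrow> nat) \<Rightarrow> (nat \<Rightarrow> nat) \<Rightarrow> bool" where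
  "emitted bb bits n T out ptr \<longleftrightarrow>
     ptr 0 = 3 + 10 * length T \<and> ptr 1 = bb + n + length T \<and> ptr 2 = n + length T \<and>
     map out [3..<3 + 10 * length T] = concat (map (\<lambda>t. gadget_cells n t (T ! t)) [0..<length T]) \<and>
     map out [bb..<bb + n + length T] = bits @ map (\<lambda>g. of_bool (fst g)) T"

definition emit :: "bool \<times> aexp \<times> aexp \<Rightarrow> prog" where
  "emit g = pseq
     [PStore 0 (var 13 0) (fst (snd g)),
      PStore 0 (Add (var 13 0) (cst 1)) (var 13 2),
      PStore 0 (Add (var 13 0) (cst 2)) (cst 0),
      PStore 0 (Add (var 13 0) (cst 3)) (cst 1),
      PStore 0 (Add (var 13 0) (cst 4)) (cst 1),
      PStore 0 (Add (var 13 0) (cst 5)) (snd (snd g)),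
      PStore 0 (Add (var 13 0) (cst 6)) (var 13 2),
      PStore 0 (Add (var 13 0) (cst 7)) (cst 0),
      PStore 0 (Add (var 13 0) (cst 8)) (cst 1),
      PStore 0 (Add (var 13 0) (cst 9)) (cst 1),
      PStore 0 (var 13 1) (cst (of_bool (fst g))),
      PStore 13 (cst 0) (Add (var 13 0) (cst 10)),
      PStore 13 (cst 1) (Add (var 13 1) (cst 1)),
      PStore 13 (cst 2) (Add (var 13 2) (cst 1))]"

text \<open>Operands of gadgets are evaluated while earlier gadgets change the output and its
  pointers; stability makes their values independent of that.\<close>

definition stable :: "aexp \<Rightarrow> bool" where
  "stable e \<longleftrightarrow> (\<forall>s u. (\<forall>x. x \<noteq> 0 \<and> x \<noteq> 13 \<longrightarrow> s x = u x) \<longrightarrow> aval e s = aval e u)"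

lemma stable_Const [simp]: "stable (Const n)"
  by (simp add: stable_def)

lemma stable_Add [simp]: "stable a \<Longrightarrow> stable b \<Longrightarrow> stable (Add a b)"
  unfolding stable_def aval.simps by metis

lemma stable_var: "x \<noteq> 0 \<Longrightarrow> x \<noteq> 13 \<Longrightarrow> stable (var x i)"
  by (simp add: stable_def)

lemma stable_set: "stable e \<Longrightarrow> aval e (set_cell 0 i a s) = aval e s"
  unfolding stable_def by (metis set_cell_other)

lemma upt_add_10: "[i..<i + 10] = [i, i + 1, i + 2, i + 3, i + 4, i + 5, i + 6, i + 7, i + 8, i + 9]"
  by (simp add: upt_rec)

lemma wf_emit: "wf_prog (emit g)" and writes_emit: "writes (emit g) = {0, 13}"
  by (auto simp: emit_def)

text \<open>The assumption \<open>room\<close> keeps the growing list of edge cells below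
  \<open>bb\<close>, so that it never overwrites side bits.\<close>

lemma sem_emit:
  assumes e: "emitted bb bits n T (s 0) (s 13)" and room: "3 + 10 * Suc (length T) \<le> bb"
    and st: "stable (fst (snd g))" "stable (snd (snd g))"
  shows "emitted bb bits n (T @ [(fst g, aval (fst (snd g)) s, aval (snd (snd g)) s)])
    (sem (emit g) s 0) (sem (emit g) s 13)"
proof -
  let ?p = "3 + 10 * length T" and ?u = "sem (emit g) s"
  let ?g = "(fst g, aval (fst (snd g)) s, aval (snd (snd g)) s)"
  have ptr: "s 13 0 = ?p" "s 13 1 = bb + n + length T" "s 13 (Suc 0) = bb + n + length T" "s 13 2 = n + length T"
    using e by (simp_all add: emitted_def)
  have out: "?u 0 = (s 0)(?p := aval (fst (snd g)) s, ?p + 1 := n + length T, ?p + 2 := 0, ?p + 3 := 1, ?p + 4 := 1,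
      ?p + 5 := aval (snd (snd g)) s, ?p + 6 := n + length T, ?p + 7 := 0, ?p + 8 := 1, ?p + 9 := 1,
      bb + n + length T := of_bool (fst g))"
  proof -
    obtain c :: nat where c: "of_bool (fst g) = c" by simp
    show ?thesis unfolding emit_def c by (simp add: ptr stable_set[OF st(2)] add.commute) (simp only: fun_upd_def)
  qed
  have ptr': "?u 13 0 = ?p + 10" "?u 13 1 = bb + n + length T + 1" "?u 13 2 = n + length T + 1"
    by (simp_all add: emit_def ptr)
  have old: "map (?u 0) [3..<?p] = map (s 0) [3..<?p]"
    using room by (intro map_cong) (auto simp: out)
  have new: "map (?u 0) [?p..<?p + 10] = gadget_cells n (length T) ?g"
    using room unfolding upt_add_10 by (simp add: out gadget_cells_def)
  have "[3..<3 + 10 * length (T @ [?g])] = [3..<?p] @ [?p..<?p + 10]"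
    using upt_add_eq_append[of 3 ?p 10] by simp
  then have cells: "map (?u 0) [3..<3 + 10 * length (T @ [?g])] =
      concat (map (\<lambda>t. gadget_cells n t ((T @ [?g]) ! t)) [0..<length (T @ [?g])])"
  proof -
    have "map (\<lambda>t. gadget_cells n t ((T @ [?g]) ! t)) [0..<length T] = map (\<lambda>t. gadget_cells n t (T ! t)) [0..<length T]"
      by (simp add: nth_append)
    then have "concat (map (\<lambda>t. gadget_cells n t ((T @ [?g]) ! t)) [0..<length (T @ [?g])]) =
        concat (map (\<lambda>t. gadget_cells n t (T ! t)) [0..<length T]) @ gadget_cells n (length T) ?g"
      by (simp del: map_eq_conv)
    moreover have "map (s 0) [3..<?p] = concat (map (\<lambda>t. gadget_cells n t (T ! t)) [0..<length T])"
      using e by (simp add: emitted_def)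
    ultimately show ?thesis using \<open>[3..<3 + 10 * length (T @ [?g])] = _\<close> old new by simp
  qed
  have "map (?u 0) [bb..<bb + n + length T] = map (s 0) [bb..<bb + n + length T]"
    using room by (intro map_cong) (auto simp: out)
  then have "map (?u 0) [bb..<bb + n + length (T @ [?g])] = bits @ map (\<lambda>g. of_bool (fst g)) (T @ [?g])"
    using e out by (simp add: emitted_def del: map_eq_conv)
  then show ?thesis unfolding emitted_def using cells ptr' by simp
qed

definition emits :: "(bool \<times> aexp \<times> aexp) list \<Rightarrow> prog" where
  "emits gs = pseq (map emit gs)"

lemma wf_emits: "wf_prog (emits gs)" and writes_emits: "writes (emits gs) \<subseteq> {0, 13}"
  by (induction gs) (auto simp: emits_def wf_emit writes_emit)

lemma sem_emits:
  assumes "emitted bb bits n T (s 0) (s 13)" "3 + 10 * (length T + length gs) \<le> bb"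
    and "\<forall>g\<in>set gs. stable (fst (snd g)) \<and> stable (snd (snd g))"
  shows "emitted bb bits n (T @ map (\<lambda>g. (fst g, aval (fst (snd g)) s, aval (snd (snd g)) s)) gs)
    (sem (emits gs) s 0) (sem (emits gs) s 13)"
  using assms
proof (induction gs arbitrary: T s)
  case Nil
  then show ?case by (simp add: emits_def)
next
  case (Cons g gs)
  let ?u = "sem (emit g) s"
  have "emitted bb bits n (T @ [(fst g, aval (fst (snd g)) s, aval (snd (snd g)) s)]) (?u 0) (?u 13)"
    using Cons.prems by (intro sem_emit) auto
  from Cons.IH[OF this] Cons.prems
  have "emitted bb bits n ((T @ [(fst g, aval (fst (snd g)) s, aval (snd (snd g)) s)]) @
      map (\<lambda>g. (fst g, aval (fst (snd g)) ?u, aval (snd (snd g)) ?u)) gs) (sem (emits gs) ?u 0) (sem (emits gs) ?u 13)"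
    by simp
  moreover have "aval e ?u = aval e s" if "stable e" for e
    using that writes_emit[of g] by (auto simp: stable_def sem_frame)
  ultimately show ?case using Cons.prems(3) by (simp add: emits_def cong: map_cong)
qed

text \<open>The constant length \<open>m\<close> of the appended lists turns the space needed by
  nested loops into a product. The predicate \<open>G\<close> collects what the body relies on and
  preserves.\<close>

lemma emit_loop:
  assumes wf: "wf_prog (PFor x 1 p)" and x: "x \<noteq> 0" "x \<noteq> 13" and P: "s 2 1 = P"
    and pres: "\<And>u. G u \<Longrightarrow> G (sem p u)" and G_set: "\<And>u a. G u \<Longrightarrow> G (set_cell x 0 a u)"
    and body: "\<And>i u X. i < P \<Longrightarrow> G u \<Longrightarrow> u x 0 = i \<Longrightarrow> emitted bb bits n X (u 0) (u 13) \<Longrightarrow>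
      3 + 10 * (length X + m) \<le> bb \<Longrightarrow> emitted bb bits n (X @ b i) (sem p u 0) (sem p u 13)"
    and len: "\<And>i. length (b i) = m"
    and init: "G s" "emitted bb bits n X (s 0) (s 13)" "3 + 10 * (length X + P * m) \<le> bb"
  shows "emitted bb bits n (X @ concat (map b [0..<P])) (sem (PFor x 1 p) s 0) (sem (PFor x 1 p) s 13)"
proof -
  let ?I = "\<lambda>i u. G u \<and> emitted bb bits n (X @ concat (map b [0..<i])) (u 0) (u 13)"
  have "?I (s 2 1) (sem (PFor x 1 p) s)"
  proof (rule sem_For_induct[OF wf, where I = ?I])
    show "?I 0 (set_cell x 0 0 s)" using init x G_set by simp
  next
    fix i and u :: memory assume u: "i < s 2 1" "?I i u" "u x 0 = i"
    have "length (X @ concat (map b [0..<i])) = length X + i * m"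
      by (simp add: length_concat comp_def len sum_list_triv)
    moreover have "i * m + m \<le> P * m" using u(1) P by (metis Suc_leI add.commute mult_Suc mult_le_mono1)
    ultimately have "emitted bb bits n ((X @ concat (map b [0..<i])) @ b i) (sem p u 0) (sem p u 13)"
      using u P init(3) by (intro body) auto
    then show "?I (Suc i) (set_cell x 0 (Suc i) (sem p u))"
      using u x pres G_set by simp
  qed
  then show ?thesis using P by simp
qed

section \<open>Emission of the gadget blocks by three nested loops\<close>

definition eP :: "nat \<Rightarrow> aexp" where "eP c = Add (var 2 1) (cst c)"

abbreviation lock_A :: "bool \<times> aexp \<times> aexp" where "lock_A \<equiv> (False, eP 0, eP 1)"
abbreviation lock_B :: "bool \<times> aexp \<times> aexp" where "lock_B \<equiv> (True, eP 2, eP 3)"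

text \<open>The branches of each conditional emit equally many gadgets, with locks as padding. The
  adjacency test is repeated for every copy index, which costs only a polynomial factor.\<close>

definition block_prog :: "nat \<Rightarrow> nat \<Rightarrow> prog" where
  "block_prog R d = pseq
     [emits [lock_A, lock_B, lock_A, lock_B, lock_A, lock_B],
      PIf (BAnd (Less (var 12 0) (var 9 2)) (BAnd (Less (Add (var 11 0) (cst 1)) (var 9 2))
            (Less (cst 0) (Add (var 12 0) (var 11 0)))))
        (emits [(False, var 10 0, eP 0), (False, var 10 0, eP 0)])
        (emits [lock_A, lock_A]),
      decide 0 (f_compatible R d (Read 8 (var 10 0)) (Read 8 (var 11 0))),
      PIf (BAnd (Less (var 12 0) (var 9 2)) (Less (cst 0) (var (flag 0) 0)))
        (emits [(False, var 10 0, var 11 0), (True, var 10 0, eP 2), (True, var 10 0, eP 2)])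
        (emits [lock_A, lock_A, lock_A])]"

lemma writes_block_prog: "x \<in> writes (block_prog R d) \<Longrightarrow> x = 0 \<or> x = 13 \<or> 20 \<le> x"
  using writes_emits writes_decide[of x 0]
  unfolding block_prog_def by (fastforce simp: qvar_def)

lemma wf_block_prog: "wf_prog (block_prog R d)"
  by (simp add: block_prog_def wf_emits wf_decide)

lemma decoded_circuit_cong:
  assumes "decoded_circuit C s k R" "\<And>x. 2 \<le> x \<Longrightarrow> x < 10 \<Longrightarrow> u x = s x"
  shows "decoded_circuit C u k R"
  using assms by (simp add: decoded_circuit_def circuit_in_memory_def)

lemma sem_block_prog:
  assumes e: "emitted bb bits n T (s 0) (s 13)" and room: "3 + 10 * (length T + 11) \<le> bb"
    and dec: "decoded_circuit C s k R"
    and vals: "s 2 1 = P" "s 9 2 = \<kappa>" "s 10 0 = u" "s 11 0 = j" "s 12 0 = i"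
    and adj: "adj u j \<longleftrightarrow> compatible C k R d (\<lambda>l. s 7 (s 8 u + l)) (\<lambda>l. s 7 (s 8 j + l))"
  shows "emitted bb bits n (T @ block adj \<kappa> P u j i) (sem (block_prog R d) s 0) (sem (block_prog R d) s 13)"
proof -
  let ?\<phi> = "f_compatible R d (Read 8 (var 10 0)) (Read 8 (var 11 0))"
  have st: "stable (eP c)" "stable (var 10 0)" "stable (var 11 0)" for c by (simp_all add: eP_def stable_var)
  define g1 where "g1 = [lock_A, lock_B, lock_A, lock_B, lock_A, lock_B]"
  define g2 where "g2 = (if i < \<kappa> \<and> j + 1 < \<kappa> \<and> 0 < i + j
    then [(False, var 10 0, eP 0), (False, var 10 0, eP 0)] else [lock_A, lock_A])"
  define g3 where "g3 = (if i < \<kappa> \<and> adj u j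
    then [(False, var 10 0, var 11 0), (True, var 10 0, eP 2), (True, var 10 0, eP 2)] else [lock_A, lock_A, lock_A])"
  define s1 where "s1 = sem (emits g1) s"
  define s2 where "s2 = sem (emits g2) s1"
  define s3 where "s3 = sem (decide 0 ?\<phi>) s2"
  have fr1: "s1 x = s x" if "x \<noteq> 0" "x \<noteq> 13" for x
    unfolding s1_def using that writes_emits[of g1] by (intro sem_frame) auto
  have fr2: "s2 x = s x" if "x \<noteq> 0" "x \<noteq> 13" for x
    unfolding s2_def using that writes_emits[of g2] fr1 sem_frame[of x "emits g2" s1] by auto
  have fr3: "s3 x = s2 x" if "x < 20" for x
    unfolding s3_def using that by (intro decide_frame) (simp add: qvar_def)
  define gs where "gs v g = (fst g, aval (fst (snd g)) v, aval (snd (snd g)) v)" for v :: memory and g :: "bool \<times> aexp \<times> aexp"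
  have lens: "length g1 = 6" "length g2 = 2" "length g3 = 3" by (simp_all add: g1_def g2_def g3_def)
  have e1: "emitted bb bits n (T @ map (gs s) g1) (s1 0) (s1 13)"
    unfolding s1_def gs_def using e room st by (intro sem_emits) (auto simp: g1_def)
  have e2: "emitted bb bits n ((T @ map (gs s) g1) @ map (gs s1) g2) (s2 0) (s2 13)"
    unfolding s2_def gs_def[of s1] using e1 room st lens by (intro sem_emits) (auto simp: g2_def)
  have e3: "emitted bb bits n (((T @ map (gs s) g1) @ map (gs s1) g2) @ map (gs s3) g3)
      (sem (emits g3) s3 0) (sem (emits g3) s3 13)"
    unfolding gs_def[of s3] using e2 room st lens fr3[of 0] fr3[of 13] by (intro sem_emits) (auto simp: g3_def)
  interpret decoded_circuit C s2 k R d
    by (rule decoded_circuit_cong[OF dec]) (simp add: fr2)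
  have "row_of (Read 8 (var 10 0)) = (\<lambda>l. s 7 (s 8 u + l))" "row_of (Read 8 (var 11 0)) = (\<lambda>l. s 7 (s 8 j + l))"
    by (simp_all add: fun_eq_iff row_of_def fr2 vals)
  then have "fval 0 ?\<phi> s2 \<longleftrightarrow> adj u j"
    unfolding adj using fval_compatible[of s2 "Read 8 (var 10 0)" "Read 8 (var 11 0)"]
    by (simp add: ctx_def)
  then have flag: "0 < s3 (flag 0) 0 \<longleftrightarrow> adj u j"
    unfolding s3_def using sem_decide[of 0 ?\<phi> s2] wf_f_compatible by simp
  have vals3: "s3 12 0 = i" "s3 9 2 = \<kappa>" using vals by (simp_all add: fr3 fr2)
  have vals': "s 2 (Suc 0) = P" using vals(1) by simp
  have p2: "sem (PIf (BAnd (Less (var 12 0) (var 9 2)) (BAnd (Less (Add (var 11 0) (cst 1)) (var 9 2))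
            (Less (cst 0) (Add (var 12 0) (var 11 0)))))
        (emits [(False, var 10 0, eP 0), (False, var 10 0, eP 0)]) (emits [lock_A, lock_A])) s1 = s2"
    unfolding s2_def g2_def by (auto simp: fr1 vals)
  have p3: "sem (PIf (BAnd (Less (var 12 0) (var 9 2)) (Less (cst 0) (var (flag 0) 0)))
        (emits [(False, var 10 0, var 11 0), (True, var 10 0, eP 2), (True, var 10 0, eP 2)])
        (emits [lock_A, lock_A, lock_A])) s3 = sem (emits g3) s3"
    using flag vals3 unfolding g3_def by simp
  have "sem (block_prog R d) s = sem (emits g3) s3"
    unfolding block_prog_def pseq.simps sem.simps(1,3)
    using p2 p3 unfolding s3_def s1_def g1_def by (simp only:)
  moreover have "map (gs s) g1 = [(False, P, P + 1), (True, P + 2, P + 3), (False, P, P + 1), (True, P + 2, P + 3),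
      (False, P, P + 1), (True, P + 2, P + 3)]"
    by (simp add: g1_def gs_def eP_def vals')
  moreover have "map (gs s1) g2 = (if i < \<kappa> \<and> j + 1 < \<kappa> \<and> 0 < i + j then [(False, u, P), (False, u, P)]
        else [(False, P, P + 1), (False, P, P + 1)])"
    by (simp add: g2_def gs_def eP_def fr1 vals vals')
  moreover have "map (gs s3) g3 = (if i < \<kappa> \<and> adj u j then [(False, u, j), (True, u, P + 2), (True, u, P + 2)]
        else [(False, P, P + 1), (False, P, P + 1), (False, P, P + 1)])"
    by (simp add: g3_def gs_def eP_def fr3 fr2 vals vals')
  ultimately have "emitted bb bits n (T @ block adj \<kappa> P u j i) (sem (block_prog R d) s 0) (sem (block_prog R d) s 13)"
    using e3 unfolding block_def by (simp only: append_assoc)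
  then show ?thesis .
qed

definition main_prog :: "nat \<Rightarrow> nat \<Rightarrow> prog" where
  "main_prog R d = PFor 10 1 (PFor 11 1 (PFor 12 1 (block_prog R d)))"

lemma wf_main_prog: "wf_prog (main_prog R d)"
  using writes_block_prog[of _ R d] by (fastforce simp: main_prog_def wf_block_prog)

lemma writes_main_prog: "x \<in> writes (main_prog R d) \<Longrightarrow> x \<in> {0, 10, 11, 12, 13} \<or> 20 \<le> x"
  using writes_block_prog[of x R d] by (auto simp: main_prog_def)

lemma sem_main_prog:
  assumes e: "emitted bb bits n [] (s 0) (s 13)" and room: "3 + 10 * (11 * (P * P * P)) \<le> bb"
    and dec: "decoded_circuit C s k R"
    and vals: "s 2 1 = P" "s 9 2 = \<kappa>"
    and adj: "\<And>u j. adj u j \<longleftrightarrow> compatible C k R d (\<lambda>l. s 7 (s 8 u + l)) (\<lambda>l. s 7 (s 8 j + l))"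
  shows "emitted bb bits n (clique_gadgets adj \<kappa> P) (sem (main_prog R d) s 0) (sem (main_prog R d) s 13)"
proof -
  define G where "G v \<longleftrightarrow> (\<forall>x. 2 \<le> x \<and> x < 10 \<longrightarrow> v x = s x)" for v :: memory
  have G_set: "G (set_cell x 0 a v)" if "G v" "10 \<le> x" for v x a using that by (auto simp: G_def)
  have G_sem: "G (sem p v)" if "G v" "\<And>x. x \<in> writes p \<Longrightarrow> x = 0 \<or> 10 \<le> x" for p v
    using that unfolding G_def by (metis le_antisym nat_le_linear not_less sem_frame zero_neq_numeral
      le_zero_eq)
  have G_P: "v 2 1 = P" if "G v" for v using that vals by (simp add: G_def)
  note wf = wf_main_prog[of R d, unfolded main_prog_def]
  have wB: "x = 0 \<or> x = 13 \<or> 20 \<le> x" if "x \<in> writes (block_prog R d)" for x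
    using writes_block_prog[OF that] .
  have inner: "emitted bb bits n (X @ block adj \<kappa> P u j i) (sem (block_prog R d) v 0) (sem (block_prog R d) v 13)"
    if "G v" "v 10 0 = u" "v 11 0 = j" "v 12 0 = i" "emitted bb bits n X (v 0) (v 13)" "3 + 10 * (length X + 11) \<le> bb"
    for X v u j i
  proof (rule sem_block_prog[OF that(5,6), where C = C and k = k])
    show "decoded_circuit C v k R" using dec by (rule decoded_circuit_cong) (use that(1) in \<open>simp add: G_def\<close>)
    show "adj u j = compatible C k R d (\<lambda>l. v 7 (v 8 u + l)) (\<lambda>l. v 7 (v 8 j + l))"
      using that(1) adj by (simp add: G_def)
  qed (use that vals in \<open>simp_all add: G_def\<close>)
  have loop_i: "emitted bb bits n (X @ concat (map (block adj \<kappa> P u j) [0..<P]))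
      (sem (PFor 12 1 (block_prog R d)) v 0) (sem (PFor 12 1 (block_prog R d)) v 13)"
    if v: "G v" "v 10 0 = u" "v 11 0 = j" "emitted bb bits n X (v 0) (v 13)" "3 + 10 * (length X + P * 11) \<le> bb"
    for X v u j
  proof (rule emit_loop[where G = "\<lambda>v. G v \<and> v 10 0 = u \<and> v 11 0 = j" and m = 11])
    fix w assume w: "G w \<and> w 10 0 = u \<and> w 11 0 = j"
    have "sem (block_prog R d) w 10 = w 10" "sem (block_prog R d) w 11 = w 11"
      using wB by (force intro!: sem_frame)+
    then show "G (sem (block_prog R d) w) \<and> sem (block_prog R d) w 10 0 = u \<and> sem (block_prog R d) w 11 0 = j"
      using w G_sem[of w "block_prog R d"] wB by force
  next
    fix i w Y assume "i < P" "G w \<and> w 10 0 = u \<and> w 11 0 = j" "w 12 0 = i" "emitted bb bits n Y (w 0) (w 13)"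
      "3 + 10 * (length Y + 11) \<le> bb"
    then show "emitted bb bits n (Y @ block adj \<kappa> P u j i) (sem (block_prog R d) w 0) (sem (block_prog R d) w 13)"
      by (intro inner) simp_all
  next
    show "v 2 1 = P" by (rule G_P[OF v(1)])
  qed (use v wf in \<open>simp_all add: length_block G_set\<close>)
  have loop_j: "emitted bb bits n (X @ concat (map (\<lambda>j. concat (map (block adj \<kappa> P u j) [0..<P])) [0..<P]))
      (sem (PFor 11 1 (PFor 12 1 (block_prog R d))) v 0) (sem (PFor 11 1 (PFor 12 1 (block_prog R d))) v 13)"
    if v: "G v" "v 10 0 = u" "emitted bb bits n X (v 0) (v 13)" "3 + 10 * (length X + P * (P * 11)) \<le> bb"
    for X v u
  proof (rule emit_loop[where G = "\<lambda>v. G v \<and> v 10 0 = u" and m = "P * 11"])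
    fix w assume w: "G w \<and> w 10 0 = u"
    have "sem (PFor 12 1 (block_prog R d)) w 10 = w 10"
      using wB by (force intro!: sem_frame)
    then show "G (sem (PFor 12 1 (block_prog R d)) w) \<and> sem (PFor 12 1 (block_prog R d)) w 10 0 = u"
      using w G_sem[of w "PFor 12 1 (block_prog R d)"] wB by force
  next
    fix i w Y assume "i < P" "G w \<and> w 10 0 = u" "w 11 0 = i" "emitted bb bits n Y (w 0) (w 13)"
      "3 + 10 * (length Y + P * 11) \<le> bb"
    then show "emitted bb bits n (Y @ concat (map (block adj \<kappa> P u i) [0..<P]))
        (sem (PFor 12 1 (block_prog R d)) w 0) (sem (PFor 12 1 (block_prog R d)) w 13)"
      by (intro loop_i) simp_all
  next
    show "v 2 1 = P" by (rule G_P[OF v(1)])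
  qed (use v wf in \<open>simp_all add: length_block G_set length_concat comp_def sum_list_triv\<close>)
  have "emitted bb bits n ([] @ concat (map (\<lambda>u. concat (map (\<lambda>j. concat (map (block adj \<kappa> P u j) [0..<P])) [0..<P])) [0..<P]))
      (sem (PFor 10 1 (PFor 11 1 (PFor 12 1 (block_prog R d)))) s 0) (sem (PFor 10 1 (PFor 11 1 (PFor 12 1 (block_prog R d)))) s 13)"
  proof (rule emit_loop[where G = G and m = "P * (P * 11)"])
    fix w assume w: "G w"
    then show "G (sem (PFor 11 1 (PFor 12 1 (block_prog R d))) w)"
      using G_sem[of w "PFor 11 1 (PFor 12 1 (block_prog R d))"] wB by force
  next
    fix i w Y assume "i < P" "G w" "w 10 0 = i" "emitted bb bits n Y (w 0) (w 13)"
      "3 + 10 * (length Y + P * (P * 11)) \<le> bb"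
    then show "emitted bb bits n (Y @ concat (map (\<lambda>j. concat (map (block adj \<kappa> P i j) [0..<P])) [0..<P]))
        (sem (PFor 11 1 (PFor 12 1 (block_prog R d))) w 0) (sem (PFor 11 1 (PFor 12 1 (block_prog R d))) w 13)"
      by (intro loop_j) simp_all
  next
    show "s 2 1 = P" by (rule vals(1))
    show "3 + 10 * (length ([] :: gadget list) + P * (P * (P * 11))) \<le> bb" using room by (simp add: algebra_simps)
  qed (use e wf in \<open>simp_all add: length_block G_set G_def[of s] length_concat comp_def sum_list_triv\<close>)
  then show ?thesis by (simp add: main_prog_def clique_gadgets_def)
qed

section \<open>The reduction program\<close>

definition setup_prog :: "nat \<Rightarrow> prog" where
  "setup_prog R = pseq
     [parse_prog,
      PStore 18 (cst 0) (cst 1), power_prog 0 (var 2 0) 18 (4 * R),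
      PStore 19 (cst 0) (cst 1), power_prog 0 (Add (var 9 0) (cst 2)) 19 R,
      PStore 9 (cst 2) (var 19 0)]"

definition rows_prog :: prog where
  "rows_prog = pseq [PStore 16 (cst 1) (cst 0), PStore 16 (cst 2) (cst 0), PStore 16 (cst 3) (cst 0), table_prog]"

definition budget_prog :: prog where
  "budget_prog = pseq
     [PStore 19 (cst 0) (cst 1), power_prog 1 (var 9 2) 19 2, times_prog 1 (Sub (var 9 2) (cst 1)) 19,
      PStore 1 (cst 0) (Add (var 9 2) (var 19 0))]"

text \<open>There are 11 gadgets per block and 10 cells per gadget, so the side bits start at
  \<open>3 + 110 * P ^ 3\<close>.\<close>

definition pointer_prog :: prog where
  "pointer_prog = pseq
     [PStore 18 (cst 0) (cst 110), power_prog 1 (var 2 1) 18 3,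
      PStore 13 (cst 0) (cst 3), PStore 13 (cst 1) (Add (cst 3) (var 18 0)), PStore 13 (cst 2) (eP 4)]"

definition bits_prog :: prog where
  "bits_prog = pseq
     [PFor 10 1 (PSeq (PStore 0 (var 13 1) (cst 1)) (PStore 13 (cst 1) (Add (var 13 1) (cst 1)))),
      PStore 0 (var 13 1) (cst 1), PStore 0 (Add (var 13 1) (cst 1)) (cst 1),
      PStore 0 (Add (var 13 1) (cst 2)) (cst 0), PStore 0 (Add (var 13 1) (cst 3)) (cst 0),
      PStore 13 (cst 1) (Add (var 13 1) (cst 4))]"

text \<open>The word starts in cell 1, so its length is one less than the pointer to the next side
  bit. The number of gadgets is the next vertex number minus the \<open>P + 4\<close> base vertices,
  and each gadget has two edges.\<close>

definition header_prog :: prog where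
  "header_prog = pseq
     [PStore 0 (cst 1) (var 13 2),
      PStore 0 (cst 2) (Add (Sub (var 13 2) (eP 4)) (Sub (var 13 2) (eP 4))),
      PStore 0 (cst 0) (Sub (var 13 1) (cst 1))]"

definition output_prog :: "nat \<Rightarrow> nat \<Rightarrow> prog" where
  "output_prog R d = pseq [rows_prog, budget_prog, pointer_prog, bits_prog, main_prog R d, header_prog]"

text \<open>Bounds cannot be changed by a \<open>prog\<close>, so they are stored between the
  phases: first the size bound \<open>B\<close> and, once the first phase has computed
  \<open>B ^ (4 * R)\<close>, the number of rows.\<close>

definition reduction_com :: "nat \<Rightarrow> nat \<Rightarrow> com" where
  "reduction_com R d = Seq (Store 2 (cst 0) (Add (Add (var 1 0) (var 0 0)) (cst (4 * R + 2))))
     (Seq (compile (setup_prog R)) (Seq (Store 2 (cst 1) (var 18 0)) (compile (output_prog R d))))"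

lemma wf_setup_prog: "wf_prog (setup_prog R)"
  by (simp add: setup_prog_def wf_parse_prog wf_power_prog)

lemma wf_output_prog: "wf_prog (output_prog R d)"
  by (simp add: output_prog_def rows_prog_def budget_prog_def pointer_prog_def bits_prog_def header_prog_def
      wf_table_prog wf_power_prog wf_main_prog times_prog_def)

lemma length_preds_le: "i < length C \<Longrightarrow> length (preds (C ! i)) \<le> length (encode_circuit C)"
proof -
  assume "i < length C"
  then have "length (encode_gate (C ! i)) \<le> length (encode_circuit C)"
    using encode_circuit_split(1)[of i C] by simp
  moreover have "length (preds (C ! i)) \<le> length (encode_gate (C ! i))" by (cases "C ! i") auto
  ultimately show ?thesis by linarith
qed

lemma power_prog_frame: "y \<notin> {10, 17, x} \<Longrightarrow> sem (power_prog c e x n) s y = s y"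
  using writes_power_prog[of c e x n] by (intro sem_frame) auto

lemma sem_setup_prog:
  fixes C :: circuit and s :: memory and R :: nat
  assumes in0: "s 0 0 = length (encode_circuit C)" "\<And>i. i < length (encode_circuit C) \<Longrightarrow> s 0 (Suc i) = encode_circuit C ! i"
    and cap: "length (encode_circuit C) < s 2 0" "s 1 0 + 2 \<le> s 2 0"
    and zero: "\<And>i. s 4 i = 0" "\<And>i. s 5 i = 0" "\<And>i. s 9 i = 0"
  defines "u \<equiv> sem (setup_prog R) s"
  shows "circuit_in_memory C u" "u 9 0 = s 1 0" "u 9 1 = length C" "u 9 2 = (s 1 0 + 2) ^ R"
    "u 18 0 = s 2 0 ^ (4 * R)" "u 2 = s 2"
proof -
  define s1 where "s1 = sem parse_prog s"
  note parse = sem_parse_prog[OF in0 cap(1) zero, folded s1_def]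
  define s2 where "s2 = sem (power_prog 0 (var 2 0) 18 (4 * R)) (set_cell 18 0 1 s1)"
  define s3 where "s3 = sem (power_prog 0 (Add (var 9 0) (cst 2)) 19 R) (set_cell 19 0 1 s2)"
  have u: "u = set_cell 9 2 (s3 19 0) s3"
    unfolding u_def setup_prog_def s3_def s2_def s1_def by simp
  have caps1: "s1 2 = s 2" unfolding s1_def by (rule sem_caps[OF wf_parse_prog])
  have fr2: "s2 x = s1 x" if "x \<notin> {10, 17, 18}" for x
    unfolding s2_def using that by (simp add: power_prog_frame)
  have fr3: "s3 x = s2 x" if "x \<notin> {10, 17, 19}" for x
    unfolding s3_def using that by (simp add: power_prog_frame)
  have p: "s2 18 0 = s 2 0 ^ (4 * R)"
    unfolding s2_def by (subst sem_power_prog[where b = "s 2 0"]) (simp_all add: caps1)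
  have k: "s3 19 0 = (s 1 0 + 2) ^ R"
    unfolding s3_def
    by (subst sem_power_prog[where b = "s 1 0 + 2"]) (use cap parse(2) in \<open>simp_all add: fr2 caps1\<close>)
  show "circuit_in_memory C u" using parse(1) by (simp add: circuit_in_memory_def u fr3 fr2)
  show "u 9 0 = s 1 0" "u 9 1 = length C" using parse(2,3) by (simp_all add: u fr3 fr2)
  show "u 9 2 = (s 1 0 + 2) ^ R" using k by (simp add: u)
  show "u 18 0 = s 2 0 ^ (4 * R)" using p by (simp add: u fr3)
  show "u 2 = s 2" using caps1 by (simp add: u fr3 fr2)
qed

lemma writes_rows_prog: "writes rows_prog = {7, 8, 10, 11, 14, 15, 16}"
  by (auto simp: rows_prog_def writes_table_prog)

lemma sem_rows_prog:
  assumes "0 < s 2 0" "v < s 2 1" "l < s 2 0"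
  shows "sem rows_prog s 7 (sem rows_prog s 8 v + l) = v div s 2 0 ^ l mod s 2 0"
  unfolding rows_prog_def using assms by (simp, intro sem_table_prog) simp_all

lemma writes_budget_prog: "writes budget_prog \<subseteq> {1, 10, 17, 19}"
  using writes_power_prog[of 1 "var 9 2" 19 2] by (auto simp: budget_prog_def times_prog_def)

lemma sem_budget_prog:
  assumes "s 9 2 = \<kappa>" "\<kappa> \<le> s 2 1"
  shows "sem budget_prog s 1 0 = \<kappa> + \<kappa> * \<kappa> * (\<kappa> - 1)"
proof -
  define s1 where "s1 = sem (power_prog 1 (var 9 2) 19 2) (set_cell 19 0 1 s)"
  have fr: "s1 x = s x" if "x \<notin> {10, 17, 19}" for x
    unfolding s1_def using that by (simp add: power_prog_frame)
  have 1: "s1 19 0 = \<kappa> ^ 2"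
    unfolding s1_def by (subst sem_power_prog[where b = \<kappa>]) (use assms in simp_all)
  have 2: "sem (times_prog 1 (Sub (var 9 2) (cst 1)) 19) s1 19 0 = (\<kappa> - 1) * \<kappa> ^ 2"
    by (subst sem_times_prog[where b = "\<kappa> - 1"]) (use assms 1 in \<open>simp_all add: fr\<close>)
  have "sem (times_prog 1 (Sub (var 9 2) (cst 1)) 19) s1 9 = s 9"
    by (subst sem_frame) (simp_all add: times_prog_def fr)
  moreover have "sem budget_prog s = sem (PStore 1 (cst 0) (Add (var 9 2) (var 19 0)))
      (sem (times_prog 1 (Sub (var 9 2) (cst 1)) 19) s1)"
    by (simp only: budget_prog_def pseq.simps sem.simps(1,2,3) aval.simps s1_def)
  ultimately show ?thesis using assms(1) 2 by (simp add: power2_eq_square)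
qed

lemma writes_pointer_prog: "writes pointer_prog \<subseteq> {10, 13, 17, 18}"
  using writes_power_prog[of 1 "var 2 1" 18 3] by (auto simp: pointer_prog_def)

lemma sem_pointer_prog:
  assumes "s 2 1 = P"
  shows "sem pointer_prog s 13 0 = 3" "sem pointer_prog s 13 1 = 3 + 110 * (P * P * P)"
    "sem pointer_prog s 13 2 = P + 4"
proof -
  define s1 where "s1 = sem (power_prog 1 (var 2 1) 18 3) (set_cell 18 0 110 s)"
  have fr: "s1 x = s x" if "x \<notin> {10, 17, 18}" for x
    unfolding s1_def using that by (simp add: power_prog_frame)
  have "s1 18 0 = P ^ 3 * 110"
    unfolding s1_def by (subst sem_power_prog[where b = P]) (use assms in simp_all)
  moreover have "sem pointer_prog s =
      sem (pseq [PStore 13 (cst 0) (cst 3), PStore 13 (cst 1) (Add (cst 3) (var 18 0)), PStore 13 (cst 2) (eP 4)]) s1"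
    by (simp only: pointer_prog_def pseq.simps sem.simps(1,2,3) aval.simps s1_def)
  ultimately show "sem pointer_prog s 13 0 = 3" "sem pointer_prog s 13 1 = 3 + 110 * (P * P * P)"
    "sem pointer_prog s 13 2 = P + 4"
    using assms by (simp_all add: fr eP_def power3_eq_cube)
qed

lemma writes_bits_prog: "writes bits_prog = {0, 10, 13}"
  by (auto simp: bits_prog_def)

lemma sem_bits_prog:
  assumes "s 2 1 = P" "s 13 0 = 3" "s 13 1 = bb" "s 13 2 = P + 4" "3 \<le> bb"
  shows "emitted bb (map (\<lambda>v. of_bool (v < P + 2)) [0..<P + 4]) (P + 4) [] (sem bits_prog s 0) (sem bits_prog s 13)"
proof -
  let ?p = "PSeq (PStore 0 (var 13 1) (cst 1)) (PStore 13 (cst 1) (Add (var 13 1) (cst 1)))"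
  define s1 where "s1 = sem (PFor 10 1 ?p) s"
  let ?I = "\<lambda>i u. u 13 0 = 3 \<and> u 13 2 = P + 4 \<and> u 13 1 = bb + i \<and> map (u 0) [bb..<bb + i] = replicate i 1"
  have "?I (s 2 1) s1"
    unfolding s1_def
  proof (rule sem_For_induct[where I = ?I])
    fix i and u :: memory assume u: "i < s 2 1" "?I i u" "u 10 0 = i"
    have "map (\<lambda>a. if a = bb + i then Suc 0 else u 0 a) [bb..<bb + i] = map (u 0) [bb..<bb + i]" by simp
    then show "?I (Suc i) (set_cell 10 0 (Suc i) (sem ?p u))"
      using u by (simp add: replicate_append_same del: map_eq_conv)
  qed (use assms in simp_all)
  then have s1: "s1 13 0 = 3" "s1 13 2 = P + 4" "s1 13 1 = bb + P" "map (s1 0) [bb..<bb + P] = replicate P 1"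
    using assms(1) by simp_all
  define v where "v = sem bits_prog s"
  have v: "v 13 0 = 3" "v 13 2 = P + 4" "v 13 1 = bb + P + 4"
    "v 0 = (s1 0)(bb + P := 1, bb + P + 1 := 1, bb + P + 2 := 0, bb + P + 3 := 0)"
  proof -
    have "v = sem (pseq [PStore 0 (var 13 1) (cst 1), PStore 0 (Add (var 13 1) (cst 1)) (cst 1),
      PStore 0 (Add (var 13 1) (cst 2)) (cst 0), PStore 0 (Add (var 13 1) (cst 3)) (cst 0),
      PStore 13 (cst 1) (Add (var 13 1) (cst 4))]) s1"
      by (simp only: v_def bits_prog_def pseq.simps sem.simps(3) s1_def)
    then show "v 13 0 = 3" "v 13 2 = P + 4" "v 13 1 = bb + P + 4"
      "v 0 = (s1 0)(bb + P := 1, bb + P + 1 := 1, bb + P + 2 := 0, bb + P + 3 := 0)"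
      using s1(1-3) by (simp_all, simp only: fun_upd_def)
  qed
  have split: "[bb..<bb + (P + 4)] = [bb..<bb + P] @ [bb + P, bb + P + 1, bb + P + 2, bb + P + 3]"
    by (simp add: numeral_eq_Suc)
  have "map (v 0) [bb..<bb + P] = map (s1 0) [bb..<bb + P]" by (simp add: v(4))
  then have "map (v 0) [bb..<bb + (P + 4)] = replicate P 1 @ [1, 1, 0, 0]"
    unfolding split using s1(4) by (simp add: v(4) del: map_eq_conv)
  moreover have "map (\<lambda>v. of_bool (v < P + 2)) [0..<P + 4] = replicate P 1 @ [1, 1, 0, 0 :: nat]"
  proof -
    have "[0..<P + 4] = [0..<P] @ [P, P + 1, P + 2, P + 3]" by (simp add: numeral_eq_Suc)
    moreover have "map (\<lambda>v. of_bool (v < P + 2)) [0..<P] = replicate P (1::nat)"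
      by (intro replicate_eqI) auto
    ultimately show ?thesis by simp
  qed
  ultimately show ?thesis using v(1-3) unfolding emitted_def v_def[symmetric] by simp
qed

lemma holds_outputI:
  assumes "s 0 0 = length w" "map (s 0) [1..<Suc (length w)] = w" "s 1 0 = k"
  shows "holds_output s w k"
proof -
  have "s 0 (Suc i) = w ! i" if "i < length w" for i
    using arg_cong[OF assms(2), of "\<lambda>l. l ! i"] that by (simp del: upt_Suc)
  then show ?thesis using assms(1,3) by (simp add: holds_output_def)
qed

lemma length_gadget_word: "length (gadget_word n base T) = 2 + 10 * length T + n + length T"
proof -
  have "length (concat (map (\<lambda>t. gadget_cells n t (T ! t)) xs)) = 10 * length xs" for xs
    by (induction xs) (auto simp: gadget_cells_def)
  then show ?thesis by (simp add: gadget_word_def)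
qed

lemma sem_output_prog:
  assumes circ: "is_circuit C" "circuit_in_memory C s" and vals: "s 9 0 = k" "s 9 1 = length C" "s 9 2 = \<kappa>"
    and caps: "s 2 0 = B" "s 2 1 = P" "4 * R \<le> B" "length (encode_circuit C) < B" "\<kappa> \<le> P"
    and sizes: "0 < R" "P = B ^ (4 * R)"
  shows "\<exists>row. (\<forall>f. (\<forall>l<4 * R. f l < B) \<longrightarrow> (\<exists>u<P. \<forall>l<4 * R. row u l = f l)) \<and>
    holds_output (sem (output_prog R d) s)
      (gadget_word (P + 4) (\<lambda>v. v < P + 2) (clique_gadgets (\<lambda>u v. compatible C k R d (row u) (row v)) \<kappa> P))
      (\<kappa> + \<kappa> * \<kappa> * (\<kappa> - 1))"
proof -
  define s1 where "s1 = sem rows_prog s"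
  define s2 where "s2 = sem budget_prog s1"
  define s3 where "s3 = sem pointer_prog s2"
  define s4 where "s4 = sem bits_prog s3"
  define s5 where "s5 = sem (main_prog R d) s4"
  define s6 where "s6 = sem header_prog s5"
  have s6: "sem (output_prog R d) s = s6"
    by (simp add: output_prog_def s6_def s5_def s4_def s3_def s2_def s1_def)
  have fr1: "s1 x = s x" if "x < 7 \<or> x = 9" for x
    unfolding s1_def using that by (intro sem_frame) (auto simp: writes_rows_prog)
  have fr2: "s2 x = s1 x" if "x \<notin> {1, 10, 17, 19}" for x
    unfolding s2_def using that writes_budget_prog by (intro sem_frame) auto
  have fr3: "s3 x = s2 x" if "x \<notin> {10, 13, 17, 18}" for x
    unfolding s3_def using that writes_pointer_prog by (intro sem_frame) auto
  have fr4: "s4 x = s3 x" if "x \<notin> {0, 10, 13}" for x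
    unfolding s4_def using that by (intro sem_frame) (auto simp: writes_bits_prog)
  have fr5: "s5 x = s4 x" if "x < 20" "x \<notin> {0, 10, 11, 12, 13}" for x
    unfolding s5_def using that writes_main_prog[of x R d] by (intro sem_frame) auto
  define row where "row u l = s1 7 (s1 8 u + l)" for u l
  define adj where "adj u v \<longleftrightarrow> compatible C k R d (row u) (row v)" for u v
  let ?T = "clique_gadgets adj \<kappa> P" and ?n = "P + 4" and ?base = "\<lambda>v. v < P + 2"
  let ?bits = "map (\<lambda>v. of_bool (?base v)) [0..<?n] :: nat list" and ?bb = "3 + 110 * (P * P * P)"
  have B: "0 < B" using caps by simp
  have rows: "\<exists>u<P. \<forall>l<4 * R. row u l = f l" if f: "\<forall>l<4 * R. f l < B" for f
  proof -
    obtain u where u: "u < P" "\<And>l. l < 4 * R \<Longrightarrow> u div B ^ l mod B = f l"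
      using digits_surjective[of "4 * R" f B] f B sizes(2) by auto
    have "row u l = f l" if "l < 4 * R" for l
      using sem_rows_prog[of s u l] u(1) u(2)[OF that] that caps B by (simp add: row_def s1_def)
    then show ?thesis using u(1) by blast
  qed
  have K: "s2 1 0 = \<kappa> + \<kappa> * \<kappa> * (\<kappa> - 1)"
    unfolding s2_def using vals caps by (intro sem_budget_prog) (simp_all add: fr1)
  have "s2 2 1 = P" using caps by (simp add: fr2 fr1)
  from sem_pointer_prog[of s2, OF this] have ptr: "s3 13 0 = 3" "s3 13 1 = ?bb" "s3 13 2 = ?n"
    by (simp_all add: s3_def)
  have e4: "emitted ?bb ?bits ?n [] (s4 0) (s4 13)"
    unfolding s4_def using ptr caps by (intro sem_bits_prog) (simp_all add: fr3 fr2 fr1)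
  have "length (preds (C ! i)) \<le> B" if "i < length C" for i
    using length_preds_le[OF that] caps(4) by linarith
  then have "decoded_circuit C s4 k R"
    using circ vals caps unfolding decoded_circuit_def circuit_in_memory_def
    by (simp add: fr4 fr3 fr2 fr1)
  then have e5: "emitted ?bb ?bits ?n ?T (s5 0) (s5 13)"
    unfolding s5_def using e4 vals caps
    by (intro sem_main_prog) (simp_all add: fr4 fr3 fr2 fr1 adj_def row_def[abs_def])
  have len: "length ?T = 11 * (P * P * P)" by (rule length_clique_gadgets)
  then have bb: "?bb = 3 + 10 * length ?T" by simp
  let ?w = "gadget_word ?n ?base ?T"
  have ptr5: "s5 13 1 = ?bb + ?n + length ?T" "s5 13 2 = ?n + length ?T"
    and cells: "map (s5 0) [3..<3 + 10 * length ?T] = concat (map (\<lambda>t. gadget_cells ?n t (?T ! t)) [0..<length ?T])"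
    and bits: "map (s5 0) [?bb..<?bb + ?n + length ?T] = ?bits @ map (\<lambda>g. of_bool (fst g)) ?T"
    using e5 unfolding emitted_def by blast+
  have P5: "s5 2 1 = P" using caps by (simp add: fr5 fr4 fr3 fr2 fr1)
  have out: "s6 0 = (s5 0)(1 := ?n + length ?T, 2 := 2 * length ?T, 0 := ?bb + ?n + length ?T - 1)" and s61: "s6 1 = s5 1"
    unfolding s6_def header_prog_def
    using ptr5 P5 by (simp_all add: eP_def ptr5(1)[unfolded One_nat_def] P5[unfolded One_nat_def] mult_2)
  have "holds_output s6 ?w (\<kappa> + \<kappa> * \<kappa> * (\<kappa> - 1))"
  proof (rule holds_outputI)
    show "s6 0 0 = length ?w" unfolding out length_gadget_word using bb by simp
    show "s6 1 0 = \<kappa> + \<kappa> * \<kappa> * (\<kappa> - 1)" using K s61 fr5[of 1] fr4[of 1] fr3[of 1] by simp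
    have "[1..<Suc (length ?w)] = [1, 2] @ [3..<3 + 10 * length ?T] @ [?bb..<?bb + ?n + length ?T]"
    proof -
      have "[1..<Suc (length ?w)] = [1..<3 + (10 * length ?T + (?n + length ?T))]"
        by (simp add: length_gadget_word)
      also have "\<dots> = [1..<3] @ [3..<3 + 10 * length ?T] @ [3 + 10 * length ?T..<3 + 10 * length ?T + (?n + length ?T)]"
        using upt_add_eq_append[of 1 3 "10 * length ?T + (?n + length ?T)"]
          upt_add_eq_append[of 3 "3 + 10 * length ?T" "?n + length ?T"] by (simp only: add.assoc)
      also have "[1..<3] = [1, 2::nat]" by (simp add: upt_rec)
      finally show ?thesis unfolding bb by (simp only: add.assoc)
    qed
    moreover have "map (s6 0) [3..<3 + 10 * length ?T] = map (s5 0) [3..<3 + 10 * length ?T]"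
      by (intro map_cong) (auto simp: out)
    moreover have "map (s6 0) [?bb..<?bb + ?n + length ?T] = map (s5 0) [?bb..<?bb + ?n + length ?T]"
      by (intro map_cong) (auto simp: out)
    moreover have "map (s6 0) [1, 2] = [?n + length ?T, 2 * length ?T]" by (simp add: out)
    ultimately show "map (s6 0) [1..<Suc (length ?w)] = ?w"
      unfolding gadget_word_def using cells bits by (simp only: map_append)
  qed
  then show ?thesis unfolding s6 adj_def using rows by blast
qed

section \<open>Correctness and resource bounds\<close>

lemma length_le_word_size: "length w \<le> word_size w"
  by (induction w) (auto simp: word_size_def)

lemma floor_log_le_self: "floor_log a \<le> a"
proof (cases "a = 0")
  case False
  then have "2 ^ floor_log a \<le> a" by (intro floor_log_exp2_le) simp
  then show ?thesis using less_exp[of "floor_log a"] by linarith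
qed simp

text \<open>Bounding the bit length of a number by the number itself is crude, but suffices since
  vertex numbers and counts in the output are polynomially bounded.\<close>

lemma word_size_le: "(\<And>a. a \<in> set w \<Longrightarrow> a \<le> m) \<Longrightarrow> word_size w \<le> length w * (m + 1)"
proof (induction w)
  case (Cons a w)
  have "floor_log a \<le> m" using floor_log_le_self[of a] Cons.prems[of a] by simp
  moreover have "word_size w \<le> length w * (m + 1)" using Cons by simp
  ultimately show ?case by (simp add: word_size_def)
qed (simp add: word_size_def)

lemma word_size_gadget_word:
  assumes "valid_gadgets n T"
  shows "word_size (gadget_word n base T) \<le> (2 + 10 * length T + n + length T) * (2 * length T + n + 2)"
proof -
  have "a \<le> 2 * length T + n + 1" if "a \<in> set (gadget_word n base T)" for a
  proof -
    have "a \<le> 2 * length T + n + 1" if "t < length T" "a \<in> set (gadget_cells n t (T ! t))" for t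
      using valid_gadgetsD[OF assms that(1)] that by (auto simp: gadget_cells_def)
    then show ?thesis using that by (auto simp: gadget_word_def)
  qed
  then have "word_size (gadget_word n base T) \<le> length (gadget_word n base T) * (2 * length T + n + 1 + 1)"
    by (rule word_size_le)
  then show ?thesis unfolding length_gadget_word by (simp only: add.assoc one_add_one)
qed

text \<open>As \<open>R\<close> and the loop depth \<open>dep\<close> depend on the circuit depth
  alone, this is a polynomial in \<open>M\<close>.\<close>

lemma reduction_time:
  fixes P B M :: nat
  assumes P: "P = B ^ (4 * R)" and B: "1 \<le> B" "B \<le> M"
  shows "w * Suc P ^ dep \<le> w * 2 ^ dep * M ^ (4 * R * dep)"
proof -
  have "1 \<le> M ^ (4 * R)" "P \<le> M ^ (4 * R)" using B P by (auto intro: power_mono)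
  then have "Suc P \<le> 2 * M ^ (4 * R)" by linarith
  then have "Suc P ^ dep \<le> (2 * M ^ (4 * R)) ^ dep" by (intro power_mono) auto
  also have "\<dots> = 2 ^ dep * M ^ (4 * R * dep)" by (simp add: power_mult_distrib power_mult)
  finally show ?thesis by (simp add: mult.assoc)
qed

text \<open>The program runs after another reduction, so only arrays 2 to 19 are assumed to be
  cleared; those from 20 on may contain anything, as \<open>decide\<close> initialises what it
  uses.\<close>

lemma reduction_correct:
  fixes d :: nat
  defines "R \<equiv> 2 * 2 ^ d"
  shows "\<exists>A E. \<forall>C k s. is_circuit C \<longrightarrow> weft_at_most 1 C \<longrightarrow> depth_at_most d C \<longrightarrow>
    holds_output s (encode_circuit C) k \<longrightarrow> (\<forall>x i. 2 \<le> x \<longrightarrow> x < 20 \<longrightarrow> s x i = 0) \<longrightarrow>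
    (\<exists>w' k' t u. exec (reduction_com R d) s t u \<and> holds_output u w' k' \<and>
      t \<le> A * ((k + 4 * R + 2) * Suc (word_size (encode_circuit C))) ^ E \<and>
      word_size w' \<le> A * ((k + 4 * R + 2) * Suc (word_size (encode_circuit C))) ^ E \<and>
      k' \<le> (k + 4 * R + 2) ^ E \<and>
      (w', k') \<in> bipartite_2_degenerate_unit_weight_instances \<and>
      ((encode_circuit C, k) \<in> WCS \<longleftrightarrow> (w', k') \<in> LS_Max_Cut))"
proof -
  let ?S = "setup_prog R" and ?O = "output_prog R d"
  define dS where "dS = loop_depth ?S"
  define dO where "dO = loop_depth ?O"
  \<comment> \<open>The 2 stands for the two raw stores, the powers of two come from
    \<open>Suc P \<le> 2 * M ^ (4 * R)\<close>, and 4096 = 128 * 32 from the bound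
    \<open>4096 * P ^ 6\<close> on the size of the output, which also explains the last summand of
    \<open>E\<close>.\<close>
  define A where "A = 2 + weight ?S * 2 ^ dS + weight ?O * 2 ^ dO + 4096"
  define E where "E = 4 * R * dS + 4 * R * dO + 4 * R * 6"
  have R: "0 < R" by (simp add: R_def)
  show ?thesis
  proof (rule exI[of _ A], rule exI[of _ E], intro allI impI)
    fix C k s
    assume C: "is_circuit C" "weft_at_most 1 C" "depth_at_most d C"
      and s: "holds_output s (encode_circuit C) k" and zero: "\<forall>x i. 2 \<le> x \<longrightarrow> x < 20 \<longrightarrow> s x i = 0"
    let ?w = "encode_circuit C"
    define B where "B = k + length ?w + (4 * R + 2)"
    define P where "P = B ^ (4 * R)"
    define \<kappa> where "\<kappa> = (k + 2) ^ R"
    define M where "M = (k + 4 * R + 2) * Suc (word_size ?w)"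
    have "length ?w \<le> (k + 4 * R + 2) * word_size ?w"
      using length_le_word_size[of ?w] by (simp add: trans_le_add1 trans_le_add2)
    then have BM: "1 \<le> B" "B \<le> M" by (simp_all add: B_def M_def)
    have BP: "B \<le> P" using power_increasing[of 1 "4 * R" B] BM(1) R by (simp add: P_def)
    have "\<kappa> \<le> B ^ R" unfolding \<kappa>_def B_def by (intro power_mono) auto
    also have "\<dots> \<le> P" unfolding P_def using BM(1) by (intro power_increasing) auto
    finally have \<kappa>P: "\<kappa> \<le> P" .
    have \<kappa>2: "2 \<le> \<kappa>" using power_increasing[of 1 R "k + 2"] R by (simp add: \<kappa>_def)
    define s1 where "s1 = set_cell 2 0 B s"
    have in1: "s1 0 0 = length ?w" "\<And>i. i < length ?w \<Longrightarrow> s1 0 (Suc i) = ?w ! i" "s1 1 0 = k" "s1 2 0 = B"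
      using s by (simp_all add: s1_def holds_output_def)
    have e1: "exec (Store 2 (cst 0) (Add (Add (var 1 0) (var 0 0)) (cst (4 * R + 2)))) s 1 s1"
      using exec_Store[of 2 "cst 0" "Add (Add (var 1 0) (var 0 0)) (cst (4 * R + 2))" s] s
      by (simp add: s1_def B_def holds_output_def)
    define s2 where "s2 = sem ?S s1"
    have caps: "length ?w < s1 2 0" "s1 1 0 + 2 \<le> s1 2 0" unfolding in1(3,4) B_def by simp_all
    have zero1: "\<And>i. s1 4 i = 0" "\<And>i. s1 5 i = 0" "\<And>i. s1 9 i = 0" using zero by (simp_all add: s1_def)
    note prep = sem_setup_prog[OF in1(1,2) caps zero1, of R, folded s2_def, unfolded in1]
    have s1_caps: "s1 2 j \<le> P" for j using zero BP by (simp add: s1_def)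
    from exec_compile[of _ s1, OF wf_setup_prog s1_caps] obtain t2 where e2: "exec (compile ?S) s1 t2 s2"
      and t2: "t2 \<le> weight ?S * Suc P ^ dS" unfolding s2_def dS_def by blast
    define s3 where "s3 = set_cell 2 1 P s2"
    have e3: "exec (Store 2 (cst 1) (var 18 0)) s2 1 s3"
      using exec_Store[of 2 "cst 1" "var 18 0" s2] prep(5) by (simp add: s3_def P_def)
    have s3_caps: "s3 2 j \<le> P" for j using s1_caps prep(6) by (simp add: s3_def)
    from exec_compile[of _ s3, OF wf_output_prog s3_caps] obtain t4 where e4: "exec (compile ?O) s3 t4 (sem ?O s3)"
      and t4: "t4 \<le> weight ?O * Suc P ^ dO" unfolding dO_def by blast
    have "circuit_in_memory C s3" using prep(1) by (simp add: circuit_in_memory_def s3_def)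
    then obtain row where row: "\<And>f. \<forall>l<4 * R. f l < B \<Longrightarrow> \<exists>u<P. \<forall>l<4 * R. row u l = f l"
      and out: "holds_output (sem ?O s3)
        (gadget_word (P + 4) (\<lambda>v. v < P + 2) (clique_gadgets (\<lambda>u v. compatible C k R d (row u) (row v)) \<kappa> P))
        (\<kappa> + \<kappa> * \<kappa> * (\<kappa> - 1))"
      using sem_output_prog[OF C(1), of s3 k \<kappa> B P R d] prep(2-6) in1(4) R \<kappa>P
      by (auto simp: s3_def \<kappa>_def P_def B_def)
    let ?adj = "\<lambda>u v. compatible C k R d (row u) (row v)"
    let ?T = "clique_gadgets ?adj \<kappa> P"
    let ?w' = "gadget_word (P + 4) (\<lambda>v. v < P + 2) ?T" and ?k' = "\<kappa> + \<kappa> * \<kappa> * (\<kappa> - 1)"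
    interpret cut: clique_cut ?adj \<kappa> P
      by unfold_locales (use compatible_sym compatible_irrefl \<kappa>2 \<kappa>P in blast)+
    interpret clique_setting C k d R B P row
      by unfold_locales (use C row length_le_encode_circuit[of C] in \<open>auto simp: R_def B_def\<close>)
    have "(?w, k) \<in> WCS \<longleftrightarrow> (\<exists>S \<subseteq> input_nodes C. card S = k \<and> satisfies S C)"
      using C(1) by (auto simp: WCS_def encode_circuit_inject)
    also have "\<dots> \<longleftrightarrow> (\<exists>Q \<subseteq> {..<P}. card Q = \<kappa> \<and> is_clique ?adj Q)"
      unfolding \<kappa>_def using satisfying_if_clique clique_if_satisfying by metis
    also have "\<dots> \<longleftrightarrow> (?w', ?k') \<in> LS_Max_Cut"
      unfolding is_clique_def by (rule cut.LS_Max_Cut_iff_clique[symmetric])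
    finally have iff: "(?w, k) \<in> WCS \<longleftrightarrow> (?w', ?k') \<in> LS_Max_Cut" .
    have M1: "1 \<le> M" using BM by simp
    have A_le: "a * M ^ e \<le> A * M ^ E" if "a \<le> A" "e \<le> E" for a e
      using that M1 by (intro mult_mono power_increasing) auto
    have time: "1 + (t2 + (1 + t4)) \<le> A * M ^ E"
    proof -
      have "t2 \<le> (weight ?S * 2 ^ dS) * M ^ (4 * R * dS)"
        using t2 reduction_time[OF P_def BM, of "weight ?S" dS] by linarith
      also have "\<dots> \<le> (weight ?S * 2 ^ dS) * M ^ E"
        using M1 by (intro mult_left_mono power_increasing) (auto simp: E_def)
      finally have 2: "t2 \<le> (weight ?S * 2 ^ dS) * M ^ E" .
      have "t4 \<le> (weight ?O * 2 ^ dO) * M ^ (4 * R * dO)"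
        using t4 reduction_time[OF P_def BM, of "weight ?O" dO] by linarith
      also have "\<dots> \<le> (weight ?O * 2 ^ dO) * M ^ E"
        using M1 by (intro mult_left_mono power_increasing) (auto simp: E_def)
      finally have 4: "t4 \<le> (weight ?O * 2 ^ dO) * M ^ E" .
      have "2 \<le> 2 * M ^ E" using M1 by simp
      with 2 4 have "1 + (t2 + (1 + t4)) \<le> (2 + weight ?S * 2 ^ dS + weight ?O * 2 ^ dO) * M ^ E"
        by (simp only: add_mult_distrib)
      also have "\<dots> \<le> A * M ^ E" by (intro mult_right_mono) (auto simp: A_def)
      finally show ?thesis .
    qed
    have P1: "1 \<le> P" using BP BM by linarith
    have size: "word_size ?w' \<le> A * M ^ E"
    proof -
      have len: "length ?T = 11 * (P * P * P)" by (rule length_clique_gadgets)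
      have PPP: "P \<le> P * P * P" "1 \<le> P * P * P" using P1 by simp_all
      have "word_size ?w' \<le> (2 + 10 * length ?T + (P + 4) + length ?T) * (2 * length ?T + (P + 4) + 2)"
        by (rule word_size_gadget_word[OF cut.valid])
      also have "\<dots> \<le> (128 * (P * P * P)) * (32 * (P * P * P))"
        unfolding len using PPP by (intro mult_mono) linarith+
      also have "\<dots> = 4096 * ((P * P * P) * (P * P * P))" by simp
      also have "(P * P * P) * (P * P * P) = P ^ 6"
        using power_add[of P 3 3] by (simp only: power3_eq_cube) simp
      also have "4096 * P ^ 6 \<le> 4096 * (M ^ (4 * R)) ^ 6"
        unfolding P_def using BM by (intro mult_left_mono power_mono) auto
      also have "\<dots> = 4096 * M ^ (4 * R * 6)" by (simp only: power_mult)
      also have "\<dots> \<le> A * M ^ E" by (rule A_le) (auto simp: A_def E_def)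
      finally show ?thesis .
    qed
    have param: "?k' \<le> (k + 4 * R + 2) ^ E"
    proof -
      have "?k' \<le> \<kappa> * \<kappa> * \<kappa>"
      proof -
        have "\<kappa> \<le> \<kappa> * \<kappa>" using \<kappa>2 by simp
        moreover have "\<kappa> * \<kappa> * \<kappa> = \<kappa> * \<kappa> + \<kappa> * \<kappa> * (\<kappa> - 1)" using \<kappa>2 by (cases \<kappa>) (simp_all add: algebra_simps)
        ultimately show ?thesis by linarith
      qed
      also have "\<dots> = (k + 2) ^ (R * 3)" by (simp add: \<kappa>_def power_mult power3_eq_cube)
      also have "\<dots> \<le> (k + 4 * R + 2) ^ (R * 3)" by (intro power_mono) auto
      also have "\<dots> \<le> (k + 4 * R + 2) ^ E" by (intro power_increasing) (auto simp: E_def)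
      finally show ?thesis .
    qed
    have run: "exec (reduction_com R d) s (1 + (t2 + (1 + t4))) (sem ?O s3)"
      unfolding reduction_com_def by (intro exec.Seq[OF e1] exec.Seq[OF e2] exec.Seq[OF e3] e4)
    have inst: "(?w', ?k') \<in> bipartite_2_degenerate_unit_weight_instances"
      by (rule gadget_word_instance[OF cut.valid])
    show "\<exists>w' k' t u. exec (reduction_com R d) s t u \<and> holds_output u w' k' \<and>
      t \<le> A * ((k + 4 * R + 2) * Suc (word_size ?w)) ^ E \<and>
      word_size w' \<le> A * ((k + 4 * R + 2) * Suc (word_size ?w)) ^ E \<and>
      k' \<le> (k + 4 * R + 2) ^ E \<and>
      (w', k') \<in> bipartite_2_degenerate_unit_weight_instances \<and>
      ((?w, k) \<in> WCS \<longleftrightarrow> (w', k') \<in> LS_Max_Cut)"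
      using run out time size param inst iff unfolding M_def
      by (intro exI[of _ ?w'] exI[of _ ?k'] exI[of _ "1 + (t2 + (1 + t4))"] exI[of _ "sem ?O s3"] conjI)
  qed
qed

text \<open>The bounds of the second reduction refer to the output of the first. Its parameter is
  bounded in terms of \<open>k\<close> alone and its word by a polynomial times a function of
  \<open>k\<close>, so the composed bound has the same form.\<close>

lemma compose_bound:
  fixes X f g k1 n1 A c E e :: nat
  assumes "1 \<le> X" "n1 \<le> f * X ^ e" "k1 \<le> g"
  shows "A * ((k1 + c) * Suc n1) ^ E \<le> A * ((g + c) * (f + 1)) ^ E * X ^ (e + e * E)"
proof -
  have "1 \<le> X ^ e" using assms(1) by simp
  then have "Suc n1 \<le> (f + 1) * X ^ e" using assms(2) by (simp add: algebra_simps)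
  then have "(k1 + c) * Suc n1 \<le> (g + c) * ((f + 1) * X ^ e)" using assms(3) by (intro mult_mono) auto
  then have "((k1 + c) * Suc n1) ^ E \<le> ((g + c) * ((f + 1) * X ^ e)) ^ E" by (intro power_mono) auto
  also have "\<dots> = ((g + c) * (f + 1)) ^ E * X ^ (e * E)" by (simp only: power_mult_distrib power_mult mult.assoc)
  also have "\<dots> \<le> ((g + c) * (f + 1)) ^ E * X ^ (e + e * E)"
    using assms(1) by (intro mult_left_mono power_increasing) auto
  finally show ?thesis by (simp add: mult.assoc)
qed

theorem theorem1:
  shows "W_hard_on 1 bipartite_2_degenerate_unit_weight_instances LS_Max_Cut"
  unfolding W_hard_on_def
proof
  fix Pr assume "Pr \<in> W 1"
  then obtain d where "fpt_reducible_on (WCS_instances 1 d) Pr WCS" unfolding W_def by blast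
  then obtain c f g e where fg: "computable f" "computable g"
    and red: "\<And>w k. \<exists>w' k' t s. exec c (input_memory w k) t s \<and> holds_output s w' k' \<and>
          t \<le> f k * Suc (word_size w) ^ e \<and> word_size w' \<le> f k * Suc (word_size w) ^ e \<and> k' \<le> g k \<and>
          (w', k') \<in> WCS_instances 1 d \<and> ((w, k) \<in> Pr \<longleftrightarrow> (w', k') \<in> WCS)"
    unfolding fpt_reducible_on_def by blast
  \<comment> \<open>The depth \<open>d\<close> comes with the problem \<open>Pr\<close>, so
    \<open>R\<close> and with it the program are constants here.\<close>
  define R :: nat where "R = 2 * 2 ^ d"
  define cc where "cc = 4 * R + 2"
  obtain A E where main: "\<And>C k s. is_circuit C \<Longrightarrow> weft_at_most 1 C \<Longrightarrow> depth_at_most d C \<Longrightarrow>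
    holds_output s (encode_circuit C) k \<Longrightarrow> (\<And>x i. 2 \<le> x \<Longrightarrow> x < 20 \<Longrightarrow> s x i = 0) \<Longrightarrow>
    \<exists>w' k' t u. exec (reduction_com R d) s t u \<and> holds_output u w' k' \<and>
      t \<le> A * ((k + cc) * Suc (word_size (encode_circuit C))) ^ E \<and>
      word_size w' \<le> A * ((k + cc) * Suc (word_size (encode_circuit C))) ^ E \<and>
      k' \<le> (k + cc) ^ E \<and>
      (w', k') \<in> bipartite_2_degenerate_unit_weight_instances \<and>
      ((encode_circuit C, k) \<in> WCS \<longleftrightarrow> (w', k') \<in> LS_Max_Cut)"
    using reduction_correct[of d] unfolding R_def[symmetric] cc_def add.assoc by blast
  \<comment> \<open>Arrays 0 and 1 stay in place to hand over input and output; all others move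
    beyond 19, so that arrays 2 to 19 are still zero when \<open>reduction_com\<close>
    starts.\<close>
  define \<rho> where "\<rho> x = (if x < 2 then x else x + 18)" for x :: nat
  have inj: "inj \<rho>" by (auto simp: inj_def \<rho>_def split: if_splits)
  define F where "F k = f k + A * ((g k + cc) * (f k + 1)) ^ E" for k
  define G where "G k = (g k + cc) ^ E" for k
  have "computable F"
    unfolding F_def by (intro computable_add computable_mult computable_power computable_const fg)
  moreover have "computable G"
    unfolding G_def by (intro computable_add computable_power computable_const fg)
  moreover have "\<exists>w' k' t s. exec (Seq (rename_com \<rho> c) (reduction_com R d)) (input_memory w k) t s \<and>
      holds_output s w' k' \<and> t \<le> F k * Suc (word_size w) ^ (e + e * E) \<and>
      word_size w' \<le> F k * Suc (word_size w) ^ (e + e * E) \<and> k' \<le> G k \<and>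
      (w', k') \<in> bipartite_2_degenerate_unit_weight_instances \<and> ((w, k) \<in> Pr \<longleftrightarrow> (w', k') \<in> LS_Max_Cut)" for w k
  proof -
    let ?X = "Suc (word_size w)"
    obtain w1 k1 t1 s1 where r: "exec c (input_memory w k) t1 s1" "holds_output s1 w1 k1"
      "t1 \<le> f k * ?X ^ e" "word_size w1 \<le> f k * ?X ^ e" "k1 \<le> g k"
      "(w1, k1) \<in> WCS_instances 1 d" "(w, k) \<in> Pr \<longleftrightarrow> (w1, k1) \<in> WCS"
      using red[of w k] by blast
    have "input_memory w k (\<rho> x) = input_memory w k x" for x
      by (auto simp: \<rho>_def input_memory_def fun_eq_iff)
    from exec_rename[OF r(1) inj this] obtain u1 where u1: "exec (rename_com \<rho> c) (input_memory w k) t1 u1"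
      "\<And>x. u1 (\<rho> x) = s1 x" "\<And>y. y \<notin> range \<rho> \<Longrightarrow> u1 y = input_memory w k y" by blast
    have "u1 0 = s1 0" "u1 1 = s1 1" using u1(2)[of 0] u1(2)[of 1] by (simp_all add: \<rho>_def)
    then have out1: "holds_output u1 w1 k1" using r(2) by (simp add: holds_output_def)
    have zero: "u1 x i = 0" if "2 \<le> x" "x < 20" for x i
    proof -
      have "x \<notin> range \<rho>" using that by (auto simp: \<rho>_def)
      then show ?thesis using u1(3) that by (simp add: input_memory_def)
    qed
    obtain C where C: "w1 = encode_circuit C" "is_circuit C" "weft_at_most 1 C" "depth_at_most d C"
      using r(6) by (auto simp: WCS_instances_def)
    obtain w2 k2 t2 u2 where m: "exec (reduction_com R d) u1 t2 u2" "holds_output u2 w2 k2"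
      "t2 \<le> A * ((k1 + cc) * Suc (word_size w1)) ^ E" "word_size w2 \<le> A * ((k1 + cc) * Suc (word_size w1)) ^ E"
      "k2 \<le> (k1 + cc) ^ E" "(w2, k2) \<in> bipartite_2_degenerate_unit_weight_instances"
      "(w1, k1) \<in> WCS \<longleftrightarrow> (w2, k2) \<in> LS_Max_Cut"
      using main[OF C(2-4) out1[unfolded C(1)] zero] unfolding C(1) by blast
    note cb = compose_bound[of ?X "word_size w1" "f k" e k1 "g k" A cc E, OF _ r(4,5)]
    have "f k * ?X ^ e \<le> f k * ?X ^ (e + e * E)" by (intro mult_left_mono power_increasing) auto
    then have t1: "t1 \<le> f k * ?X ^ (e + e * E)" using r(3) by linarith
    have cb': "A * ((k1 + cc) * Suc (word_size w1)) ^ E \<le> A * ((g k + cc) * (f k + 1)) ^ E * ?X ^ (e + e * E)"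
      by (rule cb) simp
    have F: "F k * ?X ^ (e + e * E) = f k * ?X ^ (e + e * E) + A * ((g k + cc) * (f k + 1)) ^ E * ?X ^ (e + e * E)"
      unfolding F_def add_mult_distrib ..
    have "t1 + t2 \<le> F k * ?X ^ (e + e * E)"
      unfolding F using t1 order.trans[OF m(3) cb'] by (rule add_mono)
    moreover have "word_size w2 \<le> F k * ?X ^ (e + e * E)"
      unfolding F using order.trans[OF m(4) cb'] by (rule trans_le_add2)
    moreover have "k2 \<le> G k"
      using m(5) power_mono[of "k1 + cc" "g k + cc" E] r(5) unfolding G_def by simp
    ultimately show ?thesis
      using exec.Seq[OF u1(1) m(1)] m(2,6,7) r(7)
      by (intro exI[of _ w2] exI[of _ k2] exI[of _ "t1 + t2"] exI[of _ u2] conjI) simp_all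
  qed
  ultimately show "fpt_reducible_on bipartite_2_degenerate_unit_weight_instances Pr LS_Max_Cut"
    unfolding fpt_reducible_on_def by blast
qed

end
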